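(* Assume $\alpha=1/2$ and $\phi>0$. Then, as $n\to\infty$, $$\frac{S_n-\mathbb{E}[S_n]}{\sqrt{\phi\, n\log n}}\xrightarrow{d}N(0,1),$$ and $$\limsup_{n\to\infty}\pm\frac{S_n-\mathbb{E}[S_n]}{\sqrt{2\phi\, n\,\log n\,\log\log\!\big(\phi\,\Gamma(3/2)\log n\big)}}=1\quad\text{almost surely}.$$
   Context: Fix $p,q,r\ge 0$ with $p+q+r=1$ and $\theta\in[0,1)$. Let $(X_n)_{n\ge1}$ be random variables with values in $\{-1,0,+1\}$ such that $\mathbb{P}(X_1=+1)=p$, $\mathbb{P}(X_1=-1)=q$, $\mathbb{P}(X_1=0)=r$. Let $\mathcal F_n=\sigma(X_1,\dots,X_n)$. For $n\ge1$ let $n_+,n_-,n_0$ denote the number of indices $i\in\{1,\dots,n\}$ with $X_i=+1$, $X_i=-1$, $X_i=0$ respectively. The conditional law of $X_{n+1}$ is $\mathbb{P}(X_{n+1}=+1\mid\mathcal F_n)=\theta\big(\tfrac{n_+}{n}p+\tfrac{n_-}{n}q\big)+(1-\theta)p$, $\mathbb{P}(X_{n+1}=-1\mid\mathcal F_n)=\theta\big(\tfrac{n_-}{n}p+\tfrac{n_+}{n}q\big)+(1-\theta)q$, $\mathbb{P}(X_{n+1}=0\mid\mathcal F_n)=\theta(p+q)\tfrac{n_0}{n}+r$. Set $S_0=0$, $S_n=\sum_{i=1}^n X_i$. Notation: $\alpha=(p-q)\theta$, $\omega=(p-q)(1-\theta)$, $\tau=(1-\theta)(p+q)$, $\gamma=(p+q)\theta$,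 $\phi=\frac{\tau}{1-\gamma}-\left(\frac{\omega}{1-\alpha}\right)^2$. *)

theory Defs
  imports "HOL-Probability.Probability"
begin

definition nat_filtr :: "'a measure \<Rightarrow> (nat \<Rightarrow> 'a \<Rightarrow> real) \<Rightarrow> nat \<Rightarrow> 'a measure" where
  "nat_filtr M X n = sigma (space M)
     {X i -` A \<inter> space M | i A. i \<in> {1..n} \<and> A \<in> sets borel}"

end

(*
  The centred walk, multiplied by weights of order n^(-1/2), is a martingale with bounded
  innovations xi_k and increments b_k xi_k, b_k ~ k^(-1/2), so its variance grows like
  phi * ln n. The conditional variance of xi_k is a quadratic function of the two empirical
  averages S_k/k and N_k/k (N counts the nonzero steps), which contract to constants at a
  polynomial rate in mean square, even conditionally on the past. Since the clock is
  logarithmic, all errors this causes are summable.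

  Central limit theorem: E exp(i t W_n) is compared step by step with exp(-t^2 phi V_n / 2).
  Upper half of the iterated logarithm: exponential supermartingale and maximal inequality
  along blocks ln n ~ rho^j. Lower half: on blocks with ln n ~ R^j the conditional exponential
  moments are bounded from both sides; comparing those at lambda and (1 +- delta) lambda shows that
  the exponentially tilted increment concentrates, which yields a conditional lower bound
  for the tail, and a sequential Borel-Cantelli argument finishes the proof.
*)
theory Submission
  imports Defs "HOL-Real_Asymp.Real_Asymp"
begin

section \<open>Elementary estimates\<close>

text \<open>The number \<phi> is the limiting conditional variance: the two empirical averages
  settle at \<open>activity\<close> and \<open>drift\<close>, the fixed points of their conditional
  mean maps, and the conditional second moment minus the squared conditional mean tends to
  \<open>activity - drift\<^sup>2\<close>. The lower half of the iterated logarithm shapes the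
  proof. It needs estimates that are uniform over all past events, although the conditional variance
  is random and the exponential tilt could favour exactly the paths on which it is atypical. What
  makes this harmless is a difference of scales: over block j the exponential moments in question
  grow only like a power of j, while the mean-square fluctuation of the conditional variance is of
  size exp(-const * R^j). Young's inequality together with a very crude moment bound therefore
  suffices. Conditioning is expressed by integrals against bounded measurable functions or
  indicators; conditional expectations enter only where the transition law is read off.\<close>

lemma exp_cubic_remainder:
  fixes x :: real
  assumes "\<bar>x\<bar> \<le> 1"
  shows "\<bar>exp x - (1 + x + x\<^sup>2 / 2)\<bar> \<le> \<bar>x\<bar> ^ 3 / 2"
proof -
  obtain t where t: "\<bar>t\<bar> \<le> \<bar>x\<bar>" "exp x = (\<Sum>m<3. (x ^ m) / fact m) + (exp t / fact 3) * x ^ 3"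
    using Maclaurin_exp_le[of x 3] by blast
  have "exp t \<le> exp 1" using t(1) assms by simp
  also have "exp 1 \<le> (3::real)" by (rule exp_le)
  finally have e: "exp t \<le> 3" .
  have f: "exp x - (1 + x + x\<^sup>2 / 2) = exp t / 6 * x ^ 3"
    using t(2) by (simp add: eval_nat_numeral fact_Suc)
  have "\<bar>exp t / 6 * x ^ 3\<bar> = exp t / 6 * \<bar>x\<bar> ^ 3"
    by (simp add: abs_mult power_abs)
  also have "\<dots> \<le> 3 / 6 * \<bar>x\<bar> ^ 3"
    using e by (intro mult_right_mono) auto
  finally show ?thesis unfolding f by simp
qed

text \<open>Absorbing the cubic remainder into the quadratic term costs only a factor 1 \<plusminus>
  \<open>\<epsilon>\<close>, so that bounds for exponential moments keep the form of a conditional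
  second moment.\<close>

lemma exp_sandwich:
  fixes x \<epsilon> :: real
  assumes "\<bar>x\<bar> \<le> 1" "\<bar>x\<bar> \<le> \<epsilon>"
  shows "exp x \<le> 1 + x + (1 + \<epsilon>) * x\<^sup>2 / 2" "1 + x + (1 - \<epsilon>) * x\<^sup>2 / 2 \<le> exp x"
proof -
  have "\<bar>x\<bar> ^ 3 = \<bar>x\<bar> * x\<^sup>2" by (simp add: eval_nat_numeral)
  also have "\<dots> \<le> \<epsilon> * x\<^sup>2" using assms by (intro mult_right_mono) auto
  finally have *: "\<bar>x\<bar> ^ 3 \<le> \<epsilon> * x\<^sup>2" .
  have **: "\<bar>exp x - (1 + x + x\<^sup>2 / 2)\<bar> \<le> \<epsilon> * x\<^sup>2 / 2"
    using exp_cubic_remainder[OF assms(1)] * by linarith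
  show "exp x \<le> 1 + x + (1 + \<epsilon>) * x\<^sup>2 / 2" "1 + x + (1 - \<epsilon>) * x\<^sup>2 / 2 \<le> exp x"
    using ** by (simp_all only: abs_le_iff ring_distribs add_divide_distrib diff_divide_distrib) linarith+
qed

lemma exp_le_quadratic:
  fixes x :: real
  assumes "\<bar>x\<bar> \<le> 1"
  shows "exp x \<le> 1 + x + x\<^sup>2"
  using exp_sandwich(1)[OF assms, of 1] assms by simp

lemma tendsto_real_imp_bounded:
  fixes f :: "nat \<Rightarrow> real"
  assumes "f \<longlonglongrightarrow> l"
  obtains K where "K > 0" "\<And>n. \<bar>f n\<bar> \<le> K"
  using convergent_imp_Bseq[OF convergentI[OF assms]] by (auto elim!: BseqE)

text \<open>Terms that differ from 1/(k+1) by o(1/k) change the harmonic sum by o(ln n): a fixed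
  initial segment stays bounded, and beyond it the differences are a small multiple of the harmonic
  terms.\<close>

lemma sum_sim_ln:
  fixes x :: "nat \<Rightarrow> real"
  assumes "(\<lambda>k. x k * real (Suc k)) \<longlonglongrightarrow> 1"
  shows "(\<lambda>n. (\<Sum>k<n. x k) / ln (real n)) \<longlonglongrightarrow> 1"
proof -
  define H where "H n = (\<Sum>k<n. 1 / real (Suc k))" for n
  have H: "H = harm"
  proof
    show "H n = harm n" for n
      by (induction n) (auto simp: H_def harm_Suc harm_def divide_inverse)
  qed
  have Hln: "(\<lambda>n. H n / ln (real n)) \<longlonglongrightarrow> 1"
  proof -
    have "(\<lambda>n. (harm n - ln (real n)) / ln (real n) + 1) \<longlonglongrightarrow> 0 + 1"
      by (intro tendsto_add tendsto_const real_tendsto_divide_at_top[OF euler_mascheroni_LIMSEQ]) real_asymp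
    moreover have "eventually (\<lambda>n. (harm n - ln (real n)) / ln (real n) + 1 = H n / ln (real n)) sequentially"
      using eventually_gt_at_top[of 1] by eventually_elim (auto simp: H field_simps)
    ultimately show ?thesis using Lim_transform_eventually by fastforce
  qed
  have "(\<lambda>n. ((\<Sum>k<n. x k) - H n) / ln (real n)) \<longlonglongrightarrow> 0"
  proof (rule LIMSEQ_I)
    fix e :: real assume e: "e > 0"
    obtain k0 where k0: "\<And>k. k \<ge> k0 \<Longrightarrow> \<bar>x k * real (Suc k) - 1\<bar> \<le> e / 4"
      using LIMSEQ_D[OF assms, of "e/4"] e by (force intro: less_imp_le)
    define c where "c = (\<Sum>k<k0. \<bar>x k - 1 / real (Suc k)\<bar>)"
    have bd: "\<bar>x k - 1 / real (Suc k)\<bar> \<le> e / 4 * (1 / real (Suc k))" if "k \<ge> k0" for k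
    proof -
      have "x k - 1 / real (Suc k) = (x k * real (Suc k) - 1) * (1 / real (Suc k))"
        by (simp add: field_simps)
      then have "\<bar>x k - 1 / real (Suc k)\<bar> = \<bar>x k * real (Suc k) - 1\<bar> * (1 / real (Suc k))"
        by (simp only: abs_mult) simp
      also have "\<dots> \<le> e / 4 * (1 / real (Suc k))"
        using k0[OF that] by (intro mult_right_mono) auto
      finally show ?thesis .
    qed
    have main: "\<bar>(\<Sum>k<n. x k) - H n\<bar> \<le> c + e / 4 * H n" for n
    proof -
      have "\<bar>(\<Sum>k<n. x k) - H n\<bar> \<le> (\<Sum>k<n. \<bar>x k - 1 / real (Suc k)\<bar>)"
        unfolding H_def by (simp only: sum_subtractf[symmetric] sum_abs)
      also have "\<dots> \<le> (\<Sum>k<n. (if k < k0 then \<bar>x k - 1 / real (Suc k)\<bar> else 0) + e / 4 * (1 / real (Suc k)))"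
        using bd e by (intro sum_mono) (auto simp del: of_nat_Suc)
      also have "\<dots> = (\<Sum>k\<in>{..<n} \<inter> {..<k0}. \<bar>x k - 1 / real (Suc k)\<bar>) + e / 4 * H n"
        unfolding H_def sum.distrib sum_distrib_left
        by (simp add: sum.inter_restrict del: of_nat_Suc)
      also have "(\<Sum>k\<in>{..<n} \<inter> {..<k0}. \<bar>x k - 1 / real (Suc k)\<bar>) \<le> c"
        unfolding c_def by (intro sum_mono2) auto
      finally show ?thesis by simp
    qed
    \<comment> \<open>The initial segment costs e/4 and the tail at most e/4 * 2, because
      \<open>H n\<close> is eventually below 2 ln n.\<close>
    have "eventually (\<lambda>n. c / ln (real n) < e / 4) sequentially"
      using e by real_asymp
    moreover have "eventually (\<lambda>n. H n / ln (real n) < 2) sequentially"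
      using Hln by (intro order_tendstoD(2)[OF Hln]) auto
    moreover have "eventually (\<lambda>n. ln (real n) > 0) sequentially"
      by real_asymp
    ultimately have "eventually (\<lambda>n. norm (((\<Sum>k<n. x k) - H n) / ln (real n) - 0) < e) sequentially"
    proof eventually_elim
      case (elim n)
      have "\<bar>(\<Sum>k<n. x k) - H n\<bar> / ln (real n) \<le> (c + e / 4 * H n) / ln (real n)"
        using main[of n] elim by (intro divide_right_mono) auto
      also have "\<dots> = c / ln (real n) + e / 4 * (H n / ln (real n))"
        by (simp add: add_divide_distrib)
      also have "\<dots> < e / 4 + e / 4 * 2"
        using elim e by (intro add_strict_mono mult_strict_left_mono) auto
      also have "\<dots> < e" using e by simp
      finally show ?case using elim by simp
    qed
    then show "\<exists>no. \<forall>n\<ge>no. norm (((\<Sum>k<n. x k) - H n) / ln (real n) - 0) < e"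
      by (simp add: eventually_sequentially)
  qed
  from tendsto_add[OF this Hln] show ?thesis
    by (simp add: diff_divide_distrib)
qed

text \<open>Interpolation on the logarithmic clock: every large n lies in exactly one block
  (\<rho>^j, \<rho>^(j+1)] of ln n, found through the least exponent that reaches ln n, and ln n >
  \<rho>^J forces the block index to be at least J.\<close>

lemma eventually_geometric_blocks:
  fixes \<rho> :: real
  assumes \<rho>: "\<rho> > 1" and P: "eventually P sequentially"
    and block: "\<And>j n. P j \<Longrightarrow> \<rho> ^ j < ln (real n) \<Longrightarrow> ln (real n) \<le> \<rho> ^ Suc j \<Longrightarrow> R n"
  shows "eventually R sequentially"
proof -
  obtain J where J: "\<And>j. j \<ge> J \<Longrightarrow> P j" using P by (auto simp: eventually_sequentially)
  have "eventually (\<lambda>n. ln (real n) > \<rho> ^ J) sequentially" by real_asymp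
  moreover have "eventually (\<lambda>n. ln (real n) > 1) sequentially" by real_asymp
  ultimately show ?thesis
  proof eventually_elim
    case (elim n)
    obtain m where "ln (real n) < \<rho> ^ m" using real_arch_pow[OF \<rho>] by blast
    then have ex: "\<exists>m. ln (real n) \<le> \<rho> ^ m" by (auto intro: less_imp_le)
    define m where "m = (LEAST m. ln (real n) \<le> \<rho> ^ m)"
    have m: "ln (real n) \<le> \<rho> ^ m" unfolding m_def using ex by (rule LeastI_ex)
    have m0: "m \<noteq> 0" using m elim by (cases m) auto
    then obtain j where j: "m = Suc j" by (cases m) auto
    have lt: "\<rho> ^ j < ln (real n)"
      using not_less_Least[of j "\<lambda>m. ln (real n) \<le> \<rho> ^ m"] j by (auto simp: m_def[symmetric])
    have "\<rho> ^ J < \<rho> ^ Suc j" using elim m j by simp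
    then have "J < Suc j" using \<rho> power_strict_increasing_iff by blast
    then show "R n" using block[of j n] J[of j] lt m j by simp
  qed
qed

text \<open>Partial converse of 1 + y <= exp y. It turns a lower recursion with factors 1 + y into
  an exponential lower bound, at the price of a factor 1 - \<open>\<epsilon>\<close> in the
  exponent.\<close>

lemma exp_shrunk_le_one_plus:
  fixes y \<epsilon> :: real
  assumes "0 \<le> y" "y \<le> \<epsilon>" "\<epsilon> \<le> 1"
  shows "exp ((1 - \<epsilon>) * y) \<le> 1 + y"
proof -
  define z where "z = (1 - \<epsilon>) * y"
  have z: "0 \<le> z" "z \<le> y" using assms by (auto simp: z_def mult_left_le_one_le)
  have "exp z \<le> 1 + z + z\<^sup>2" using exp_le_quadratic[of z] z assms by auto
  also have "z\<^sup>2 \<le> \<epsilon> * y"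
    unfolding power2_eq_square using z assms by (intro mult_mono) auto
  finally show ?thesis by (simp add: z_def algebra_simps)
qed

text \<open>Completing the square: for both signs the exponent per unit of \<open>L\<close> is 1/2 -
  \<delta>^2/2 up to a multiple of \<open>e\<close>, so it lies \<delta>^2/2 below 1/2. The errors
  in \<open>e\<close> consume at most \<delta>^2/4; what remains, times \<open>L\<close>, is at
  least 2, and exp 2 >= 4. The third bound is the exponent that survives as the cost of the middle
  region.\<close>

lemma tilted_exponents:
  fixes \<delta> e L :: real
  assumes \<delta>: "0 < \<delta>" "\<delta> \<le> 1 / 2" and e: "0 \<le> e" "e \<le> \<delta>\<^sup>2 / 8" and L: "8 \<le> L * \<delta>\<^sup>2"
  shows "4 * exp (L * ((1 + \<delta>)\<^sup>2 * (1 + e) / 2 - \<delta> * (1 + \<delta>))) \<le> exp (L * (1 - e) / 2)"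
    and "4 * exp (L * ((1 - \<delta>)\<^sup>2 * (1 + e) / 2 + \<delta> * (1 - \<delta>))) \<le> exp (L * (1 - e) / 2)"
    and "L * (1 + \<delta>) - L * (1 - e) / 2 \<le> L * (1 / 2 + 2 * \<delta>)"
proof -
  have L0: "L > 0" using L \<delta> by (metis less_le_trans zero_less_numeral zero_less_mult_pos2 zero_less_power)
  have 4: "4 * exp a \<le> exp c" if "a + 2 \<le> c" for a c :: real
  proof -
    have "(4::real) \<le> exp 2"
      using exp_lower_Taylor_quadratic[of "2::real"] by simp
    then have "4 * exp a \<le> exp 2 * exp a" by (intro mult_right_mono) auto
    also have "\<dots> = exp (a + 2)" by (simp add: exp_add)
    also have "\<dots> \<le> exp c" using that by simp
    finally show ?thesis .
  qed
  have sq: "(1 + \<delta>)\<^sup>2 \<le> 9 / 4" "(1 - \<delta>)\<^sup>2 \<le> 9 / 4"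
    using power_mono[of "1 + \<delta>" "3/2" 2] power_mono[of "1 - \<delta>" "3/2" 2] \<delta> by (simp_all add: power_divide)
  have *: "L * (1 / 2 - \<delta>\<^sup>2 / 2 + q * e / 2) + 2 \<le> L * (1 - e) / 2" if "q \<le> 9 / 4" for q
  proof -
    have "q * e \<le> 9 / 4 * e" using that e by (intro mult_right_mono) auto
    then have "1 / 2 - \<delta>\<^sup>2 / 2 + q * e / 2 \<le> (1 - e) / 2 - \<delta>\<^sup>2 / 4" using e by (simp add: field_simps)
    then have "L * (1 / 2 - \<delta>\<^sup>2 / 2 + q * e / 2) \<le> L * ((1 - e) / 2 - \<delta>\<^sup>2 / 4)" using L0 by (intro mult_left_mono) auto
    also have "L * ((1 - e) / 2 - \<delta>\<^sup>2 / 4) = L * (1 - e) / 2 - L * \<delta>\<^sup>2 / 4" by (simp add: field_simps)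
    finally show ?thesis using L by linarith
  qed
  have e1: "(1 + \<delta>)\<^sup>2 * (1 + e) / 2 - \<delta> * (1 + \<delta>) = 1 / 2 - \<delta>\<^sup>2 / 2 + (1 + \<delta>)\<^sup>2 * e / 2"
    by (simp add: power2_eq_square field_simps)
  have e2: "(1 - \<delta>)\<^sup>2 * (1 + e) / 2 + \<delta> * (1 - \<delta>) = 1 / 2 - \<delta>\<^sup>2 / 2 + (1 - \<delta>)\<^sup>2 * e / 2"
    by (simp add: power2_eq_square field_simps)
  show "4 * exp (L * ((1 + \<delta>)\<^sup>2 * (1 + e) / 2 - \<delta> * (1 + \<delta>))) \<le> exp (L * (1 - e) / 2)"
    unfolding e1 by (intro 4 * sq)
  show "4 * exp (L * ((1 - \<delta>)\<^sup>2 * (1 + e) / 2 + \<delta> * (1 - \<delta>))) \<le> exp (L * (1 - e) / 2)"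
    unfolding e2 by (intro 4 * sq)
  have "\<delta>\<^sup>2 \<le> \<delta>" using \<delta> by (simp add: power2_eq_square mult_left_le)
  then have "(1 + \<delta>) - (1 - e) / 2 \<le> 1 / 2 + 2 * \<delta>" using e \<delta> by (simp add: field_simps)
  then have "L * ((1 + \<delta>) - (1 - e) / 2) \<le> L * (1 / 2 + 2 * \<delta>)" using L0 by (intro mult_left_mono) auto
  then show "L * (1 + \<delta>) - L * (1 - e) / 2 \<le> L * (1 / 2 + 2 * \<delta>)" by (simp add: right_diff_distrib)
qed

text \<open>Multiplied by \<open>real (Suc i) powr (1 - g)\<close>, the normalized sequence \<open>e i / i\<^sup>2\<close> has summable increments.\<close>

lemma second_moment_growth:
  fixes g :: real
  assumes g: "1 / 2 \<le> g" "g < 1"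
  obtains D where "D > 0" "\<And>e m k P. P \<ge> 0 \<Longrightarrow> m \<ge> 1 \<Longrightarrow> m\<^sup>2 \<le> k \<Longrightarrow> (\<And>i. e i \<ge> 0) \<Longrightarrow> e m \<le> 4 * P * (real m)\<^sup>2 \<Longrightarrow>
    (\<And>i. i \<ge> m \<Longrightarrow> e (Suc i) \<le> (1 + g / real i)\<^sup>2 * e i + 4 * P) \<Longrightarrow>
    e k \<le> D * P * (real k)\<^sup>2 * real (Suc k) powr (- ((1 - g) / 2))"
proof -
  define \<delta> where "\<delta> = 1 - g"
  have \<delta>: "0 < \<delta>" "\<delta> \<le> 1 / 2" using g by (auto simp: \<delta>_def)
  \<comment> \<open>The noise at time i is weighted by a power \<delta> <= 1/2 and divided by the
    square of i+1, which leaves the exponent -3/2; this is where g >= 1/2 enters.\<close>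
  have sm: "summable (\<lambda>k. real (Suc k) powr (-3/2))"
    by (subst summable_Suc_iff) (simp add: summable_real_powr_iff)
  define Z where "Z = (\<Sum>k. real (Suc k) powr (-3/2))"
  have Z0: "Z \<ge> 0" unfolding Z_def by (intro suminf_nonneg sm) simp
  show thesis
  proof (rule that[of "8 * (1 + Z)"])
    show "8 * (1 + Z) > 0" using Z0 by simp
    fix e :: "nat \<Rightarrow> real" and m k P
    assume P: "P \<ge> (0::real)" and m: "m \<ge> (1::nat)" and mk: "m\<^sup>2 \<le> k" and e0: "\<And>i. e i \<ge> 0"
      and em: "e m \<le> 4 * P * (real m)\<^sup>2"
      and step: "\<And>i. i \<ge> m \<Longrightarrow> e (Suc i) \<le> (1 + g / real i)\<^sup>2 * e i + 4 * P"
    have mk': "m \<le> k" using mk by (rule power2_nat_le_imp_le)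
    define G where "G i = real (Suc i) powr \<delta> * (e i / (real i)\<^sup>2)" for i
    have G_step: "G (Suc i) \<le> G i + 8 * P * real (Suc i) powr (-3/2)" if i: "i \<ge> m" for i
    proof -
      have i0: "real i > 0" using i m by simp
      \<comment> \<open>After normalization by squares the expanding factor 1 + g/i becomes the
        contraction 1 - w.\<close>
      define w where "w = \<delta> / real (Suc i)"
      have w: "0 \<le> w" "w \<le> 1" using \<delta> by (auto simp: w_def divide_le_eq)
      have eq: "(1 + g / real i) / real (Suc i) = (1 - w) / real i"
        using i0 by (simp add: w_def \<delta>_def field_simps)
      have "ln (real (Suc (Suc i)) / real (Suc i)) \<le> 1 / real (Suc i)"
        using ln_le_minus_one[of "real (Suc (Suc i)) / real (Suc i)"] by (simp add: field_simps)
      then have "\<delta> * (ln (real (Suc (Suc i))) - ln (real (Suc i))) \<le> \<delta> * (1 / real (Suc i))"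
        using \<delta> by (intro mult_left_mono) (auto simp: ln_div)
      then have lnw: "\<delta> * ln (real (Suc (Suc i))) - w \<le> \<delta> * ln (real (Suc i))"
        by (simp add: w_def algebra_simps)
      \<comment> \<open>One of the two factors 1 - w is given away; the other, at most exp(-w),
        already offsets the growth of the weight with exponent \<delta> from i+1 to i+2.\<close>
      have "(1 - w)\<^sup>2 \<le> 1 - w" using w by (simp add: power2_eq_square mult_left_le)
      also have "1 - w \<le> exp (-w)" using exp_ge_add_one_self[of "-w"] by simp
      finally have "real (Suc (Suc i)) powr \<delta> * (1 - w)\<^sup>2 \<le> real (Suc (Suc i)) powr \<delta> * exp (-w)"
        by (intro mult_left_mono) auto
      also have "\<dots> = exp (\<delta> * ln (real (Suc (Suc i))) - w)" by (simp add: powr_def exp_diff exp_minus divide_inverse)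
      also have "\<dots> \<le> exp (\<delta> * ln (real (Suc i)))" using lnw by simp
      also have "\<dots> = real (Suc i) powr \<delta>" by (simp add: powr_def)
      finally have pw: "real (Suc (Suc i)) powr \<delta> * (1 - w)\<^sup>2 \<le> real (Suc i) powr \<delta>" .
      have "real (Suc (Suc i)) powr \<delta> \<le> real (Suc (Suc i)) powr (1/2)" using \<delta> by (intro powr_mono) auto
      also have "\<dots> \<le> (4 * real (Suc i)) powr (1/2)" by (intro powr_mono2) auto
      also have "\<dots> = 2 * real (Suc i) powr (1/2)"
        using real_sqrt_mult[of 4 "real (Suc i)"] by (simp add: powr_half_sqrt del: of_nat_Suc)
      finally have pw2: "real (Suc (Suc i)) powr \<delta> \<le> 2 * real (Suc i) powr (1/2)" .
      have three: "real (Suc i) powr (1/2) / (real (Suc i))\<^sup>2 = real (Suc i) powr (-3/2)"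
        using powr_diff[of "real (Suc i)" "1/2" 2] by (simp add: powr_numeral)
      have "e (Suc i) / (real (Suc i))\<^sup>2 \<le> ((1 + g / real i)\<^sup>2 * e i + 4 * P) / (real (Suc i))\<^sup>2"
        using step[OF i] by (intro divide_right_mono) auto
      also have "\<dots> = ((1 + g / real i) / real (Suc i))\<^sup>2 * e i + 4 * P / (real (Suc i))\<^sup>2"
        unfolding power_divide by (simp only: add_divide_distrib times_divide_eq_left)
      also have "\<dots> = (1 - w)\<^sup>2 * (e i / (real i)\<^sup>2) + 4 * P / (real (Suc i))\<^sup>2"
        unfolding eq by (simp add: power_divide)
      finally have "G (Suc i) \<le> real (Suc (Suc i)) powr \<delta> * ((1 - w)\<^sup>2 * (e i / (real i)\<^sup>2) + 4 * P / (real (Suc i))\<^sup>2)"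
        unfolding G_def by (intro mult_left_mono) auto
      also have "\<dots> = (real (Suc (Suc i)) powr \<delta> * (1 - w)\<^sup>2) * (e i / (real i)\<^sup>2)
          + real (Suc (Suc i)) powr \<delta> * (4 * P / (real (Suc i))\<^sup>2)" by (simp add: algebra_simps)
      also have "\<dots> \<le> real (Suc i) powr \<delta> * (e i / (real i)\<^sup>2) + (2 * real (Suc i) powr (1/2)) * (4 * P / (real (Suc i))\<^sup>2)"
        using pw pw2 e0[of i] P by (intro add_mono mult_right_mono) auto
      also have "\<dots> = G i + 8 * P * (real (Suc i) powr (1/2) / (real (Suc i))\<^sup>2)"
        by (simp add: G_def)
      finally show ?thesis unfolding three .
    qed
    have "G i \<le> G m + 8 * P * (\<Sum>j<i. real (Suc j) powr (-3/2))" if "i \<ge> m" for i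
      using that
    proof (induction i rule: dec_induct)
      case base
      show ?case using P by (auto intro!: mult_nonneg_nonneg sum_nonneg)
    next
      case (step i)
      then show ?case using G_step[of i] by (simp add: algebra_simps)
    qed
    from this[OF mk'] have "G k \<le> G m + 8 * P * (\<Sum>j<k. real (Suc j) powr (-3/2))" .
    also have "\<dots> \<le> G m + 8 * P * Z"
      unfolding Z_def using P by (intro add_left_mono mult_left_mono sum_le_suminf sm) auto
    \<comment> \<open>The lag is used here: the initial value carries the weight m^\<delta>, and m^2
      <= k bounds this by a constant times k^(\<delta>/2). Forgetting an arbitrary initial state
      thus costs half of the decay exponent.\<close>
    also have "G m \<le> 8 * P * real (Suc k) powr (\<delta> / 2)"
    proof -
      have "e m / (real m)\<^sup>2 \<le> 4 * P" using em m by (simp add: divide_le_eq)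
      then have Gm: "G m \<le> real (Suc m) powr \<delta> * (4 * P)" unfolding G_def by (intro mult_left_mono) auto
      have "real (Suc m) powr \<delta> = ((real (Suc m))\<^sup>2) powr (\<delta> / 2)"
        using powr_powr[of "real (Suc m)" 2 "\<delta> / 2"] by (simp add: powr_numeral del: of_nat_Suc)
      also have "\<dots> \<le> (4 * real (Suc k)) powr (\<delta> / 2)"
      proof (rule powr_mono2)
        have "real (Suc m) \<le> 2 * real m" using m by simp
        then have "(real (Suc m))\<^sup>2 \<le> (2 * real m)\<^sup>2" by (intro power_mono) auto
        also have "\<dots> = 4 * real (m\<^sup>2)" by (simp add: power_mult_distrib)
        also have "\<dots> \<le> 4 * real (Suc k)" using mk by (intro mult_left_mono) (auto simp del: of_nat_power)
        finally show "(real (Suc m))\<^sup>2 \<le> 4 * real (Suc k)" .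
      qed (use \<delta> in auto)
      also have "\<dots> = 4 powr (\<delta> / 2) * real (Suc k) powr (\<delta> / 2)" by (rule powr_mult)
      also have "\<dots> \<le> 4 powr (1/2) * real (Suc k) powr (\<delta> / 2)"
        using \<delta> by (intro mult_right_mono powr_mono) auto
      also have "\<dots> = 2 * real (Suc k) powr (\<delta> / 2)" by (simp add: powr_half_sqrt)
      finally have "real (Suc m) powr \<delta> * (4 * P) \<le> 2 * real (Suc k) powr (\<delta> / 2) * (4 * P)"
        using P by (intro mult_right_mono) auto
      with Gm show ?thesis by (simp add: mult_ac)
    qed
    also have "8 * P * real (Suc k) powr (\<delta> / 2) + 8 * P * Z \<le> 8 * P * real (Suc k) powr (\<delta> / 2) + 8 * P * Z * real (Suc k) powr (\<delta> / 2)"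
    proof -
      have "1 \<le> real (Suc k) powr (\<delta> / 2)" using \<delta> by (intro ge_one_powr_ge_zero) auto
      then show ?thesis using P Z0 mult_left_mono[of 1 "real (Suc k) powr (\<delta> / 2)" "8 * P * Z"] by simp
    qed
    finally have Gk: "G k \<le> 8 * (1 + Z) * P * real (Suc k) powr (\<delta> / 2)" by (simp add: algebra_simps)
    have k0: "real k > 0" using mk' m by simp
    have "e k = G k * real (Suc k) powr (-\<delta>) * (real k)\<^sup>2"
      using k0 by (simp add: G_def powr_minus field_simps)
    also have "\<dots> \<le> 8 * (1 + Z) * P * real (Suc k) powr (\<delta> / 2) * real (Suc k) powr (-\<delta>) * (real k)\<^sup>2"
      using Gk by (intro mult_right_mono) auto
    also have "real (Suc k) powr (\<delta> / 2) * real (Suc k) powr (-\<delta>) = real (Suc k) powr (- (\<delta> / 2))"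
      by (simp flip: powr_add)
    then have "8 * (1 + Z) * P * real (Suc k) powr (\<delta> / 2) * real (Suc k) powr (-\<delta>) * (real k)\<^sup>2
      = 8 * (1 + Z) * P * (real k)\<^sup>2 * real (Suc k) powr (- (\<delta> / 2))"
      by (simp only: mult.assoc mult.left_commute mult.commute)
    finally show "e k \<le> 8 * (1 + Z) * P * (real k)\<^sup>2 * real (Suc k) powr (- ((1 - g) / 2))"
      by (simp add: \<delta>_def)
  qed
qed

text \<open>Gauss's product for Gamma(1/2) = sqrt pi; the factor sqrt((k+1)/k) adjusts the shift
  between k and k+1.\<close>

lemma Gamma_half_weight_limit:
  "(\<lambda>k. fact k / (pochhammer (1 / 2) (Suc k) * sqrt pi) * sqrt (real (Suc k))) \<longlonglongrightarrow> 1"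
proof -
  have "(\<lambda>k. Gamma_series (1 / 2 :: real) k / sqrt pi * sqrt (real (Suc k) / real k)) \<longlonglongrightarrow> sqrt pi / sqrt pi * 1"
  proof (intro tendsto_intros)
    show "Gamma_series (1 / 2 :: real) \<longlonglongrightarrow> sqrt pi"
      using Gamma_series_LIMSEQ[of "1 / 2 :: real"] by (simp only: Gamma_one_half_real)
    show "(\<lambda>k. sqrt (real (Suc k) / real k)) \<longlonglongrightarrow> 1" by real_asymp
  qed simp
  moreover have "eventually (\<lambda>k. Gamma_series (1 / 2 :: real) k / sqrt pi * sqrt (real (Suc k) / real k)
      = fact k / (pochhammer (1 / 2) (Suc k) * sqrt pi) * sqrt (real (Suc k))) sequentially"
    using eventually_gt_at_top[of 0]
  proof eventually_elim
    case (elim k)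
    have "exp (1 / 2 * ln (real k)) = sqrt (real k)"
      using elim powr_half_sqrt[of "real k"] by (simp add: powr_def)
    then show ?case using elim
      by (simp add: Gamma_series_def real_sqrt_divide)
  qed
  ultimately show ?thesis using Lim_transform_eventually by fastforce
qed

section \<open>Bounded functions and a Borel-Cantelli lemma along a filtration\<close>

lemma (in prob_space) integrable_bounded:
  fixes f :: "'a \<Rightarrow> 'b :: {banach, second_countable_topology}"
  assumes "f \<in> borel_measurable M" "\<And>x. x \<in> space M \<Longrightarrow> norm (f x) \<le> c"
  shows "integrable M f"
  by (rule integrable_const_bound[of f c]) (use assms in auto)

lemma (in prob_space) integrable_abs_bounded:
  fixes f :: "'a \<Rightarrow> real"
  assumes "f \<in> borel_measurable M" "\<And>x. x \<in> space M \<Longrightarrow> \<bar>f x\<bar> \<le> c"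
  shows "integrable M f"
  using integrable_bounded[of f c] assms by simp

text \<open>A substitute for independence: the event of having missed all earlier \<open>A j\<close>
  is itself a past event, so each new index multiplies its probability by at most 1 - c <= exp(-c),
  and the divergence of the sum of \<open>c\<close> drives it to zero.\<close>

lemma (in prob_space) sequential_borel_cantelli:
  assumes G: "\<And>j. subalgebra M (G j)" "\<And>j. sets (G j) \<subseteq> sets (G (Suc j))"
    and A: "\<And>j. A j \<in> sets (G (Suc j))"
    and c: "\<And>j. c j \<ge> 0" "\<not> summable c"
    and prob: "eventually (\<lambda>j. \<forall>B\<in>sets (G j). c j * prob B \<le> prob (A j \<inter> B)) sequentially"
  shows "AE x in M. \<exists>\<^sub>F j in sequentially. x \<in> A j"
proof -
  obtain J where J: "\<And>j B. j \<ge> J \<Longrightarrow> B \<in> sets (G j) \<Longrightarrow> c j * prob B \<le> prob (A j \<inter> B)"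
    using prob by (auto simp: eventually_sequentially)
  have GM: "B \<in> sets M" if "B \<in> sets (G j)" for B j
    using G(1)[of j] that by (auto simp: subalgebra_def)
  have spG: "space (G j) = space M" for j using G(1)[of j] by (simp add: subalgebra_def)
  have "AE x in M. \<exists>j\<ge>K. x \<in> A j" if K: "K \<ge> J" for K
  proof -
    \<comment> \<open>The strict upper limit makes \<open>H i\<close> an event of
      \<open>G (K + i)\<close>, which is the past of the next index K + i.\<close>
    define H where "H i = {x \<in> space M. \<forall>j. K \<le> j \<and> j < K + i \<longrightarrow> x \<notin> A j}" for i
    have H0: "H 0 = space M" by (auto simp: H_def)
    have HS: "H (Suc i) = H i - A (K + i)" for i
      by (auto simp: H_def less_Suc_eq)
    have HG: "H i \<in> sets (G (K + i))" for i
    proof (induction i)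
      case 0
      then show ?case using sets.top[of "G K"] by (simp add: H0 spG)
    next
      case (Suc i)
      then have "H i \<in> sets (G (Suc (K + i)))" using G(2) by blast
      then show ?case using A[of "K + i"] by (simp add: HS sets.Diff)
    qed
    note HM = GM[OF HG]
    have bound: "prob (H i) \<le> exp (- (\<Sum>j<i. c (K + j)))" for i
    proof (induction i)
      case 0
      show ?case by (simp add: H0 prob_space)
    next
      case (Suc i)
      have "prob (H (Suc i)) = prob (H i) - prob (A (K + i) \<inter> H i)"
        unfolding HS using HM[of i] GM[OF A[of "K + i"]] by (simp add: finite_measure_Diff' Int_commute)
      also have "\<dots> \<le> prob (H i) - c (K + i) * prob (H i)"
        using J[OF _ HG[of i]] K by simp
      also have "\<dots> = prob (H i) * (1 + - c (K + i))" by (simp add: algebra_simps)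
      also have "\<dots> \<le> prob (H i) * exp (- c (K + i))"
        by (intro mult_left_mono exp_ge_add_one_self) simp
      also have "\<dots> \<le> exp (- (\<Sum>j<i. c (K + j))) * exp (- c (K + i))"
        by (intro mult_right_mono Suc.IH) simp
      also have "\<dots> = exp (- (\<Sum>j<Suc i. c (K + j)))" by (simp flip: exp_add)
      finally show ?case .
    qed
    define I where "I = (\<Inter>i. H i)"
    have IM: "I \<in> sets M" unfolding I_def using HM by auto
    have Ib: "prob I \<le> exp (- X)" for X
    proof -
      have "\<not> summable (\<lambda>j. c (j + K))" using c(2) by (simp add: summable_iff_shift)
      then obtain i where "\<not> (\<Sum>j<i. c (j + K)) \<le> X"
        using summableI_nonneg_bounded[of "\<lambda>j. c (j + K)" X] c(1) by metis
      then have "X \<le> (\<Sum>j<i. c (K + j))" by (simp add: add.commute)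
      then have "exp (- (\<Sum>j<i. c (K + j))) \<le> exp (- X)" by simp
      moreover have "prob I \<le> prob (H i)" unfolding I_def by (intro finite_measure_mono HM) auto
      ultimately show ?thesis using bound[of i] by linarith
    qed
    have "prob I = 0"
    proof (rule ccontr)
      assume "prob I \<noteq> 0"
      then have p: "prob I > 0" by (simp add: zero_less_measure_iff)
      \<comment> \<open>This choice of X gives the absurd bound prob I <= prob I / 2.\<close>
      then show False using Ib[of "- ln (prob I / 2)"] by simp
    qed
    then have "I \<in> null_sets M" using IM by (simp add: null_sets_def emeasure_eq_measure)
    then have "AE x in M. x \<notin> I" by (rule AE_not_in)
    then show ?thesis
      by (rule AE_mp) (auto simp: I_def H_def intro!: AE_I2)
  qed
  then have "AE x in M. \<forall>K. J \<le> K \<longrightarrow> (\<exists>j\<ge>K. x \<in> A j)"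
    by (subst AE_all_countable) (auto intro: AE_I2)
  then show ?thesis
  proof eventually_elim
    case (elim x)
    show ?case unfolding frequently_sequentially
    proof
      fix N
      obtain j where "j \<ge> max J N" "x \<in> A j" using elim by (meson max.cobounded1)
      then show "\<exists>n\<ge>N. x \<in> A n" by auto
    qed
  qed
qed

section \<open>Martingales on a logarithmic clock\<close>

text \<open>
  The condition v_close bounds the fluctuation of the conditional variance given the
  \<open>\<sigma>\<close>-algebra at a time \<open>m\<close>, but only after the time lag \<open>m\<^sup>2\<close>: by then the initial state is
  forgotten whatever it was, and on the logarithmic clock of the martingale the lag merely
  doubles \<open>ln m\<close>.
\<close>

locale critical_martingale = prob_space M
  for M :: "'a measure" +
  fixes F :: "nat \<Rightarrow> 'a measure" and \<xi> v :: "nat \<Rightarrow> 'a \<Rightarrow> real"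
    and b :: "nat \<Rightarrow> real" and \<phi> \<kappa> C :: real
  assumes subalg: "subalgebra M (F n)"
    and F_mono: "m \<le> n \<Longrightarrow> sets (F m) \<subseteq> sets (F n)"
    and \<xi>_meas: "\<xi> n \<in> borel_measurable (F (Suc n))"
    and \<xi>_bound: "x \<in> space M \<Longrightarrow> \<bar>\<xi> n x\<bar> \<le> 2"
    and v_meas: "v n \<in> borel_measurable (F n)"
    and v_bound: "x \<in> space M \<Longrightarrow> \<bar>v n x\<bar> \<le> 4"
    and mean_zero: "h \<in> borel_measurable (F n) \<Longrightarrow> (\<And>x. x \<in> space M \<Longrightarrow> \<bar>h x\<bar> \<le> c) \<Longrightarrow>
      (\<integral>x. h x * \<xi> n x \<partial>M) = 0"
    and second_moment: "h \<in> borel_measurable (F n) \<Longrightarrow> (\<And>x. x \<in> space M \<Longrightarrow> \<bar>h x\<bar> \<le> c) \<Longrightarrow>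
      (\<integral>x. h x * (\<xi> n x)\<^sup>2 \<partial>M) = (\<integral>x. h x * v n x \<partial>M)"
    and v_close: "A \<in> sets (F m) \<Longrightarrow> m\<^sup>2 \<le> k \<Longrightarrow>
      (\<integral>x. indicator A x * (v k x - \<phi>)\<^sup>2 \<partial>M) \<le> C * real (Suc k) powr (-2 * \<kappa>) * prob A"
    and b_pos: "b k > 0"
    and b_lim: "(\<lambda>k. b k * sqrt (real (Suc k))) \<longlonglongrightarrow> 1"
    and \<phi>_pos: "\<phi> > 0" and \<kappa>_pos: "\<kappa> > 0" and C_nonneg: "C \<ge> 0"
begin

definition W :: "nat \<Rightarrow> 'a \<Rightarrow> real" where
  "W n x = (\<Sum>k<n. b k * \<xi> k x)"

definition V :: "nat \<Rightarrow> real" where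
  "V n = (\<Sum>k<n. (b k)\<^sup>2)"

lemma space_F [simp]: "space (F n) = space M"
  using subalg[of n] by (simp add: subalgebra_def)

lemma F_measurable_mono:
  assumes "f \<in> borel_measurable (F m)" "m \<le> n"
  shows "f \<in> borel_measurable (F n)"
  by (rule measurable_from_subalg[OF _ assms(1)]) (use F_mono[OF assms(2)] in \<open>simp add: subalgebra_def\<close>)

lemma F_measurable_M:
  assumes "f \<in> borel_measurable (F m)"
  shows "f \<in> borel_measurable M"
  by (rule measurable_from_subalg[OF subalg assms])

lemma sets_F_M: "A \<in> sets (F m) \<Longrightarrow> A \<in> sets M"
  using subalg[of m] by (auto simp: subalgebra_def)

lemma \<xi>_measurable [measurable]: "\<xi> n \<in> borel_measurable M"
  by (rule F_measurable_M[OF \<xi>_meas])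

lemma v_measurable [measurable]: "v n \<in> borel_measurable M"
  by (rule F_measurable_M[OF v_meas])

lemma W_adapted: "n \<le> m \<Longrightarrow> W n \<in> borel_measurable (F m)"
  unfolding W_def
  by (intro borel_measurable_sum borel_measurable_times borel_measurable_const F_measurable_mono[OF \<xi>_meas]) auto

lemma W_measurable [measurable]: "W n \<in> borel_measurable M"
  by (rule F_measurable_M[OF W_adapted[OF order_refl]])

lemma W_Suc: "W (Suc n) x = W n x + b n * \<xi> n x"
  by (simp add: W_def)

lemma V_Suc: "V (Suc n) = V n + (b n)\<^sup>2"
  by (simp add: V_def)

lemma V_mono: "m \<le> n \<Longrightarrow> V m \<le> V n"
  unfolding V_def by (intro sum_mono2) auto

text \<open>A deterministic bound that is far from sharp; it serves only to make exponentials of the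
  martingale bounded and hence integrable.\<close>

lemma W_diff_bound:
  assumes "x \<in> space M" "m \<le> n"
  shows "\<bar>W n x - W m x\<bar> \<le> 2 * (\<Sum>k<n. b k)"
proof -
  have "W n x - W m x = (\<Sum>k=m..<n. b k * \<xi> k x)"
    unfolding W_def using assms(2) by (simp add: sum_diff_nat_ivl lessThan_atLeast0)
  also have "\<bar>\<dots>\<bar> \<le> (\<Sum>k=m..<n. \<bar>b k * \<xi> k x\<bar>)" by (rule sum_abs)
  also have "\<dots> \<le> (\<Sum>k=m..<n. b k * 2)"
    using \<xi>_bound[OF assms(1)] b_pos by (intro sum_mono) (auto simp: abs_mult less_imp_le intro!: mult_mono)
  also have "\<dots> \<le> (\<Sum>k<n. b k * 2)"
    using b_pos by (intro sum_mono2) (auto simp: less_imp_le)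
  finally show ?thesis by (simp add: sum_distrib_left mult.commute)
qed

section \<open>The clock and the summable errors\<close>

lemma V_sim_ln: "(\<lambda>n. V n / ln (real n)) \<longlonglongrightarrow> 1"
  unfolding V_def
proof (rule sum_sim_ln)
  have "(\<lambda>k. (b k * sqrt (real (Suc k)))\<^sup>2) \<longlonglongrightarrow> 1\<^sup>2"
    by (intro tendsto_intros b_lim)
  then show "(\<lambda>k. (b k)\<^sup>2 * real (Suc k)) \<longlonglongrightarrow> 1"
    by (simp add: power_mult_distrib)
qed

lemma b_bound:
  obtains K where "K > 0" "\<And>k. b k \<le> K * real (Suc k) powr (-1/2)" "\<And>k. b k \<le> K"
proof -
  obtain K where K: "K > 0" "\<And>k. \<bar>b k * sqrt (real (Suc k))\<bar> \<le> K"
    using tendsto_real_imp_bounded[OF b_lim] by blast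
  have 1: "b k \<le> K * real (Suc k) powr (-1/2)" for k
  proof -
    have "b k * sqrt (real (Suc k)) \<le> K" using K(2)[of k] by linarith
    then have "b k \<le> K / sqrt (real (Suc k))" by (simp add: pos_le_divide_eq)
    also have "\<dots> = K * real (Suc k) powr (-1/2)"
      using powr_minus_divide[of "real (Suc k)" "1/2"] by (simp add: powr_half_sqrt[symmetric])
    finally show ?thesis .
  qed
  moreover have "b k \<le> K" for k
  proof -
    have "real (Suc k) powr (-1/2) \<le> 1" using powr_mono[of "-1/2" 0 "real (Suc k)"] by simp
    then show ?thesis using 1[of k] K(1) mult_left_mono[of "real (Suc k) powr (-1/2)" 1 K] by linarith
  qed
  ultimately show ?thesis using K(1) that by blast
qed

lemma summable_b_cube: "summable (\<lambda>k. (b k) ^ 3)"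
proof -
  obtain K where K: "K > 0" "\<And>k. b k \<le> K * real (Suc k) powr (-1/2)" using b_bound by metis
  show ?thesis
  proof (rule summable_comparison_test')
    have "summable (\<lambda>k. real k powr (-3/2))" by (subst summable_real_powr_iff) simp
    then have "summable (\<lambda>k. real (Suc k) powr (-3/2))" by (subst summable_Suc_iff)
    then show "summable (\<lambda>k. K ^ 3 * real (Suc k) powr (-3/2))" by (rule summable_mult)
    fix k :: nat
    have "b k ^ 3 \<le> (K * real (Suc k) powr (-1/2)) ^ 3"
      using K(2)[of k] b_pos[of k] by (intro power_mono) auto
    also have "\<dots> = K ^ 3 * real (Suc k) powr (-3/2)"
      by (simp add: power_mult_distrib powr_powr flip: powr_realpow')
    finally show "norm (b k ^ 3) \<le> K ^ 3 * real (Suc k) powr (-3/2)"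
      using b_pos[of k] by simp
  qed
qed

text \<open>Passage from mean square to mean through |y| <= \<eta> y^2 + 1/\<eta>, where \<eta> =
  (k+1)^\<kappa> balances the two terms.\<close>

lemma mean_v_dist: "(\<integral>x. \<bar>v k x - \<phi>\<bar> \<partial>M) \<le> (C + 1) * real (Suc k) powr (-\<kappa>)"
proof -
  define \<eta> where "\<eta> = real (Suc k) powr \<kappa>"
  have \<eta>: "\<eta> > 0" by (simp add: \<eta>_def)
  have int2: "integrable M (\<lambda>x. (v k x - \<phi>)\<^sup>2)"
  proof (rule integrable_bounded[where c = "(4 + \<bar>\<phi>\<bar>)\<^sup>2"])
    show "norm ((v k x - \<phi>)\<^sup>2) \<le> (4 + \<bar>\<phi>\<bar>)\<^sup>2" if "x \<in> space M" for x
      using v_bound[OF that, of k] by (simp add: abs_le_square_iff[symmetric])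
  qed measurable
  have int1: "integrable M (\<lambda>x. \<bar>v k x - \<phi>\<bar>)"
  proof (rule integrable_bounded[where c = "4 + \<bar>\<phi>\<bar>"])
    show "norm \<bar>v k x - \<phi>\<bar> \<le> 4 + \<bar>\<phi>\<bar>" if "x \<in> space M" for x
      using v_bound[OF that, of k] by simp
  qed measurable
  have "(\<integral>x. \<bar>v k x - \<phi>\<bar> \<partial>M) \<le> (\<integral>x. \<eta> * (v k x - \<phi>)\<^sup>2 + 1 / \<eta> \<partial>M)"
  proof (rule integral_mono)
    fix x
    have "2 * \<bar>v k x - \<phi>\<bar> \<le> \<eta> * (v k x - \<phi>)\<^sup>2 + 1 / \<eta>"
      using \<eta> zero_le_power2[of "\<eta> * \<bar>v k x - \<phi>\<bar> - 1"]
      by (simp add: power2_eq_square field_simps)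
    moreover have "\<bar>v k x - \<phi>\<bar> \<le> 2 * \<bar>v k x - \<phi>\<bar>" by simp
    ultimately show "\<bar>v k x - \<phi>\<bar> \<le> \<eta> * (v k x - \<phi>)\<^sup>2 + 1 / \<eta>" by (rule order_trans[rotated])
  qed (use int1 int2 in auto)
  also have "\<dots> = \<eta> * (\<integral>x. (v k x - \<phi>)\<^sup>2 \<partial>M) + 1 / \<eta>"
    using int2 by (simp add: prob_space)
  \<comment> \<open>The whole space belongs to the algebra at time 0, and with m = 0 the lag
    condition holds for every k.\<close>
  also have "(\<integral>x. (v k x - \<phi>)\<^sup>2 \<partial>M) = (\<integral>x. indicator (space M) x * (v k x - \<phi>)\<^sup>2 \<partial>M)"
    by (rule Bochner_Integration.integral_cong) auto
  also have "\<eta> * \<dots> \<le> \<eta> * (C * real (Suc k) powr (-2 * \<kappa>) * prob (space M))"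
    using \<eta> sets.top[of "F 0"] by (intro mult_left_mono v_close[of _ 0]) auto
  also have "\<dots> + 1 / \<eta> = (C + 1) * real (Suc k) powr (-\<kappa>)"
  proof -
    have "real (Suc k) powr (-2 * \<kappa>) = 1 / \<eta>\<^sup>2"
      using powr_minus_divide[of "real (Suc k)" "2 * \<kappa>"] powr_add[of "real (Suc k)" \<kappa> \<kappa>]
      by (simp add: \<eta>_def power2_eq_square)
    moreover have "real (Suc k) powr (-\<kappa>) = 1 / \<eta>"
      by (simp add: \<eta>_def powr_minus_divide)
    ultimately show ?thesis
      using \<eta> by (simp add: prob_space field_simps power2_eq_square)
  qed
  finally show ?thesis by simp
qed

text \<open>Since squared weights are of order 1/k, any rate \<kappa> > 0 is enough. The sum
  controls both the error of the characteristic function and, pathwise, that of the quadratic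
  variation.\<close>

lemma summable_b_sq_v_dist: "summable (\<lambda>k. (b k)\<^sup>2 * (\<integral>x. \<bar>v k x - \<phi>\<bar> \<partial>M))"
proof -
  obtain K where K: "K > 0" "\<And>k. b k \<le> K * real (Suc k) powr (-1/2)" using b_bound by metis
  show ?thesis
  proof (rule summable_comparison_test')
    have "summable (\<lambda>k. real k powr (-1-\<kappa>))" using \<kappa>_pos by (subst summable_real_powr_iff) simp
    then have "summable (\<lambda>k. real (Suc k) powr (-1-\<kappa>))" by (subst summable_Suc_iff)
    then show "summable (\<lambda>k. K\<^sup>2 * (C + 1) * real (Suc k) powr (-1-\<kappa>))" by (rule summable_mult)
    fix k :: nat
    have "b k ^ 2 \<le> (K * real (Suc k) powr (-1/2)) ^ 2"
      using K(2)[of k] b_pos[of k] by (intro power_mono) auto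
    also have "\<dots> = K\<^sup>2 * real (Suc k) powr (-1)"
      by (simp add: power_mult_distrib powr_powr flip: powr_realpow')
    finally have "(b k)\<^sup>2 * (\<integral>x. \<bar>v k x - \<phi>\<bar> \<partial>M) \<le> K\<^sup>2 * real (Suc k) powr (-1) * ((C + 1) * real (Suc k) powr (-\<kappa>))"
      by (intro mult_mono mean_v_dist) auto
    also have "\<dots> = K\<^sup>2 * (C + 1) * real (Suc k) powr (-1-\<kappa>)"
      using powr_add[of "real (Suc k)" "-1" "-\<kappa>"] by (simp add: ac_simps del: of_nat_Suc)
    finally show "norm ((b k)\<^sup>2 * (\<integral>x. \<bar>v k x - \<phi>\<bar> \<partial>M)) \<le> K\<^sup>2 * (C + 1) * real (Suc k) powr (-1-\<kappa>)"
      by simp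
  qed
qed

section \<open>Central limit theorem\<close>

lemma complex_mean_zero:
  fixes h :: "'a \<Rightarrow> complex"
  assumes h: "h \<in> borel_measurable (F n)" and bd: "\<And>x. x \<in> space M \<Longrightarrow> norm (h x) \<le> c"
  shows "(\<integral>x. h x * \<xi> n x \<partial>M) = 0"
    and "(\<integral>x. h x * (\<xi> n x)\<^sup>2 \<partial>M) = (\<integral>x. h x * v n x \<partial>M)"
proof -
  have [measurable]: "h \<in> borel_measurable M" by (rule F_measurable_M[OF h])
  have c: "c \<ge> 0" if "x \<in> space M" for x using bd[OF that] norm_ge_zero order_trans by blast
  have hR: "(\<lambda>x. Re (h x)) \<in> borel_measurable (F n)" "(\<lambda>x. Im (h x)) \<in> borel_measurable (F n)"
    using h by auto
  have bR: "\<bar>Re (h x)\<bar> \<le> c" "\<bar>Im (h x)\<bar> \<le> c" if "x \<in> space M" for x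
    using bd[OF that] abs_Re_le_cmod[of "h x"] abs_Im_le_cmod[of "h x"] by auto
  have int: "integrable M (\<lambda>x. h x * of_real (f x))"
    if [measurable]: "f \<in> borel_measurable M" and "\<And>x. x \<in> space M \<Longrightarrow> \<bar>f x\<bar> \<le> 4" for f :: "'a \<Rightarrow> real"
    by (rule integrable_bounded[where c = "c * 4"])
       (use bd that c in \<open>auto simp: norm_mult intro!: mult_mono\<close>)
  have b2: "\<bar>(\<xi> n x)\<^sup>2\<bar> \<le> 4" if "x \<in> space M" for x
    using \<xi>_bound[OF that, of n] power_mono[of "\<bar>\<xi> n x\<bar>" 2 2] by simp
  have i1: "integrable M (\<lambda>x. h x * of_real (\<xi> n x))"
    by (rule int) (use \<xi>_bound[of _ n] in force)+
  have i2: "integrable M (\<lambda>x. h x * of_real ((\<xi> n x)\<^sup>2))"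
    by (rule int) (use b2 in auto)
  have i3: "integrable M (\<lambda>x. h x * of_real (v n x))"
    by (rule int) (use v_bound in auto)
  show "(\<integral>x. h x * \<xi> n x \<partial>M) = 0"
    using integral_Re[OF i1] integral_Im[OF i1] mean_zero[OF hR(1) bR(1)] mean_zero[OF hR(2) bR(2)]
    by (intro complex_eqI) auto
  show "(\<integral>x. h x * (\<xi> n x)\<^sup>2 \<partial>M) = (\<integral>x. h x * v n x \<partial>M)"
    using integral_Re[OF i2] integral_Im[OF i2] integral_Re[OF i3] integral_Im[OF i3]
      second_moment[OF hR(1) bR(1)] second_moment[OF hR(2) bR(2)]
    by (intro complex_eqI) auto
qed

text \<open>The three error terms have three sources: the third-order Taylor remainder of the
  increment, the replacement of \<open>v k\<close> by \<phi>, and the replacement of 1 - z by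
  exp(-z), where z is half the variance contribution of the step.\<close>

lemma char_step:
  fixes \<theta> :: real and Z :: "nat \<Rightarrow> complex"
  defines "Z \<equiv> \<lambda>k. (\<integral>x. iexp (\<theta> * W k x) \<partial>M)"
  shows "cmod (Z (Suc k) - exp (- (\<theta>\<^sup>2 * (b k)\<^sup>2 * \<phi> / 2)) * Z k)
    \<le> \<bar>\<theta>\<bar> ^ 3 * (2 * b k ^ 3) + \<theta>\<^sup>2 * ((b k)\<^sup>2 * (\<integral>x. \<bar>v k x - \<phi>\<bar> \<partial>M)) + \<theta> ^ 4 * (\<phi>\<^sup>2 * b k ^ 4)"
proof -
  define h where "h x = iexp (\<theta> * W k x)" for x
  define y where "y x = \<theta> * b k * \<xi> k x" for x
  define z where "z = \<theta>\<^sup>2 * (b k)\<^sup>2 * \<phi> / 2"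
  have hF: "h \<in> borel_measurable (F k)"
    unfolding h_def using W_adapted[of k k] by simp
  have [measurable]: "h \<in> borel_measurable M" by (rule F_measurable_M[OF hF])
  have [measurable]: "y \<in> borel_measurable M" unfolding y_def by measurable
  have nh: "norm (h x) = 1" for x by (simp add: h_def)
  have xi2: "(\<xi> k x)\<^sup>2 \<le> 4" if "x \<in> space M" for x
    using \<xi>_bound[OF that, of k] power_mono[of "\<bar>\<xi> k x\<bar>" 2 2] by simp
  have ih: "integrable M h" by (rule integrable_bounded[where c = 1]) (auto simp: nh)
  have i1: "integrable M (\<lambda>x. h x * \<xi> k x)"
    by (rule integrable_bounded[where c = 2]) (use \<xi>_bound in \<open>auto simp: norm_mult nh\<close>)
  have i2: "integrable M (\<lambda>x. h x * (\<xi> k x)\<^sup>2)"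
    by (rule integrable_bounded[where c = 4]) (use xi2 in \<open>auto simp: norm_mult norm_power nh\<close>)
  have i3: "integrable M (\<lambda>x. h x * v k x)"
    by (rule integrable_bounded[where c = 4]) (use v_bound in \<open>auto simp: norm_mult nh\<close>)
  have i4: "integrable M (\<lambda>x. \<bar>v k x - \<phi>\<bar>)"
    by (rule integrable_bounded[where c = "4 + \<bar>\<phi>\<bar>"]) (use v_bound[of _ k] in force)+
  have iS: "integrable M (\<lambda>x. iexp (\<theta> * W (Suc k) x))"
    by (rule integrable_bounded[where c = 1]) auto
  \<comment> \<open>Second-order Taylor polynomial of the next characteristic factor; in its mean
    the linear term vanishes and the square turns into \<open>v k\<close>.\<close>
  define T where "T x = h x * (1 + \<i> * y x - (y x)\<^sup>2 / 2)" for x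
  have T_eq: "T x = h x + \<i> * \<theta> * b k * (h x * \<xi> k x) - \<theta>\<^sup>2 * (b k)\<^sup>2 / 2 * (h x * (\<xi> k x)\<^sup>2)" for x
    by (simp add: T_def y_def algebra_simps power_mult_distrib)
  have iT: "integrable M T"
    unfolding T_eq[abs_def] by (intro Bochner_Integration.integrable_add Bochner_Integration.integrable_diff integrable_mult_right ih i1 i2)
  have Zh: "Z k = (\<integral>x. h x \<partial>M)" by (simp add: Z_def h_def)
  have ET: "(\<integral>x. T x \<partial>M) = Z k - \<theta>\<^sup>2 * (b k)\<^sup>2 / 2 * (\<integral>x. h x * v k x \<partial>M)"
  proof -
    have "(\<integral>x. T x \<partial>M) = (\<integral>x. h x \<partial>M) + \<i> * \<theta> * b k * (\<integral>x. h x * \<xi> k x \<partial>M)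
        - \<theta>\<^sup>2 * (b k)\<^sup>2 / 2 * (\<integral>x. h x * (\<xi> k x)\<^sup>2 \<partial>M)"
      unfolding T_eq[abs_def]
      by (simp only: Bochner_Integration.integral_diff[OF Bochner_Integration.integrable_add[OF ih integrable_mult_right[OF i1]] integrable_mult_right[OF i2]]
        Bochner_Integration.integral_add[OF ih integrable_mult_right[OF i1]] integral_mult_right_zero)
    then show ?thesis
      using complex_mean_zero[OF hF, of 1] by (simp only: nh order_refl Zh mult_zero_right add_0_right)
  qed
  have "cmod (Z (Suc k) - (\<integral>x. T x \<partial>M)) = cmod (\<integral>x. iexp (\<theta> * W (Suc k) x) - T x \<partial>M)"
    unfolding Z_def using iS iT by simp
  also have "\<dots> \<le> (\<integral>x. cmod (iexp (\<theta> * W (Suc k) x) - T x) \<partial>M)"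
    by (rule integral_norm_bound)
  also have "\<dots> \<le> (\<integral>x. \<bar>\<theta>\<bar> ^ 3 * (2 * b k ^ 3) \<partial>M)"
  proof (rule integral_mono)
    fix x assume x: "x \<in> space M"
    have "iexp (\<theta> * W (Suc k) x) = h x * iexp (y x)"
      by (simp add: W_Suc h_def y_def algebra_simps flip: exp_add)
    then have "cmod (iexp (\<theta> * W (Suc k) x) - T x) = cmod (iexp (y x) - (1 + \<i> * y x - (y x)\<^sup>2 / 2))"
      by (simp add: T_def nh norm_mult flip: right_diff_distrib)
    also have "\<dots> \<le> \<bar>y x\<bar> ^ 3 / 6"
      using iexp_approx1[of "y x" 2] by (simp add: eval_nat_numeral fact_Suc algebra_simps)
    also have "\<bar>y x\<bar> ^ 3 \<le> (\<bar>\<theta>\<bar> * b k * 2) ^ 3"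
      using \<xi>_bound[OF x, of k] b_pos[of k]
      by (intro power_mono) (auto simp: y_def abs_mult less_imp_le intro!: mult_mono)
    also have "(\<bar>\<theta>\<bar> * b k * 2) ^ 3 / 6 \<le> \<bar>\<theta>\<bar> ^ 3 * (2 * b k ^ 3)"
      using b_pos[of k] by (simp add: power_mult_distrib)
    finally show "cmod (iexp (\<theta> * W (Suc k) x) - T x) \<le> \<bar>\<theta>\<bar> ^ 3 * (2 * b k ^ 3)" by simp
  qed (use iS iT in auto)
  finally have 1: "cmod (Z (Suc k) - (\<integral>x. T x \<partial>M)) \<le> \<bar>\<theta>\<bar> ^ 3 * (2 * b k ^ 3)"
    by (simp add: prob_space)
  have dv: "(\<integral>x. h x * (v k x - \<phi>) \<partial>M) = (\<integral>x. h x * v k x \<partial>M) - \<phi> * Z k"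
    unfolding Zh using ih i3 by (simp add: right_diff_distrib mult.commute)
  have "(\<integral>x. T x \<partial>M) - (1 - z) * Z k = - (\<theta>\<^sup>2 * (b k)\<^sup>2 / 2 * (\<integral>x. h x * (v k x - \<phi>) \<partial>M))"
    unfolding ET dv by (simp add: z_def field_simps)
  then have "cmod ((\<integral>x. T x \<partial>M) - (1 - z) * Z k) = \<theta>\<^sup>2 * (b k)\<^sup>2 / 2 * cmod (\<integral>x. h x * (v k x - \<phi>) \<partial>M)"
    by (simp add: norm_mult norm_divide norm_power)
  also have "\<dots> \<le> \<theta>\<^sup>2 * (b k)\<^sup>2 / 2 * (\<integral>x. cmod (h x * (v k x - \<phi>)) \<partial>M)"
    by (intro mult_left_mono integral_norm_bound) auto
  also have "\<dots> = \<theta>\<^sup>2 * (b k)\<^sup>2 / 2 * (\<integral>x. \<bar>v k x - \<phi>\<bar> \<partial>M)"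
    by (simp add: norm_mult nh norm_of_real del: of_real_diff flip: of_real_diff)
  also have "\<dots> \<le> \<theta>\<^sup>2 * ((b k)\<^sup>2 * (\<integral>x. \<bar>v k x - \<phi>\<bar> \<partial>M))"
    by simp
  finally have 2: "cmod ((\<integral>x. T x \<partial>M) - (1 - z) * Z k) \<le> \<theta>\<^sup>2 * ((b k)\<^sup>2 * (\<integral>x. \<bar>v k x - \<phi>\<bar> \<partial>M))" .
  have z0: "z \<ge> 0" using \<phi>_pos by (simp add: z_def)
  have Z1: "cmod (Z k) \<le> 1"
  proof -
    have "cmod (Z k) \<le> (\<integral>x. cmod (iexp (\<theta> * W k x)) \<partial>M)" unfolding Z_def by (rule integral_norm_bound)
    then show ?thesis by (simp add: prob_space)
  qed
  have "\<bar>1 - z - exp (-z)\<bar> \<le> z\<^sup>2"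
  proof -
    have "exp (-z) \<ge> 1 - z" using exp_ge_add_one_self[of "-z"] by simp
    moreover have "exp (-z) \<le> 1 - z + z\<^sup>2"
    proof (cases "z \<le> 1")
      case True
      then show ?thesis using exp_le_quadratic[of "-z"] z0 by simp
    next
      case False
      then have "z \<le> z\<^sup>2" by (simp add: power2_eq_square)
      then show ?thesis using exp_le_one_iff[of "-z"] z0 by linarith
    qed
    ultimately show ?thesis by simp
  qed
  also have "z\<^sup>2 \<le> \<theta> ^ 4 * (\<phi>\<^sup>2 * b k ^ 4)"
    by (simp add: z_def power_mult_distrib power_divide flip: power_mult)
  finally have 3: "cmod ((1 - z) * Z k - exp (-z) * Z k) \<le> \<theta> ^ 4 * (\<phi>\<^sup>2 * b k ^ 4)"
  proof -
    assume a: "\<bar>1 - z - exp (-z)\<bar> \<le> \<theta> ^ 4 * (\<phi>\<^sup>2 * b k ^ 4)"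
    have "(1 - z) * Z k - exp (-z) * Z k = of_real (1 - z - exp (-z)) * Z k"
      by (simp add: left_diff_distrib)
    then have "cmod ((1 - z) * Z k - exp (-z) * Z k) = \<bar>1 - z - exp (-z)\<bar> * cmod (Z k)"
      by (simp only: norm_mult norm_of_real)
    also have "\<dots> \<le> \<bar>1 - z - exp (-z)\<bar> * 1" by (intro mult_left_mono Z1) auto
    finally show ?thesis using a by simp
  qed
  have "cmod (Z (Suc k) - exp (-z) * Z k) \<le> cmod (Z (Suc k) - (\<integral>x. T x \<partial>M))
      + cmod ((\<integral>x. T x \<partial>M) - (1 - z) * Z k) + cmod ((1 - z) * Z k - exp (-z) * Z k)"
    using norm_triangle_ineq[of "Z (Suc k) - (\<integral>x. T x \<partial>M)" "(\<integral>x. T x \<partial>M) - (1 - z) * Z k"]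
      norm_triangle_ineq[of "Z (Suc k) - (1 - z) * Z k" "(1 - z) * Z k - exp (-z) * Z k"]
    by simp
  with 1 2 3 show ?thesis unfolding z_def by linarith
qed

text \<open>The factor exp(-z) in each step is at most 1, so the one-step errors merely add up, and
  their sums converge. The resulting constant is uniform in n, and the bound vanishes as the
  argument tends to 0, which is exactly the regime of the normalized martingale.\<close>

lemma char_bound:
  obtains D where "\<And>\<theta> n. cmod ((\<integral>x. iexp (\<theta> * W n x) \<partial>M) - exp (- (\<theta>\<^sup>2 * \<phi> * V n / 2)))
      \<le> D * (\<bar>\<theta>\<bar> ^ 3 + \<theta>\<^sup>2 + \<theta> ^ 4)"
proof -
  define c1 c2 c3 where "c1 = (\<Sum>k. 2 * b k ^ 3)"
    and "c2 = (\<Sum>k. (b k)\<^sup>2 * (\<integral>x. \<bar>v k x - \<phi>\<bar> \<partial>M))" and "c3 = (\<Sum>k. \<phi>\<^sup>2 * b k ^ 4)"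
  obtain K where K: "K > 0" "\<And>k. b k \<le> K" using b_bound by metis
  have "summable (\<lambda>k. b k ^ 4)"
  proof (rule summable_comparison_test')
    show "summable (\<lambda>k. K * b k ^ 3)" by (rule summable_mult[OF summable_b_cube])
    show "norm (b k ^ 4) \<le> K * b k ^ 3" for k
      using K(2)[of k] b_pos[of k] by (simp add: eval_nat_numeral)
  qed
  then have s: "summable (\<lambda>k. 2 * b k ^ 3)" "summable (\<lambda>k. \<phi>\<^sup>2 * b k ^ 4)"
    using summable_b_cube by (auto intro: summable_mult)
  define D where "D = c1 + c2 + c3"
  have nn: "c1 \<ge> 0" "c2 \<ge> 0" "c3 \<ge> 0"
    unfolding c1_def c2_def c3_def
    using s summable_b_sq_v_dist b_pos by (auto intro!: suminf_nonneg simp: less_imp_le)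
  show thesis
  proof (rule that[of D])
    fix \<theta> :: real and n :: nat
    define Z where "Z k = (\<integral>x. iexp (\<theta> * W k x) \<partial>M)" for k
    define err where "err k = \<bar>\<theta>\<bar> ^ 3 * (2 * b k ^ 3) + \<theta>\<^sup>2 * ((b k)\<^sup>2 * (\<integral>x. \<bar>v k x - \<phi>\<bar> \<partial>M)) + \<theta> ^ 4 * (\<phi>\<^sup>2 * b k ^ 4)" for k
    have "cmod (Z n - exp (- (\<theta>\<^sup>2 * \<phi> * V n / 2))) \<le> (\<Sum>k<n. err k)"
    proof (induction n)
      case 0
      then show ?case by (simp add: Z_def W_def V_def prob_space)
    next
      case (Suc n)
      define z where "z = \<theta>\<^sup>2 * (b n)\<^sup>2 * \<phi> / 2"
      have z0: "z \<ge> 0" using \<phi>_pos by (simp add: z_def)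
      have e: "exp (- (\<theta>\<^sup>2 * \<phi> * V (Suc n) / 2)) = exp (-z) * exp (- (\<theta>\<^sup>2 * \<phi> * V n / 2))"
        by (simp add: V_Suc z_def field_simps flip: exp_add)
      have "Z (Suc n) - exp (- (\<theta>\<^sup>2 * \<phi> * V (Suc n) / 2)) =
        (Z (Suc n) - exp (-z) * Z n) + exp (-z) * (Z n - exp (- (\<theta>\<^sup>2 * \<phi> * V n / 2)))"
        unfolding e by (simp add: algebra_simps)
      also have "cmod \<dots> \<le> cmod (Z (Suc n) - exp (-z) * Z n) + exp (-z) * cmod (Z n - exp (- (\<theta>\<^sup>2 * \<phi> * V n / 2)))"
        by (rule norm_triangle_le) (simp add: norm_mult del: exp_of_real of_real_exp)
      also have "cmod (Z (Suc n) - exp (-z) * Z n) \<le> err n"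
        using char_step[of \<theta> n] unfolding Z_def z_def err_def .
      also have "exp (-z) * cmod (Z n - exp (- (\<theta>\<^sup>2 * \<phi> * V n / 2))) \<le> 1 * (\<Sum>k<n. err k)"
        using z0 by (intro mult_mono Suc.IH) auto
      finally show ?case by simp
    qed
    also have "\<dots> = \<bar>\<theta>\<bar> ^ 3 * (\<Sum>k<n. 2 * b k ^ 3) + \<theta>\<^sup>2 * (\<Sum>k<n. (b k)\<^sup>2 * (\<integral>x. \<bar>v k x - \<phi>\<bar> \<partial>M))
        + \<theta> ^ 4 * (\<Sum>k<n. \<phi>\<^sup>2 * b k ^ 4)"
      unfolding err_def by (simp only: sum.distrib sum_distrib_left)
    also have "\<dots> \<le> \<bar>\<theta>\<bar> ^ 3 * c1 + \<theta>\<^sup>2 * c2 + \<theta> ^ 4 * c3"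
      unfolding c1_def c2_def c3_def using s summable_b_sq_v_dist b_pos
      by (intro add_mono mult_left_mono sum_le_suminf) (auto simp: less_imp_le)
    also have "\<dots> \<le> \<bar>\<theta>\<bar> ^ 3 * D + \<theta>\<^sup>2 * D + \<theta> ^ 4 * D"
      using nn by (intro add_mono mult_left_mono) (auto simp: D_def)
    finally show "cmod ((\<integral>x. iexp (\<theta> * W n x) \<partial>M) - exp (- (\<theta>\<^sup>2 * \<phi> * V n / 2)))
      \<le> D * (\<bar>\<theta>\<bar> ^ 3 + \<theta>\<^sup>2 + \<theta> ^ 4)"
      by (simp add: Z_def algebra_simps)
  qed
qed

text \<open>Continuity theorem along the arguments t / s_n: they tend to 0, which removes the error
  of \<open>char_bound\<close>, while their squares times \<phi> * \<open>V n\<close> tend to t^2.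
  The scale is arbitrary up to equivalence so that the exact normalization of the walk can be
  inserted later.\<close>

theorem central_limit:
  assumes s: "(\<lambda>n. s n / sqrt (ln (real n))) \<longlonglongrightarrow> sqrt \<phi>"
  shows "weak_conv_m (\<lambda>n. distr M borel (\<lambda>x. W n x / s n)) std_normal_distribution"
proof (rule levy_continuity)
  show "real_distribution (distr M borel (\<lambda>x. W n x / s n))" for n
    by (rule real_distribution_distr) measurable
  show "real_distribution std_normal_distribution" by (rule real_dist_normal_dist)
  fix t :: real
  define \<theta> where "\<theta> n = t / s n" for n
  have ch: "char (distr M borel (\<lambda>x. W n x / s n)) t = (\<integral>x. iexp (\<theta> n * W n x) \<partial>M)" for n
    by (simp add: char_def integral_distr \<theta>_def)
  have ln_top: "filterlim (\<lambda>n. sqrt (ln (real n))) at_top sequentially" by real_asymp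
  have "(\<lambda>n. \<theta> n) \<longlonglongrightarrow> 0"
  proof -
    have "filterlim (\<lambda>n. s n / sqrt (ln (real n)) * sqrt (ln (real n))) at_top sequentially"
      by (rule filterlim_tendsto_pos_mult_at_top[OF s _ ln_top]) (use \<phi>_pos in simp)
    moreover have "eventually (\<lambda>n. s n / sqrt (ln (real n)) * sqrt (ln (real n)) = s n) sequentially"
      using eventually_gt_at_top[of 1] by eventually_elim auto
    ultimately have "filterlim s at_top sequentially"
      using filterlim_cong[OF refl refl] by fastforce
    then show ?thesis
      unfolding \<theta>_def by (intro real_tendsto_divide_at_top[OF tendsto_const])
  qed
  note \<theta>0 = this
  obtain D where D: "\<And>\<theta> n. cmod ((\<integral>x. iexp (\<theta> * W n x) \<partial>M) - exp (- (\<theta>\<^sup>2 * \<phi> * V n / 2)))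
      \<le> D * (\<bar>\<theta>\<bar> ^ 3 + \<theta>\<^sup>2 + \<theta> ^ 4)"
    using char_bound by blast
  have "(\<lambda>n. D * (\<bar>\<theta> n\<bar> ^ 3 + (\<theta> n)\<^sup>2 + \<theta> n ^ 4)) \<longlonglongrightarrow> D * (\<bar>0\<bar> ^ 3 + 0\<^sup>2 + 0 ^ 4)"
    by (intro tendsto_intros \<theta>0)
  then have 1: "(\<lambda>n. (\<integral>x. iexp (\<theta> n * W n x) \<partial>M) - exp (- ((\<theta> n)\<^sup>2 * \<phi> * V n / 2))) \<longlonglongrightarrow> 0"
    by (intro Lim_null_comparison[OF always_eventually[OF allI[OF D]]]) simp
  have "(\<lambda>n. t\<^sup>2 * \<phi> * (V n / ln (real n)) / (s n / sqrt (ln (real n)))\<^sup>2) \<longlonglongrightarrow> t\<^sup>2 * \<phi> * 1 / (sqrt \<phi>)\<^sup>2"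
    using \<phi>_pos by (intro tendsto_intros s V_sim_ln) auto
  moreover have "eventually (\<lambda>n. t\<^sup>2 * \<phi> * (V n / ln (real n)) / (s n / sqrt (ln (real n)))\<^sup>2 = (\<theta> n)\<^sup>2 * \<phi> * V n) sequentially"
    using eventually_gt_at_top[of 1] by eventually_elim (auto simp: \<theta>_def power_divide field_simps)
  ultimately have "(\<lambda>n. (\<theta> n)\<^sup>2 * \<phi> * V n) \<longlonglongrightarrow> t\<^sup>2"
    using \<phi>_pos Lim_transform_eventually by fastforce
  then have "(\<lambda>n. complex_of_real (exp (- ((\<theta> n)\<^sup>2 * \<phi> * V n / 2)))) \<longlonglongrightarrow> complex_of_real (exp (- (t\<^sup>2 / 2)))"
    by (intro tendsto_intros) auto
  from tendsto_add[OF 1 this]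
  show "(\<lambda>n. char (distr M borel (\<lambda>x. W n x / s n)) t) \<longlonglongrightarrow> char std_normal_distribution t"
    by (simp add: ch char_std_normal_distribution)
qed

section \<open>Law of the iterated logarithm: upper bound\<close>

text \<open>The reflected martingale gives the minus sign in the iterated logarithm, and it bounds
  the starting value of a block from below in \<open>lil_lower\<close>.\<close>

lemma uminus_critical_martingale: "critical_martingale M F (\<lambda>n x. - \<xi> n x) v b \<phi> \<kappa> C"
proof -
  have 1: "(\<integral>x. h x * - \<xi> n x \<partial>M) = 0"
    if "h \<in> borel_measurable (F n)" "\<And>x. x \<in> space M \<Longrightarrow> \<bar>h x\<bar> \<le> c" for h n c
    using mean_zero[OF that] by simp
  have 2: "(\<integral>x. h x * (- \<xi> n x)\<^sup>2 \<partial>M) = (\<integral>x. h x * v n x \<partial>M)"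
    if "h \<in> borel_measurable (F n)" "\<And>x. x \<in> space M \<Longrightarrow> \<bar>h x\<bar> \<le> c" for h n c
    using second_moment[OF that] by simp
  have 3: "(\<lambda>x. - \<xi> n x) \<in> borel_measurable (F (Suc n))" for n
    using \<xi>_meas by simp
  have 4: "\<bar>- \<xi> n x\<bar> \<le> 2" if "x \<in> space M" for n x using \<xi>_bound[OF that] by simp
  show ?thesis
    by (intro critical_martingale.intro critical_martingale_axioms.intro prob_space_axioms)
       (fact subalg F_mono 3 4 v_meas v_bound 1 2 v_close b_pos b_lim \<phi>_pos \<kappa>_pos C_nonneg)+
qed

text \<open>Doob's maximal inequality for nonnegative supermartingales, obtained without stopping
  times by following the set of paths that have not yet reached the level.\<close>

lemma nn_supermartingale_maximal:
  assumes Z: "\<And>k. Z k \<in> borel_measurable (F k)"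
    and bd: "\<And>k x. x \<in> space M \<Longrightarrow> 0 \<le> Z k x \<and> Z k x \<le> B k"
    and super: "\<And>k A. A \<in> sets (F k) \<Longrightarrow>
      (\<integral>x. indicator A x * Z (Suc k) x \<partial>M) \<le> (\<integral>x. indicator A x * Z k x \<partial>M)"
    and c: "c > (0::real)"
  shows "c * prob {x \<in> space M. \<exists>k\<le>n. Z k x \<ge> c} \<le> (\<integral>x. Z 0 x \<partial>M)"
proof -
  define G where "G n = {x \<in> space M. \<forall>k\<le>n. Z k x < c}" for n
  have GF: "G n \<in> sets (F n)" for n
  proof -
    have "{x \<in> space (F n). \<forall>k\<in>{..n}. Z k x < c} \<in> sets (F n)"
      by (intro sets.sets_Collect_finite_All' borel_measurable_less F_measurable_mono[OF Z]) auto
    moreover have "G n = {x \<in> space (F n). \<forall>k\<in>{..n}. Z k x < c}" by (auto simp: G_def)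
    ultimately show ?thesis by simp
  qed
  have [measurable]: "G n \<in> sets M" for n by (rule sets_F_M[OF GF])
  have [measurable]: "Z k \<in> borel_measurable M" for k by (rule F_measurable_M[OF Z])
  have iZ: "integrable M (\<lambda>x. indicator A x * Z k x)" if [measurable]: "A \<in> sets M" for A k
  proof (rule integrable_bounded[where c = "B k"])
    show "norm (indicator A x * Z k x) \<le> B k" if "x \<in> space M" for x
      using bd[OF that, of k] by (auto simp: indicator_def)
  qed measurable
  have iI: "integrable M (indicat_real (space M - G n))" for n
    by (rule integrable_bounded[where c = 1]) (auto simp: indicator_def)
  \<comment> \<open>Stopped process with the overshoot cut off: a path that reaches the level is
    frozen at c. As Z is at least c at the crossing, the truncation only lowers the mean.\<close>
  define Y where "Y n x = indicator (G n) x * Z n x + c * indicator (space M - G n) x" for n x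
  have iY: "integrable M (Y n)" for n
    unfolding Y_def[abs_def] by (intro Bochner_Integration.integrable_add iZ integrable_mult_right iI) auto
  have EY: "(\<integral>x. Y n x \<partial>M) \<le> (\<integral>x. Z 0 x \<partial>M)" for n
  proof (induction n)
    case 0
    have "integrable M (\<lambda>x. indicator (space M) x * Z 0 x)" by (rule iZ) simp
    then have "integrable M (Z 0)"
      by (subst Bochner_Integration.integrable_cong[where g = "\<lambda>x. indicator (space M) x * Z 0 x"]) auto
    then show ?case
      by (intro integral_mono iY) (auto simp: Y_def G_def indicator_def)
  next
    case (Suc n)
    have "(\<integral>x. Y (Suc n) x \<partial>M) \<le> (\<integral>x. indicator (G n) x * Z (Suc n) x + c * indicator (space M - G n) x \<partial>M)"
    proof (intro integral_mono iY Bochner_Integration.integrable_add iZ integrable_mult_right iI)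
      fix x assume x: "x \<in> space M"
      have "x \<in> G (Suc n) \<longleftrightarrow> x \<in> G n \<and> Z (Suc n) x < c"
        using x by (auto simp: G_def le_Suc_eq)
      then show "Y (Suc n) x \<le> indicator (G n) x * Z (Suc n) x + c * indicator (space M - G n) x"
        using x bd[OF x, of "Suc n"] by (auto simp: Y_def indicator_def)
    qed auto
    also have "\<dots> = (\<integral>x. indicator (G n) x * Z (Suc n) x \<partial>M) + (\<integral>x. c * indicator (space M - G n) x \<partial>M)"
      by (intro Bochner_Integration.integral_add iZ integrable_mult_right iI) auto
    also have "\<dots> \<le> (\<integral>x. indicator (G n) x * Z n x \<partial>M) + (\<integral>x. c * indicator (space M - G n) x \<partial>M)"
      by (intro add_right_mono super GF)
    also have "\<dots> = (\<integral>x. Y n x \<partial>M)"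
      unfolding Y_def by (intro Bochner_Integration.integral_add[symmetric] iZ integrable_mult_right iI) auto
    finally show ?case using Suc.IH by simp
  qed
  have "{x \<in> space M. \<exists>k\<le>n. Z k x \<ge> c} = space M - G n"
    by (auto simp: G_def not_less)
  then have "c * prob {x \<in> space M. \<exists>k\<le>n. Z k x \<ge> c} = (\<integral>x. c * indicator (space M - G n) x \<partial>M)"
    by simp
  also have "\<dots> \<le> (\<integral>x. Y n x \<partial>M)"
    by (intro integral_mono iY integrable_mult_right iI) (use bd in \<open>auto simp: Y_def indicator_def\<close>)
  also note EY
  finally show ?thesis .
qed

text \<open>The bound |\<xi>| <= 2 puts the exponent within \<epsilon>, where
  \<open>exp_sandwich\<close> applies; the linear term integrates to 0 and the square to
  \<open>v k\<close>. The random \<open>v k\<close> is kept, so that each use can choose its own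
  estimate for it.\<close>

lemma exp_step:
  assumes g: "g \<in> borel_measurable (F k)" and bd: "\<And>x. x \<in> space M \<Longrightarrow> 0 \<le> g x \<and> g x \<le> c"
    and s: "2 * \<bar>s\<bar> \<le> \<epsilon>" "\<epsilon> \<le> 1"
  shows "(\<integral>x. g x * exp (s * \<xi> k x) \<partial>M) \<le> (\<integral>x. g x * (1 + (1 + \<epsilon>) * s\<^sup>2 / 2 * v k x) \<partial>M)"
    and "(\<integral>x. g x * (1 + (1 - \<epsilon>) * s\<^sup>2 / 2 * v k x) \<partial>M) \<le> (\<integral>x. g x * exp (s * \<xi> k x) \<partial>M)"
proof -
  have [measurable]: "g \<in> borel_measurable M" by (rule F_measurable_M[OF g])
  have gb: "\<bar>g x\<bar> \<le> c" if "x \<in> space M" for x using bd[OF that] by auto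
  have int: "integrable M (\<lambda>x. g x * f x)"
    if [measurable]: "f \<in> borel_measurable M" and fb: "\<And>x. x \<in> space M \<Longrightarrow> \<bar>f x\<bar> \<le> d" for f d
  proof (rule integrable_bounded[where c = "c * d"])
    show "norm (g x * f x) \<le> c * d" if x: "x \<in> space M" for x
      using gb[OF x] fb[OF x] by (auto simp: abs_mult intro!: mult_mono)
  qed measurable
  have xi2: "(\<xi> k x)\<^sup>2 \<le> 4" if "x \<in> space M" for x
    using \<xi>_bound[OF that, of k] power_mono[of "\<bar>\<xi> k x\<bar>" 2 2] by simp
  have sx: "\<bar>s * \<xi> k x\<bar> \<le> \<epsilon>" if "x \<in> space M" for x
  proof -
    have "\<bar>s * \<xi> k x\<bar> \<le> \<bar>s\<bar> * 2" unfolding abs_mult using \<xi>_bound[OF that, of k] by (intro mult_left_mono) auto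
    then show ?thesis using s by simp
  qed
  have i0: "integrable M (\<lambda>x. g x * 1)" by (rule int[of "\<lambda>_. 1" 1]) auto
  have i1: "integrable M (\<lambda>x. g x * \<xi> k x)" by (rule int[of "\<xi> k" 2]) (use \<xi>_bound in auto)
  have i2: "integrable M (\<lambda>x. g x * (\<xi> k x)\<^sup>2)" by (rule int[of "\<lambda>x. (\<xi> k x)\<^sup>2" 4]) (use xi2 in auto)
  have i3: "integrable M (\<lambda>x. g x * v k x)" by (rule int[of "v k" 4]) (use v_bound in auto)
  have ie: "integrable M (\<lambda>x. g x * exp (s * \<xi> k x))"
    by (rule int[of "\<lambda>x. exp (s * \<xi> k x)" "exp 1"]) (use sx s in \<open>force simp: abs_le_iff\<close>)+
  have quad: "integrable M (\<lambda>x. g x * (1 + s * \<xi> k x + r * (s * \<xi> k x)\<^sup>2 / 2))"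
    "(\<integral>x. g x * (1 + s * \<xi> k x + r * (s * \<xi> k x)\<^sup>2 / 2) \<partial>M) = (\<integral>x. g x * (1 + r * s\<^sup>2 / 2 * v k x) \<partial>M)" for r
  proof -
    have eq: "g x * (1 + s * \<xi> k x + r * (s * \<xi> k x)\<^sup>2 / 2)
        = g x * 1 + s * (g x * \<xi> k x) + r * s\<^sup>2 / 2 * (g x * (\<xi> k x)\<^sup>2)" for x
      by (simp add: algebra_simps power_mult_distrib)
    have eq': "g x * (1 + r * s\<^sup>2 / 2 * v k x) = g x * 1 + r * s\<^sup>2 / 2 * (g x * v k x)" for x
      by (simp add: algebra_simps)
    show "integrable M (\<lambda>x. g x * (1 + s * \<xi> k x + r * (s * \<xi> k x)\<^sup>2 / 2))"
      unfolding eq by (intro Bochner_Integration.integrable_add integrable_mult_right i0 i1 i2)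
    show "(\<integral>x. g x * (1 + s * \<xi> k x + r * (s * \<xi> k x)\<^sup>2 / 2) \<partial>M) = (\<integral>x. g x * (1 + r * s\<^sup>2 / 2 * v k x) \<partial>M)"
      unfolding eq eq'
      by (simp only: Bochner_Integration.integral_add[OF Bochner_Integration.integrable_add[OF i0 integrable_mult_right[OF i1]] integrable_mult_right[OF i2]]
          Bochner_Integration.integral_add[OF i0 integrable_mult_right[OF i1]]
          Bochner_Integration.integral_add[OF i0 integrable_mult_right[OF i3]]
          integral_mult_right_zero mean_zero[OF g gb] second_moment[OF g gb] mult_zero_right add_0_right)
  qed
  show "(\<integral>x. g x * exp (s * \<xi> k x) \<partial>M) \<le> (\<integral>x. g x * (1 + (1 + \<epsilon>) * s\<^sup>2 / 2 * v k x) \<partial>M)"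
    unfolding quad(2)[symmetric]
    by (intro integral_mono ie quad(1) mult_left_mono exp_sandwich(1)) (use sx s bd in \<open>auto intro: order_trans\<close>)
  show "(\<integral>x. g x * (1 + (1 - \<epsilon>) * s\<^sup>2 / 2 * v k x) \<partial>M) \<le> (\<integral>x. g x * exp (s * \<xi> k x) \<partial>M)"
    unfolding quad(2)[symmetric]
    by (intro integral_mono ie quad(1) mult_left_mono exp_sandwich(2)) (use sx s bd in \<open>auto intro: order_trans\<close>)
qed

text \<open>Predictable quadratic variation of \<open>W\<close>: the value at index k+1 is already
  known at time k.\<close>

definition Q :: "nat \<Rightarrow> 'a \<Rightarrow> real" where
  "Q n x = (\<Sum>k<n. (b k)\<^sup>2 * v k x)"

lemma Q_adapted: "n \<le> Suc m \<Longrightarrow> Q n \<in> borel_measurable (F m)"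
  unfolding Q_def
  by (intro borel_measurable_sum borel_measurable_times borel_measurable_const F_measurable_mono[OF v_meas]) auto

lemma Q_bound: "x \<in> space M \<Longrightarrow> \<bar>Q n x\<bar> \<le> 4 * V n"
proof -
  assume x: "x \<in> space M"
  have "\<bar>Q n x\<bar> \<le> (\<Sum>k<n. \<bar>(b k)\<^sup>2 * v k x\<bar>)" unfolding Q_def by (rule sum_abs)
  also have "\<dots> \<le> (\<Sum>k<n. (b k)\<^sup>2 * 4)"
    using v_bound[OF x] by (intro sum_mono) (auto simp: abs_mult intro!: mult_left_mono)
  finally show ?thesis by (simp add: V_def sum_distrib_left mult.commute)
qed

text \<open>Compensating by the random \<open>Q\<close>, enlarged by 1 + \<epsilon>, yields a
  genuine supermartingale without any control on how far \<open>v\<close> is from \<phi>; that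
  comparison is made pathwise afterwards.\<close>

lemma exp_maximal:
  assumes s: "\<And>k. 2 * \<bar>\<mu>\<bar> * b k \<le> \<epsilon>" "\<epsilon> \<le> 1"
  shows "prob {x \<in> space M. \<exists>k\<le>n. \<mu> * W k x - \<mu>\<^sup>2 * (1 + \<epsilon>) / 2 * Q k x \<ge> c} \<le> exp (- c)"
proof -
  define Z where "Z k x = exp (\<mu> * W k x - \<mu>\<^sup>2 * (1 + \<epsilon>) / 2 * Q k x)" for k x
  define B where "B k = \<bar>\<mu>\<bar> * (2 * (\<Sum>k<k. b k)) + \<bar>\<mu>\<^sup>2 * (1 + \<epsilon>) / 2\<bar> * (4 * V (Suc k))" for k
  have Bb: "\<bar>\<mu> * W k x\<bar> + \<bar>\<mu>\<^sup>2 * (1 + \<epsilon>) / 2 * Q k' x\<bar> \<le> B k"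
    if x: "x \<in> space M" and k: "k' \<le> Suc k" for x k k'
  proof -
    have "\<bar>W k x\<bar> \<le> 2 * (\<Sum>k<k. b k)" using W_diff_bound[OF x, of 0 k] by (simp add: W_def)
    moreover have "\<bar>Q k' x\<bar> \<le> 4 * V (Suc k)" using Q_bound[OF x, of k'] V_mono[OF k] by simp
    ultimately show ?thesis unfolding B_def abs_mult by (intro add_mono mult_mono) auto
  qed
  have ZF: "Z k \<in> borel_measurable (F k)" for k
    unfolding Z_def by (intro measurable_compose[OF _ borel_measurable_exp] borel_measurable_diff
        borel_measurable_times borel_measurable_const W_adapted Q_adapted) auto
  have "exp c * prob {x \<in> space M. \<exists>k\<le>n. Z k x \<ge> exp c} \<le> (\<integral>x. Z 0 x \<partial>M)"
  proof (rule nn_supermartingale_maximal[OF ZF])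
    show "0 \<le> Z k x \<and> Z k x \<le> exp (B k)" if "x \<in> space M" for k x
      using Bb[OF that, of k k] by (simp add: Z_def)
    fix k A assume A: "A \<in> sets (F k)"
    define r where "r = (1 + \<epsilon>) * (\<mu> * b k)\<^sup>2 / 2"
    \<comment> \<open>The compensator of the coming step is already included. This is legitimate
      because \<open>Q (Suc k)\<close> is measurable at time k, and it leaves only the exponential
      of the innovation to be estimated.\<close>
    define g where "g x = indicator A x * exp (\<mu> * W k x - \<mu>\<^sup>2 * (1 + \<epsilon>) / 2 * Q (Suc k) x)" for x
    have QS: "\<mu>\<^sup>2 * (1 + \<epsilon>) / 2 * Q (Suc k) x = \<mu>\<^sup>2 * (1 + \<epsilon>) / 2 * Q k x + r * v k x" for x
      by (simp add: Q_def r_def field_simps power_mult_distrib)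
    have gF: "g \<in> borel_measurable (F k)"
      unfolding g_def using A by (intro measurable_compose[OF _ borel_measurable_exp] borel_measurable_diff
        borel_measurable_times borel_measurable_const W_adapted Q_adapted borel_measurable_indicator) auto
    have [measurable]: "g \<in> borel_measurable M" by (rule F_measurable_M[OF gF])
    have gb: "0 \<le> g x \<and> g x \<le> exp (B k)" if "x \<in> space M" for x
      using Bb[OF that, of "Suc k" k] by (auto simp: g_def indicator_def)
    have "(\<integral>x. indicator A x * Z (Suc k) x \<partial>M) = (\<integral>x. g x * exp (\<mu> * b k * \<xi> k x) \<partial>M)"
      by (simp add: Z_def g_def W_Suc algebra_simps flip: exp_add)
    also have "\<dots> \<le> (\<integral>x. g x * (1 + (1 + \<epsilon>) * (\<mu> * b k)\<^sup>2 / 2 * v k x) \<partial>M)"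
      by (rule exp_step[OF gF gb]) (use s b_pos[of k] in \<open>auto simp: abs_mult ac_simps\<close>)
    also have "\<dots> \<le> (\<integral>x. g x * exp (r * v k x) \<partial>M)"
    proof (rule integral_mono)
      have vb: "\<bar>r * v k x\<bar> \<le> \<bar>r\<bar> * 4" if "x \<in> space M" for x
        unfolding abs_mult using v_bound[OF that, of k] by (intro mult_left_mono) auto
      show "integrable M (\<lambda>x. g x * (1 + (1 + \<epsilon>) * (\<mu> * b k)\<^sup>2 / 2 * v k x))"
      proof (rule integrable_bounded[where c = "exp (B k) * (1 + \<bar>r\<bar> * 4)"])
        show "norm (g x * (1 + (1 + \<epsilon>) * (\<mu> * b k)\<^sup>2 / 2 * v k x)) \<le> exp (B k) * (1 + \<bar>r\<bar> * 4)" if "x \<in> space M" for x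
          using gb[OF that] vb[OF that] unfolding r_def[symmetric] norm_mult by (intro mult_mono) auto
      qed measurable
      show "integrable M (\<lambda>x. g x * exp (r * v k x))"
      proof (rule integrable_bounded[where c = "exp (B k) * exp (\<bar>r\<bar> * 4)"])
        show "norm (g x * exp (r * v k x)) \<le> exp (B k) * exp (\<bar>r\<bar> * 4)" if "x \<in> space M" for x
          using gb[OF that] vb[OF that] unfolding norm_mult by (intro mult_mono) auto
      qed measurable
      fix x assume "x \<in> space M"
      then show "g x * (1 + (1 + \<epsilon>) * (\<mu> * b k)\<^sup>2 / 2 * v k x) \<le> g x * exp (r * v k x)"
        using gb exp_ge_add_one_self[of "r * v k x"] unfolding r_def by (intro mult_left_mono) auto
    qed
    also have "\<dots> = (\<integral>x. indicator A x * Z k x \<partial>M)"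
    proof -
      have "g x * exp (r * v k x) = indicator A x * Z k x" for x
        unfolding g_def Z_def QS by (simp add: mult.assoc flip: exp_add)
      then show ?thesis by simp
    qed
    finally show "(\<integral>x. indicator A x * Z (Suc k) x \<partial>M) \<le> (\<integral>x. indicator A x * Z k x \<partial>M)" .
  qed simp
  then have "exp c * prob {x \<in> space M. \<exists>k\<le>n. \<mu> * W k x - \<mu>\<^sup>2 * (1 + \<epsilon>) / 2 * Q k x \<ge> c} \<le> 1"
    by (simp add: Z_def W_def Q_def prob_space)
  then show ?thesis by (simp add: exp_minus field_simps)
qed

text \<open>The weighted distances of \<open>v\<close> from \<phi> have a finite total expectation,
  so their sum is almost surely finite and serves as R, a random constant independent of n.\<close>

lemma AE_Q_bound: "AE x in M. \<exists>R. \<forall>n. Q n x \<le> \<phi> * V n + R"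
proof -
  define q where "q k x = (b k)\<^sup>2 * \<bar>v k x - \<phi>\<bar>" for k x
  have iv: "integrable M (q k)" for k
  proof (rule integrable_bounded[where c = "(b k)\<^sup>2 * (4 + \<bar>\<phi>\<bar>)"])
    show "norm (q k x) \<le> (b k)\<^sup>2 * (4 + \<bar>\<phi>\<bar>)" if "x \<in> space M" for x
      using v_bound[OF that, of k] by (auto simp: q_def abs_mult intro!: mult_left_mono)
  qed (unfold q_def, measurable)
  have [measurable]: "q k \<in> borel_measurable M" for k using iv by (rule borel_measurable_integrable)
  have nn: "0 \<le> q k x" for k x by (simp add: q_def)
  have "(\<integral>\<^sup>+x. (\<Sum>k. ennreal (q k x)) \<partial>M) = (\<Sum>k. \<integral>\<^sup>+x. ennreal (q k x) \<partial>M)"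
    by (rule nn_integral_suminf) measurable
  also have "\<dots> = (\<Sum>k. ennreal (\<integral>x. q k x \<partial>M))"
    using iv nn by (subst nn_integral_eq_integral) auto
  also have "\<dots> = ennreal (\<Sum>k. \<integral>x. q k x \<partial>M)"
    using summable_b_sq_v_dist nn by (intro suminf_ennreal2) (auto simp: q_def intro!: integral_nonneg)
  finally have "(\<integral>\<^sup>+x. (\<Sum>k. ennreal (q k x)) \<partial>M) \<noteq> \<infinity>" by simp
  then have "AE x in M. (\<Sum>k. ennreal (q k x)) \<noteq> \<infinity>"
    by (intro nn_integral_noteq_infinite) measurable
  then show ?thesis
  proof eventually_elim
    case (elim x)
    have sm: "summable (\<lambda>k. q k x)"
      by (rule summable_suminf_not_top) (use nn elim in auto)
    show ?case
    proof (intro exI allI)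
      fix n
      have "Q n x - \<phi> * V n = (\<Sum>k<n. (b k)\<^sup>2 * (v k x - \<phi>))"
        by (simp add: Q_def V_def sum_distrib_left algebra_simps sum_subtractf)
      also have "\<dots> \<le> (\<Sum>k<n. q k x)" unfolding q_def by (intro sum_mono mult_left_mono) auto
      also have "\<dots> \<le> (\<Sum>k. q k x)" by (rule sum_le_suminf[OF sm]) (use nn in auto)
      finally show "Q n x \<le> \<phi> * V n + (\<Sum>k. q k x)" by simp
    qed
  qed
qed

text \<open>The classical normalization sqrt(2 \<phi> t ln ln t) at the clock time t = ln n, which
  explains the triple logarithm.\<close>

definition \<psi> :: "nat \<Rightarrow> real" where
  "\<psi> n = sqrt (2 * \<phi> * ln (real n) * ln (ln (ln (real n))))"

lemma lil_upper:
  assumes "\<eta> > 0"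
  shows "AE x in M. eventually (\<lambda>n. W n x \<le> (1 + \<eta>) * \<psi> n) sequentially"
proof -
  \<comment> \<open>Three factors 1 + \<epsilon> are lost in total, and (1 + \<epsilon>)^3 <= 1 + 7
    \<epsilon> for \<epsilon> <= 1.\<close>
  define \<epsilon> where "\<epsilon> = min 1 \<eta> / 7"
  define \<rho> where "\<rho> = 1 + \<epsilon>"
  have \<epsilon>: "0 < \<epsilon>" "\<epsilon> \<le> 1" "7 * \<epsilon> \<le> \<eta>" using assms by (auto simp: \<epsilon>_def)
  have \<rho>: "\<rho> > 1" using \<epsilon> by (simp add: \<rho>_def)
  have cube: "(1 + \<epsilon>) ^ 3 \<le> 1 + \<eta>"
  proof -
    have 2: "\<epsilon> * \<epsilon> \<le> \<epsilon>" using \<epsilon> by (intro mult_left_le) auto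
    then have "\<epsilon> * (\<epsilon> * \<epsilon>) \<le> \<epsilon>" using mult_left_le[of "\<epsilon> * \<epsilon>" \<epsilon>] \<epsilon> by linarith
    moreover have "(1 + \<epsilon>) ^ 3 = 1 + 3 * \<epsilon> + 3 * (\<epsilon> * \<epsilon>) + \<epsilon> * (\<epsilon> * \<epsilon>)"
      by (simp add: power3_eq_cube algebra_simps)
    ultimately show ?thesis using \<epsilon> 2 by linarith
  qed
  define N where "N j = nat \<lfloor>exp (\<rho> ^ j)\<rfloor>" for j
  \<comment> \<open>Optimal tilt: it minimizes c / \<mu> + \<mu> s / 2 for c = ln j and s = \<phi>
    \<rho>^j. The level (1 + \<epsilon>) ln j makes the exceptional probability j^(-1-\<epsilon>),
    which is summable.\<close>
  define \<mu> where "\<mu> j = sqrt (2 * ln (real j) / (\<phi> * \<rho> ^ j))" for j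
  define E where "E j = {x \<in> space M. \<exists>k\<le>N j. \<mu> j * W k x - (\<mu> j)\<^sup>2 * (1 + \<epsilon>) / 2 * Q k x \<ge> (1 + \<epsilon>) * ln (real j)}" for j
  have [measurable]: "Q k \<in> borel_measurable M" for k
    by (rule F_measurable_M[OF Q_adapted[of k k]]) simp
  have E_meas: "E j \<in> sets M" for j
  proof -
    have "E j = {x \<in> space M. \<exists>k\<in>{..N j}. \<mu> j * W k x - (\<mu> j)\<^sup>2 * (1 + \<epsilon>) / 2 * Q k x \<ge> (1 + \<epsilon>) * ln (real j)}"
      by (auto simp: E_def)
    also have "\<dots> \<in> sets M" by measurable
    finally show ?thesis .
  qed
  obtain K where K: "K > 0" "\<And>k. b k \<le> K" using b_bound by metis
  have \<mu>0: "\<mu> \<longlonglongrightarrow> 0" unfolding \<mu>_def using \<rho> \<phi>_pos by real_asymp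
  have "eventually (\<lambda>j. \<mu> j < \<epsilon> / (2 * K)) sequentially"
    using order_tendstoD(2)[OF \<mu>0, of "\<epsilon> / (2 * K)"] \<epsilon> K by simp
  then have "eventually (\<lambda>j. norm (prob (E j)) \<le> real j powr (-(1 + \<epsilon>))) sequentially"
    using eventually_gt_at_top[of 1]
  proof eventually_elim
    case (elim j)
    have \<mu>j: "\<mu> j \<ge> 0" using elim \<rho> \<phi>_pos by (simp add: \<mu>_def)
    have "prob (E j) \<le> exp (- ((1 + \<epsilon>) * ln (real j)))"
      unfolding E_def
    proof (rule exp_maximal)
      show "2 * \<bar>\<mu> j\<bar> * b k \<le> \<epsilon>" for k
      proof -
        have "\<mu> j * b k \<le> \<epsilon> / (2 * K) * K"
          using elim \<mu>j K b_pos[of k] \<epsilon> by (intro mult_mono) (auto intro: less_imp_le)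
        then show ?thesis using K \<mu>j by simp
      qed
    qed (use \<epsilon> in auto)
    also have "\<dots> = real j powr (-(1 + \<epsilon>))" using elim by (simp add: powr_def algebra_simps)
    finally show ?case by simp
  qed
  then have "summable (\<lambda>j. prob (E j))"
    by (rule summable_comparison_test_ev) (use \<epsilon> in \<open>subst summable_real_powr_iff, simp\<close>)
  then have "AE x in M. eventually (\<lambda>j. x \<in> space M - E j) sequentially"
    by (intro borel_cantelli_AE1 E_meas) (auto simp: emeasure_eq_measure)
  moreover note AE_Q_bound
  ultimately show ?thesis
  proof eventually_elim
    case (elim x)
    obtain R where R: "\<And>n. Q n x \<le> \<phi> * V n + R" using elim(2) by blast
    have top: "filterlim (\<lambda>j. \<rho> ^ j) at_top sequentially" using \<rho> by real_asymp
    have N_top: "filterlim N at_top sequentially"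
      unfolding N_def using top
      by (intro filterlim_compose[OF filterlim_nat_sequentially] filterlim_compose[OF filterlim_floor_sequentially]
          filterlim_compose[OF exp_at_top])
    have "eventually (\<lambda>n. V n / ln (real n) < 1 + \<epsilon> / 2) sequentially"
      using order_tendstoD(2)[OF V_sim_ln] \<epsilon> by simp
    then have "eventually (\<lambda>n. V n \<le> (1 + \<epsilon> / 2) * ln (real n)) sequentially"
      using eventually_gt_at_top[of 1] by eventually_elim (auto simp: field_simps)
    then have evV: "eventually (\<lambda>j. V (N j) \<le> (1 + \<epsilon> / 2) * ln (real (N j))) sequentially"
      using N_top by (rule eventually_compose_filterlim)
    have evR: "eventually (\<lambda>j. R / (\<phi> * (\<epsilon> / 2)) \<le> \<rho> ^ j) sequentially"
      using top by (simp add: filterlim_at_top)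
    \<comment> \<open>The bound \<open>Q k x\<close> <= (1 + \<epsilon>) \<phi> \<rho>^j splits
      \<epsilon> in two halves, one for comparing \<open>V\<close> with ln, one for the random
      constant R. Then both summants of the bound on \<mu> W are at most (1 + \<epsilon>)^2 ln
      j.\<close>
    have ev1: "eventually (\<lambda>j. \<forall>k\<le>N j. W k x \<le> (1 + \<epsilon>)\<^sup>2 * sqrt (2 * \<phi> * \<rho> ^ j * ln (real j))) sequentially"
      using elim(1) evV evR eventually_gt_at_top[of 1]
        eventually_compose_filterlim[OF eventually_gt_at_top[of 0] N_top]
    proof eventually_elim
      case (elim j)
      have lj: "ln (real j) > 0" using elim by simp
      have \<mu>j: "\<mu> j > 0" using lj \<rho> \<phi>_pos by (simp add: \<mu>_def)
      have \<mu>2: "(\<mu> j)\<^sup>2 * (\<phi> * \<rho> ^ j) = 2 * ln (real j)"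
        using lj \<rho> \<phi>_pos by (simp add: \<mu>_def)
      have \<mu>s: "\<mu> j * sqrt (2 * \<phi> * \<rho> ^ j * ln (real j)) = 2 * ln (real j)"
      proof (rule power2_eq_imp_eq)
        show "(\<mu> j * sqrt (2 * \<phi> * \<rho> ^ j * ln (real j)))\<^sup>2 = (2 * ln (real j))\<^sup>2"
          using lj \<rho> \<phi>_pos by (simp add: \<mu>_def power_mult_distrib) (simp add: power2_eq_square)
      qed (use \<mu>j lj \<rho> \<phi>_pos in auto)
      have "real (N j) \<le> exp (\<rho> ^ j)" unfolding N_def by (simp add: of_nat_nat)
      then have lnN: "ln (real (N j)) \<le> \<rho> ^ j" using elim(5) ln_mono[of "real (N j)" "exp (\<rho> ^ j)"] by simp
      show ?case
      proof (intro allI impI)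
        fix k assume k: "k \<le> N j"
        have "Q k x \<le> \<phi> * V (N j) + R"
          using R[of k] V_mono[OF k] \<phi>_pos by (meson add_right_mono mult_left_mono less_imp_le order_trans)
        also have "\<phi> * V (N j) \<le> \<phi> * ((1 + \<epsilon> / 2) * \<rho> ^ j)"
          using elim(2) lnN \<phi>_pos \<epsilon> by (meson mult_left_mono less_imp_le order_trans add_nonneg_nonneg zero_le_one half_gt_zero)
        also have "R \<le> \<phi> * (\<epsilon> / 2) * \<rho> ^ j" using elim(3) \<phi>_pos \<epsilon> by (simp add: field_simps)
        finally have Qk: "Q k x \<le> (1 + \<epsilon>) * (\<phi> * \<rho> ^ j)" by (simp add: algebra_simps)
        have "\<mu> j * W k x < (1 + \<epsilon>) * ln (real j) + (\<mu> j)\<^sup>2 * (1 + \<epsilon>) / 2 * Q k x"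
          using elim(1) k by (force simp: E_def)
        also have "\<dots> \<le> (1 + \<epsilon>) * ln (real j) + (\<mu> j)\<^sup>2 * (1 + \<epsilon>) / 2 * ((1 + \<epsilon>) * (\<phi> * \<rho> ^ j))"
          using Qk \<epsilon> by (intro add_left_mono mult_left_mono) auto
        also have "\<dots> = (1 + \<epsilon>) * ln (real j) + (1 + \<epsilon>)\<^sup>2 / 2 * ((\<mu> j)\<^sup>2 * (\<phi> * \<rho> ^ j))"
          by (simp add: power2_eq_square)
        also have "\<dots> = (1 + \<epsilon>) * ln (real j) + (1 + \<epsilon>)\<^sup>2 * ln (real j)" unfolding \<mu>2 by simp
        also have "\<dots> \<le> (1 + \<epsilon>)\<^sup>2 * ln (real j) + (1 + \<epsilon>)\<^sup>2 * ln (real j)"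
          using lj \<epsilon> by (intro add_right_mono mult_right_mono) (auto simp: power2_eq_square)
        also have "\<dots> = \<mu> j * ((1 + \<epsilon>)\<^sup>2 * sqrt (2 * \<phi> * \<rho> ^ j * ln (real j)))"
          using \<mu>s by (simp add: algebra_simps)
        finally show "W k x \<le> (1 + \<epsilon>)\<^sup>2 * sqrt (2 * \<phi> * \<rho> ^ j * ln (real j))"
          using \<mu>j by simp
      qed
    qed
    have ev1': "eventually (\<lambda>j. \<forall>k\<le>N (Suc j). W k x \<le> (1 + \<epsilon>)\<^sup>2 * sqrt (2 * \<phi> * \<rho> ^ Suc j * ln (real (Suc j)))) sequentially"
      using ev1 by (subst eventually_sequentially_Suc)
    have lr: "ln \<rho> > 0" using \<rho> by simp
    \<comment> \<open>The bound at the right end of a block has to be compared with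
      \<open>\<psi>\<close> at its left end. The clock contributes a factor \<rho> = 1 + \<epsilon>
      and the iterated logarithm at most another one; under the root this is a single factor 1 +
      \<epsilon>.\<close>
    have "(\<lambda>j. ln (real (Suc j)) / ln (real j * ln \<rho>)) \<longlonglongrightarrow> 1"
      using lr by real_asymp
    then have ev2: "eventually (\<lambda>j. ln (real (Suc j)) / ln (real j * ln \<rho>) < 1 + \<epsilon>) sequentially"
      using order_tendstoD(2) \<epsilon> by fastforce
    have ev3: "eventually (\<lambda>j. real j * ln \<rho> > 1) sequentially" using lr by real_asymp
    show ?case
    proof (rule eventually_geometric_blocks[OF \<rho> eventually_conj[OF ev1' eventually_conj[OF ev2 ev3]]])
      fix j n
      assume *: "(\<forall>k\<le>N (Suc j). W k x \<le> (1 + \<epsilon>)\<^sup>2 * sqrt (2 * \<phi> * \<rho> ^ Suc j * ln (real (Suc j)))) \<and>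
          ln (real (Suc j)) / ln (real j * ln \<rho>) < 1 + \<epsilon> \<and> real j * ln \<rho> > 1"
        and lo: "\<rho> ^ j < ln (real n)" and hi: "ln (real n) \<le> \<rho> ^ Suc j"
      have n0: "n > 0" using lo \<rho> zero_less_power[of \<rho> j] by (cases n) auto
      have lnp: "ln (real n) > 0" using lo \<rho> zero_less_power[of \<rho> j] by linarith
      have lj: "ln (real j * ln \<rho>) > 0" using * by simp
      have "real n \<le> exp (\<rho> ^ Suc j)" using hi n0 by (metis exp_le_cancel_iff exp_ln of_nat_0_less_iff)
      then have "n \<le> N (Suc j)" unfolding N_def by (simp add: le_nat_floor)
      then have "W n x \<le> (1 + \<epsilon>)\<^sup>2 * sqrt (2 * \<phi> * \<rho> ^ Suc j * ln (real (Suc j)))" using * by blast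
      also have "sqrt (2 * \<phi> * \<rho> ^ Suc j * ln (real (Suc j))) \<le> sqrt ((1 + \<epsilon>)\<^sup>2 * (2 * \<phi> * \<rho> ^ j * ln (real j * ln \<rho>)))"
      proof (rule real_sqrt_le_mono)
        have "ln (real (Suc j)) \<le> (1 + \<epsilon>) * ln (real j * ln \<rho>)"
          using * lj by (simp add: pos_divide_less_eq del: of_nat_Suc)
        then have "2 * \<phi> * \<rho> ^ Suc j * ln (real (Suc j)) \<le> 2 * \<phi> * \<rho> ^ Suc j * ((1 + \<epsilon>) * ln (real j * ln \<rho>))"
          using \<phi>_pos \<rho> by (intro mult_left_mono) auto
        also have "\<dots> = (1 + \<epsilon>)\<^sup>2 * (2 * \<phi> * \<rho> ^ j * ln (real j * ln \<rho>))"
          by (simp add: \<rho>_def power2_eq_square)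
        finally show "2 * \<phi> * \<rho> ^ Suc j * ln (real (Suc j)) \<le> (1 + \<epsilon>)\<^sup>2 * (2 * \<phi> * \<rho> ^ j * ln (real j * ln \<rho>))" .
      qed
      also have "\<dots> = (1 + \<epsilon>) * sqrt (2 * \<phi> * \<rho> ^ j * ln (real j * ln \<rho>))"
        using \<epsilon> by (simp add: real_sqrt_mult)
      also have "sqrt (2 * \<phi> * \<rho> ^ j * ln (real j * ln \<rho>)) \<le> \<psi> n"
        unfolding \<psi>_def
      proof (intro real_sqrt_le_mono mult_mono)
        have "real j * ln \<rho> = ln (\<rho> ^ j)" using \<rho> by (simp add: ln_realpow)
        also have "\<dots> < ln (ln (real n))" using lo lnp \<rho> by (subst ln_less_cancel_iff) auto
        finally show "ln (real j * ln \<rho>) \<le> ln (ln (ln (real n)))" using * by (intro ln_mono) auto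
      qed (use lo lnp \<phi>_pos \<rho> lj in auto)
      finally have "W n x \<le> (1 + \<epsilon>)\<^sup>2 * ((1 + \<epsilon>) * \<psi> n)"
        using \<epsilon> by (simp add: mult_left_mono)
      also have "\<dots> = (1 + \<epsilon>) ^ 3 * \<psi> n" by (simp add: power3_eq_cube power2_eq_square)
      also have "\<dots> \<le> (1 + \<eta>) * \<psi> n"
      proof (rule mult_right_mono[OF cube])
        have "0 \<le> sqrt (2 * \<phi> * \<rho> ^ j * ln (real j * ln \<rho>))" using \<phi>_pos \<rho> lj by simp
        also have "\<dots> \<le> \<psi> n" by fact
        finally show "0 \<le> \<psi> n" .
      qed
      finally show "W n x \<le> (1 + \<eta>) * \<psi> n" .
    qed
  qed
qed

section \<open>Law of the iterated logarithm: lower bound\<close>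

lemma tilt_adapted_integrable:
  fixes \<mu> :: real
  assumes A: "A \<in> sets (F m)" and mk: "m \<le> k"
  shows "(\<lambda>x. indicat_real A x * exp (\<mu> * (W k x - W m x))) \<in> borel_measurable (F k)"
    and "x \<in> space M \<Longrightarrow> 0 \<le> indicat_real A x * exp (\<mu> * (W k x - W m x)) \<and>
      indicat_real A x * exp (\<mu> * (W k x - W m x)) \<le> exp (\<bar>\<mu>\<bar> * (2 * (\<Sum>i<k. b i)))"
    and "integrable M (\<lambda>x. indicat_real A x * exp (\<mu> * (W k x - W m x)))"
proof -
  have AM: "A \<in> sets (F k)" using A F_mono[OF mk] by auto
  show meas: "(\<lambda>x. indicat_real A x * exp (\<mu> * (W k x - W m x))) \<in> borel_measurable (F k)"
    by (intro measurable_compose[OF _ borel_measurable_exp] borel_measurable_diff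
        borel_measurable_times borel_measurable_const W_adapted borel_measurable_indicator AM mk order_refl)
  show bd: "0 \<le> indicat_real A x * exp (\<mu> * (W k x - W m x)) \<and>
      indicat_real A x * exp (\<mu> * (W k x - W m x)) \<le> exp (\<bar>\<mu>\<bar> * (2 * (\<Sum>i<k. b i)))" if "x \<in> space M" for x
  proof -
    have "\<bar>\<mu> * (W k x - W m x)\<bar> \<le> \<bar>\<mu>\<bar> * (2 * (\<Sum>i<k. b i))"
      unfolding abs_mult by (intro mult_left_mono W_diff_bound that mk) auto
    then have "\<mu> * (W k x - W m x) \<le> \<bar>\<mu>\<bar> * (2 * (\<Sum>i<k. b i))" by simp
    then show ?thesis by (auto simp: indicator_def)
  qed
  show "integrable M (\<lambda>x. indicat_real A x * exp (\<mu> * (W k x - W m x)))"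
    by (rule integrable_bounded[where c = "exp (\<bar>\<mu>\<bar> * (2 * (\<Sum>i<k. b i)))"])
       (use F_measurable_M[OF meas] bd in auto)
qed

text \<open>Only |\<open>v\<close>| <= 4 is used, whence the constant 4 in the exponent. It is
  applied at twice the actual tilt, to bound the square of an exponential.\<close>

lemma exp_moment_crude:
  fixes \<mu> :: real
  assumes A: "A \<in> sets (F m)" and \<mu>: "\<And>k. 2 * \<bar>\<mu>\<bar> * b k \<le> 1" and mk: "m \<le> k"
  shows "(\<integral>x. indicat_real A x * exp (\<mu> * (W k x - W m x)) \<partial>M) \<le> prob A * exp (4 * \<mu>\<^sup>2 * (V k - V m))"
  using mk
proof (induction k rule: dec_induct)
  case base
  show ?case using sets_F_M[OF A] by simp
next
  case (step k)
  define g where "g x = indicat_real A x * exp (\<mu> * (W k x - W m x))" for x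
  note g = tilt_adapted_integrable[OF A step.hyps(1), where \<mu> = \<mu>, folded g_def]
  have [measurable]: "g \<in> borel_measurable M" by (rule F_measurable_M[OF g(1)])
  have igv: "integrable M (\<lambda>x. g x * (1 + (1 + 1) * (\<mu> * b k)\<^sup>2 / 2 * v k x))"
  proof (rule integrable_bounded[where c = "exp (\<bar>\<mu>\<bar> * (2 * (\<Sum>i<k. b i))) * (1 + (\<mu> * b k)\<^sup>2 * 4)"])
    fix x assume x: "x \<in> space M"
    have "\<bar>(\<mu> * b k)\<^sup>2 * v k x\<bar> \<le> (\<mu> * b k)\<^sup>2 * 4"
      unfolding abs_mult using v_bound[OF x, of k] by (intro mult_mono) auto
    then show "norm (g x * (1 + (1 + 1) * (\<mu> * b k)\<^sup>2 / 2 * v k x)) \<le> exp (\<bar>\<mu>\<bar> * (2 * (\<Sum>i<k. b i))) * (1 + (\<mu> * b k)\<^sup>2 * 4)"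
      unfolding norm_mult using g(2)[OF x] by (intro mult_mono) auto
  qed measurable
  have "(\<integral>x. indicat_real A x * exp (\<mu> * (W (Suc k) x - W m x)) \<partial>M) = (\<integral>x. g x * exp (\<mu> * b k * \<xi> k x) \<partial>M)"
    by (simp add: g_def W_Suc algebra_simps flip: exp_add)
  also have "\<dots> \<le> (\<integral>x. g x * (1 + (1 + 1) * (\<mu> * b k)\<^sup>2 / 2 * v k x) \<partial>M)"
    by (rule exp_step(1)[OF g(1) g(2)]) (use \<mu>[of k] b_pos[of k] in \<open>auto simp: abs_mult\<close>)
  also have "\<dots> \<le> (\<integral>x. g x * (1 + 4 * (\<mu> * b k)\<^sup>2) \<partial>M)"
  proof (rule integral_mono[OF igv])
    show "integrable M (\<lambda>x. g x * (1 + 4 * (\<mu> * b k)\<^sup>2))" using g(3) by simp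
    fix x assume x: "x \<in> space M"
    have "(\<mu> * b k)\<^sup>2 * v k x \<le> (\<mu> * b k)\<^sup>2 * 4" using v_bound[OF x, of k] by (intro mult_left_mono) auto
    then show "g x * (1 + (1 + 1) * (\<mu> * b k)\<^sup>2 / 2 * v k x) \<le> g x * (1 + 4 * (\<mu> * b k)\<^sup>2)"
      using g(2)[OF x] by (intro mult_left_mono) auto
  qed
  also have "\<dots> = (1 + 4 * (\<mu> * b k)\<^sup>2) * (\<integral>x. g x \<partial>M)" by (simp add: mult.commute)
  also have "\<dots> \<le> exp (4 * (\<mu> * b k)\<^sup>2) * (prob A * exp (4 * \<mu>\<^sup>2 * (V k - V m)))"
    using step.IH g(2) by (intro mult_mono exp_ge_add_one_self) (auto simp: g_def[symmetric] intro!: integral_nonneg)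
  also have "\<dots> = prob A * exp (4 * \<mu>\<^sup>2 * (V (Suc k) - V m))"
    by (simp add: V_Suc algebra_simps power_mult_distrib flip: exp_add)
  finally show ?case .
qed

text \<open>Young's inequality separates the tilt from the fluctuation: the square of the
  exponential is the tilt at 2\<mu>, covered by the crude bound with exponent 4 (2\<mu>)^2 = 16
  \<mu>^2, and the squared distance of \<open>v\<close> from \<phi> is covered by
  \<open>v_close\<close> on the past event. The weight (k+1)^(-\<kappa>) balances both.\<close>

lemma exp_moment_v_dist:
  fixes \<mu> :: real
  assumes A: "A \<in> sets (F l)" "l\<^sup>2 \<le> m" "m \<le> k" "k \<le> n"
    and \<mu>: "\<And>k. 4 * \<bar>\<mu>\<bar> * b k \<le> 1"
    and small: "real (Suc m) powr (-\<kappa>) * (exp (16 * \<mu>\<^sup>2 * (V n - V m)) + C) \<le> 2 * c"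
  shows "(\<integral>x. indicat_real A x * exp (\<mu> * (W k x - W m x)) * \<bar>v k x - \<phi>\<bar> \<partial>M) \<le> c * prob A"
proof -
  have lm: "l \<le> m" using A(2) by (rule power2_nat_le_imp_le)
  have AFm: "A \<in> sets (F m)" using A(1) F_mono[OF lm] by auto
  have [measurable]: "A \<in> sets M" by (rule sets_F_M[OF A(1)])
  define \<eta> where "\<eta> = real (Suc k) powr (-\<kappa>)"
  have \<eta>: "\<eta> > 0" by (simp add: \<eta>_def)
  define g where "g p x = indicat_real A x * exp (p * (W k x - W m x))" for p x
  have ig: "integrable M (g p)" for p
    unfolding g_def using tilt_adapted_integrable(3)[OF AFm A(3)] .
  have iv: "integrable M (\<lambda>x. indicat_real A x * (v k x - \<phi>)\<^sup>2)"
  proof (rule integrable_bounded[where c = "(4 + \<bar>\<phi>\<bar>)\<^sup>2"])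
    fix x assume x: "x \<in> space M"
    have "\<bar>v k x - \<phi>\<bar> \<le> \<bar>4 + \<bar>\<phi>\<bar>\<bar>" using v_bound[OF x, of k] by linarith
    then have "(v k x - \<phi>)\<^sup>2 \<le> (4 + \<bar>\<phi>\<bar>)\<^sup>2" by (simp only: abs_le_square_iff)
    then show "norm (indicat_real A x * (v k x - \<phi>)\<^sup>2) \<le> (4 + \<bar>\<phi>\<bar>)\<^sup>2" by (auto simp: indicator_def)
  qed measurable
  have "(\<integral>x. indicat_real A x * exp (\<mu> * (W k x - W m x)) * \<bar>v k x - \<phi>\<bar> \<partial>M)
      \<le> (\<integral>x. \<eta> / 2 * g (2 * \<mu>) x + 1 / (2 * \<eta>) * (indicat_real A x * (v k x - \<phi>)\<^sup>2) \<partial>M)"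
  proof (rule integral_mono)
    show "integrable M (\<lambda>x. indicat_real A x * exp (\<mu> * (W k x - W m x)) * \<bar>v k x - \<phi>\<bar>)"
    proof (rule integrable_bounded[where c = "exp (\<bar>\<mu>\<bar> * (2 * (\<Sum>i<k. b i))) * (4 + \<bar>\<phi>\<bar>)"])
      fix x assume x: "x \<in> space M"
      show "norm (indicat_real A x * exp (\<mu> * (W k x - W m x)) * \<bar>v k x - \<phi>\<bar>) \<le> exp (\<bar>\<mu>\<bar> * (2 * (\<Sum>i<k. b i))) * (4 + \<bar>\<phi>\<bar>)"
        unfolding norm_mult[of _ "\<bar>v k x - \<phi>\<bar>"]
        using tilt_adapted_integrable(2)[OF AFm A(3) x, of \<mu>] v_bound[OF x, of k] by (intro mult_mono) auto
    qed measurable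
    show "integrable M (\<lambda>x. \<eta> / 2 * g (2 * \<mu>) x + 1 / (2 * \<eta>) * (indicat_real A x * (v k x - \<phi>)\<^sup>2))"
      by (intro Bochner_Integration.integrable_add integrable_mult_right ig iv)
    fix x
    have "e * y \<le> \<eta> / 2 * e\<^sup>2 + 1 / (2 * \<eta>) * y\<^sup>2" for e y :: real
      using \<eta> zero_le_power2[of "\<eta> * e - y"] by (simp add: power2_eq_square field_simps)
    from this[of "exp (\<mu> * (W k x - W m x))" "\<bar>v k x - \<phi>\<bar>"]
    show "indicat_real A x * exp (\<mu> * (W k x - W m x)) * \<bar>v k x - \<phi>\<bar> \<le>
        \<eta> / 2 * g (2 * \<mu>) x + 1 / (2 * \<eta>) * (indicat_real A x * (v k x - \<phi>)\<^sup>2)"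
      by (auto simp: g_def indicator_def mult.assoc exp_double)
  qed
  also have "\<dots> = \<eta> / 2 * (\<integral>x. g (2 * \<mu>) x \<partial>M) + 1 / (2 * \<eta>) * (\<integral>x. indicat_real A x * (v k x - \<phi>)\<^sup>2 \<partial>M)"
    by (subst Bochner_Integration.integral_add) (use ig iv in auto)
  also have "\<dots> \<le> \<eta> / 2 * (prob A * exp (16 * \<mu>\<^sup>2 * (V n - V m))) + 1 / (2 * \<eta>) * (C * \<eta>\<^sup>2 * prob A)"
  proof (intro add_mono mult_left_mono)
    have "(\<integral>x. g (2 * \<mu>) x \<partial>M) \<le> prob A * exp (4 * (2 * \<mu>)\<^sup>2 * (V k - V m))"
      unfolding g_def by (rule exp_moment_crude[OF AFm _ A(3)]) (use \<mu> in \<open>auto simp: abs_mult\<close>)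
    also have "\<dots> \<le> prob A * exp (16 * \<mu>\<^sup>2 * (V n - V m))"
      using V_mono[OF A(4)] by (intro mult_left_mono) (auto simp: power_mult_distrib intro!: mult_left_mono)
    finally show "(\<integral>x. g (2 * \<mu>) x \<partial>M) \<le> prob A * exp (16 * \<mu>\<^sup>2 * (V n - V m))" .
    have "(\<integral>x. indicat_real A x * (v k x - \<phi>)\<^sup>2 \<partial>M) \<le> C * real (Suc k) powr (-2 * \<kappa>) * prob A"
      by (rule v_close[OF A(1)]) (use A in simp)
    also have "real (Suc k) powr (-2 * \<kappa>) = \<eta>\<^sup>2"
      using powr_add[of "real (Suc k)" "-\<kappa>" "-\<kappa>"] by (simp add: \<eta>_def power2_eq_square)
    finally show "(\<integral>x. indicat_real A x * (v k x - \<phi>)\<^sup>2 \<partial>M) \<le> C * \<eta>\<^sup>2 * prob A" .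
  qed (use \<eta> in auto)
  also have "\<dots> = \<eta> * (exp (16 * \<mu>\<^sup>2 * (V n - V m)) + C) / 2 * prob A"
    using \<eta> by (simp add: field_simps power2_eq_square)
  also have "\<dots> \<le> c * prob A"
  proof (rule mult_right_mono)
    have "\<eta> \<le> real (Suc m) powr (-\<kappa>)"
      unfolding \<eta>_def using A \<kappa>_pos by (intro powr_mono2') auto
    then have "\<eta> * (exp (16 * \<mu>\<^sup>2 * (V n - V m)) + C) \<le> real (Suc m) powr (-\<kappa>) * (exp (16 * \<mu>\<^sup>2 * (V n - V m)) + C)"
      using C_nonneg by (intro mult_right_mono) (auto simp: add_nonneg_nonneg)
    with small show "\<eta> * (exp (16 * \<mu>\<^sup>2 * (V n - V m)) + C) / 2 \<le> c" by simp
  qed auto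
  finally show ?thesis .
qed

text \<open>Each factor 1 \<plusminus> \<epsilon> pays for one approximation: the exponential by a
  quadratic, and \<open>v\<close> by \<phi>. The third factor below comes from writing 1 + y as an
  exponential.\<close>

lemma exp_moment_sandwich:
  fixes \<mu> :: real
  assumes A: "A \<in> sets (F l)" "l\<^sup>2 \<le> m" "m \<le> n"
    and \<mu>: "\<And>k. 4 * \<bar>\<mu>\<bar> * b k \<le> \<epsilon>" and \<epsilon>: "0 < \<epsilon>" "\<epsilon> \<le> 1" "\<phi> * \<epsilon> \<le> 1"
    and small: "real (Suc m) powr (-\<kappa>) * (exp (16 * \<mu>\<^sup>2 * (V n - V m)) + C) \<le> 2 * (\<epsilon> * \<phi>)"
  defines "u \<equiv> \<lambda>k. (\<integral>x. indicat_real A x * exp (\<mu> * (W k x - W m x)) \<partial>M)"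
  shows "prob A * exp ((1 - \<epsilon>) ^ 3 * \<mu>\<^sup>2 * \<phi> * (V n - V m) / 2) \<le> u n"
    and "u n \<le> prob A * exp ((1 + \<epsilon>)\<^sup>2 * \<mu>\<^sup>2 * \<phi> * (V n - V m) / 2)"
proof -
  have lm: "l \<le> m" using A(2) by (rule power2_nat_le_imp_le)
  have AFm: "A \<in> sets (F m)" using A(1) F_mono[OF lm] by auto
  have [measurable]: "A \<in> sets M" by (rule sets_F_M[OF A(1)])
  have "prob A * exp ((1 - \<epsilon>) ^ 3 * \<mu>\<^sup>2 * \<phi> * (V k - V m) / 2) \<le> u k \<and>
      u k \<le> prob A * exp ((1 + \<epsilon>)\<^sup>2 * \<mu>\<^sup>2 * \<phi> * (V k - V m) / 2)" if "m \<le> k" "k \<le> n" for k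
    using that
  proof (induction k rule: dec_induct)
    case base
    show ?case by (simp add: u_def)
  next
    case (step k)
    define s where "s = \<mu> * b k"
    define g where "g x = indicat_real A x * exp (\<mu> * (W k x - W m x))" for x
    note g = tilt_adapted_integrable[OF AFm step.hyps(1), where \<mu> = \<mu>, folded g_def]
    have [measurable]: "g \<in> borel_measurable M" by (rule F_measurable_M[OF g(1)])
    have s\<epsilon>: "4 * \<bar>s\<bar> \<le> \<epsilon>" using \<mu>[of k] b_pos[of k] by (simp add: s_def abs_mult)
    have IH: "prob A * exp ((1 - \<epsilon>) ^ 3 * \<mu>\<^sup>2 * \<phi> * (V k - V m) / 2) \<le> u k"
      "u k \<le> prob A * exp ((1 + \<epsilon>)\<^sup>2 * \<mu>\<^sup>2 * \<phi> * (V k - V m) / 2)" using step by auto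
    have uk: "u k = (\<integral>x. g x \<partial>M)" by (simp add: u_def g_def)
    have uS: "u (Suc k) = (\<integral>x. g x * exp (s * \<xi> k x) \<partial>M)"
      by (simp add: u_def g_def s_def W_Suc algebra_simps flip: exp_add)
    \<comment> \<open>The lower half of the induction hypothesis is needed for both halves of the
      step: since \<open>u k\<close> is at least prob A, an error proportional to prob A becomes a
      relative error of \<open>u k\<close>.\<close>
    have "prob A * 1 \<le> prob A * exp ((1 - \<epsilon>) ^ 3 * \<mu>\<^sup>2 * \<phi> * (V k - V m) / 2)"
      using V_mono[OF step.hyps(1)] \<epsilon> \<phi>_pos by (intro mult_left_mono) auto
    then have pu: "prob A \<le> u k" using IH by simp
    have igv: "integrable M (\<lambda>x. g x * v k x)"
    proof (rule integrable_bounded[where c = "exp (\<bar>\<mu>\<bar> * (2 * (\<Sum>i<k. b i))) * 4"])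
      fix x assume x: "x \<in> space M"
      show "norm (g x * v k x) \<le> exp (\<bar>\<mu>\<bar> * (2 * (\<Sum>i<k. b i))) * 4"
        unfolding norm_mult using g(2)[OF x] v_bound[OF x, of k] by (intro mult_mono) auto
    qed measurable
    have "\<bar>(\<integral>x. g x * v k x \<partial>M) - \<phi> * u k\<bar> = \<bar>\<integral>x. g x * (v k x - \<phi>) \<partial>M\<bar>"
      unfolding uk using g(3) igv by (simp add: right_diff_distrib mult.commute)
    also have "\<dots> \<le> (\<integral>x. \<bar>g x * (v k x - \<phi>)\<bar> \<partial>M)"
      using integral_norm_bound[of M "\<lambda>x. g x * (v k x - \<phi>)"] by simp
    also have "\<dots> = (\<integral>x. indicat_real A x * exp (\<mu> * (W k x - W m x)) * \<bar>v k x - \<phi>\<bar> \<partial>M)"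
      by (simp add: g_def abs_mult)
    also have "\<dots> \<le> \<epsilon> * \<phi> * prob A"
      by (rule exp_moment_v_dist[OF A(1,2) step.hyps(1) _ _ small])
         (use step.prems \<mu> \<epsilon> in \<open>auto intro: order_trans\<close>)
    also have "\<dots> \<le> \<epsilon> * \<phi> * u k" using pu \<epsilon> \<phi>_pos by (intro mult_left_mono) auto
    finally have near: "\<bar>(\<integral>x. g x * v k x \<partial>M) - \<phi> * u k\<bar> \<le> \<epsilon> * \<phi> * u k" .
    have lin: "(\<integral>x. g x * (1 + r * v k x) \<partial>M) = u k + r * (\<integral>x. g x * v k x \<partial>M)" for r
    proof -
      have "(\<integral>x. g x * (1 + r * v k x) \<partial>M) = (\<integral>x. g x + r * (g x * v k x) \<partial>M)"
        by (simp add: algebra_simps)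
      then show ?thesis unfolding uk using g(3) igv by simp
    qed
    have u0: "u k \<ge> 0" using pu measure_nonneg order_trans by blast
    have "u (Suc k) \<le> u k + (1 + \<epsilon>) * s\<^sup>2 / 2 * (\<integral>x. g x * v k x \<partial>M)"
      unfolding uS lin[symmetric] by (rule exp_step(1)[OF g(1,2)]) (use s\<epsilon> \<epsilon> in auto)
    also have "\<dots> \<le> u k + (1 + \<epsilon>) * s\<^sup>2 / 2 * ((1 + \<epsilon>) * \<phi> * u k)"
      using near \<epsilon> by (intro add_left_mono mult_left_mono) (auto simp: abs_le_iff algebra_simps)
    also have "\<dots> = u k * (1 + (1 + \<epsilon>)\<^sup>2 * s\<^sup>2 * \<phi> / 2)" by (simp add: power2_eq_square algebra_simps)
    also have "\<dots> \<le> (prob A * exp ((1 + \<epsilon>)\<^sup>2 * \<mu>\<^sup>2 * \<phi> * (V k - V m) / 2)) * exp ((1 + \<epsilon>)\<^sup>2 * s\<^sup>2 * \<phi> / 2)"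
      using u0 \<phi>_pos IH by (intro mult_mono exp_ge_add_one_self) auto
    also have "\<dots> = prob A * exp ((1 + \<epsilon>)\<^sup>2 * \<mu>\<^sup>2 * \<phi> * (V (Suc k) - V m) / 2)"
      by (simp add: V_Suc s_def power_mult_distrib field_simps flip: exp_add)
    finally have up: "u (Suc k) \<le> prob A * exp ((1 + \<epsilon>)\<^sup>2 * \<mu>\<^sup>2 * \<phi> * (V (Suc k) - V m) / 2)" .
    define y where "y = (1 - \<epsilon>)\<^sup>2 * s\<^sup>2 * \<phi> / 2"
    have "prob A * exp ((1 - \<epsilon>) ^ 3 * \<mu>\<^sup>2 * \<phi> * (V (Suc k) - V m) / 2)
        = (prob A * exp ((1 - \<epsilon>) ^ 3 * \<mu>\<^sup>2 * \<phi> * (V k - V m) / 2)) * exp ((1 - \<epsilon>) * y)"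
      by (simp add: V_Suc s_def y_def power_mult_distrib power3_eq_cube power2_eq_square field_simps flip: exp_add)
    also have "\<dots> \<le> u k * (1 + y)"
    proof (intro mult_mono exp_shrunk_le_one_plus IH)
      have s1: "s\<^sup>2 \<le> \<epsilon>\<^sup>2" using s\<epsilon> \<epsilon> by (subst abs_le_square_iff[symmetric]) auto
      have e1: "(1 - \<epsilon>)\<^sup>2 \<le> 1" using \<epsilon> by (simp add: abs_square_le_1)
      have "y \<le> 1 * \<epsilon>\<^sup>2 * \<phi> / 2" unfolding y_def using s1 e1 \<phi>_pos by (intro divide_right_mono mult_mono) auto
      also have "\<dots> = \<epsilon> * (\<phi> * \<epsilon>) / 2" by (simp add: power2_eq_square)
      also have "\<dots> \<le> \<epsilon>" using \<epsilon> mult_left_le[of "\<phi> * \<epsilon>" \<epsilon>] by simp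
      finally show "y \<le> \<epsilon>" .
      show "0 \<le> y" using \<phi>_pos by (simp add: y_def)
    qed (use \<epsilon> u0 in auto)
    also have "\<dots> = u k + (1 - \<epsilon>) * s\<^sup>2 / 2 * ((1 - \<epsilon>) * \<phi> * u k)"
      by (simp add: y_def power2_eq_square algebra_simps)
    also have "\<dots> \<le> u k + (1 - \<epsilon>) * s\<^sup>2 / 2 * (\<integral>x. g x * v k x \<partial>M)"
    proof (intro add_left_mono mult_left_mono)
      show "(1 - \<epsilon>) * \<phi> * u k \<le> (\<integral>x. g x * v k x \<partial>M)" using near by (simp add: abs_le_iff algebra_simps)
    qed (use \<epsilon> in auto)
    also have "\<dots> \<le> u (Suc k)"
      unfolding uS lin[symmetric] by (rule exp_step(2)[OF g(1,2)]) (use s\<epsilon> \<epsilon> in auto)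
    finally show ?case using up by simp
  qed
  from this[of n] A(3) show "prob A * exp ((1 - \<epsilon>) ^ 3 * \<mu>\<^sup>2 * \<phi> * (V n - V m) / 2) \<le> u n"
    "u n \<le> prob A * exp ((1 + \<epsilon>)\<^sup>2 * \<mu>\<^sup>2 * \<phi> * (V n - V m) / 2)" by auto
qed

text \<open>The increment exceeds \<open>(1 - \<delta>) r s\<close> because, under the measure tilted by \<open>exp (r (W n - W m))\<close>,
  it has mean about \<open>r s\<close>; both deviations by \<open>\<delta> r s\<close> are excluded by the moments at \<open>(1 \<plusminus> \<delta>) r\<close>.\<close>

lemma block_lower_bound:
  fixes r \<delta> :: real
  assumes A: "A \<in> sets (F l)" "l\<^sup>2 \<le> m" "m \<le> n" and \<delta>: "0 < \<delta>" "\<delta> \<le> 1 / 2" "\<phi> * \<delta>\<^sup>2 \<le> 24" and r: "r > 0"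
    and b_small: "\<And>k. 8 * r * b k \<le> \<delta>\<^sup>2 / 24"
    and small: "real (Suc m) powr (-\<kappa>) * (exp (64 * r\<^sup>2 * (V n - V m)) + C) \<le> \<delta>\<^sup>2 / 12 * \<phi>"
  defines "s \<equiv> \<phi> * (V n - V m)"
  assumes large: "8 \<le> r\<^sup>2 * s * \<delta>\<^sup>2"
  shows "prob A / 2 * exp (- (r\<^sup>2 * s * (1 / 2 + 2 * \<delta>))) \<le> prob ({x \<in> space M. W n x - W m x \<ge> (1 - \<delta>) * r * s} \<inter> A)"
proof -
  have lm: "l \<le> m" using A(2) by (rule power2_nat_le_imp_le)
  have AFm: "A \<in> sets (F m)" using A(1) F_mono[OF lm] by auto
  have [measurable]: "A \<in> sets M" by (rule sets_F_M[OF A(1)])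
  \<comment> \<open>\<open>e\<close> = 3 \<epsilon> absorbs the three factors of
    \<open>exp_moment_sandwich\<close> and equals \<delta>^2/8, the margin allowed in
    \<open>tilted_exponents\<close>. All tilts used are at most 2 r.\<close>
  define \<epsilon> e L where "\<epsilon> = \<delta>\<^sup>2 / 24" and "e = \<delta>\<^sup>2 / 8" and "L = r\<^sup>2 * s"
  have d2: "\<delta>\<^sup>2 \<le> 1" "\<delta>\<^sup>2 > 0" using \<delta> by (auto simp: abs_square_le_1)
  have \<epsilon>: "0 < \<epsilon>" "\<epsilon> \<le> 1" "\<phi> * \<epsilon> \<le> 1" "e = 3 * \<epsilon>" using d2 \<delta> by (auto simp: \<epsilon>_def e_def)
  have s0: "s \<ge> 0" using \<phi>_pos V_mono[OF A(3)] by (simp add: s_def)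
  have e3: "1 - e \<le> (1 - \<epsilon>) ^ 3" "(1 + \<epsilon>)\<^sup>2 \<le> 1 + e"
  proof -
    have 1: "\<epsilon> * \<epsilon> \<le> \<epsilon>" using \<epsilon> by (intro mult_left_le) auto
    then have "\<epsilon> * (\<epsilon> * \<epsilon>) \<le> \<epsilon> * \<epsilon>" using \<epsilon> mult_left_mono by fastforce
    moreover have "(1 - \<epsilon>) ^ 3 = 1 - 3 * \<epsilon> + 3 * (\<epsilon> * \<epsilon>) - \<epsilon> * (\<epsilon> * \<epsilon>)" "(1 + \<epsilon>)\<^sup>2 = 1 + 2 * \<epsilon> + \<epsilon> * \<epsilon>"
      by (simp_all add: power3_eq_cube power2_eq_square algebra_simps)
    ultimately show "1 - e \<le> (1 - \<epsilon>) ^ 3" "(1 + \<epsilon>)\<^sup>2 \<le> 1 + e" using 1 \<epsilon>(4) zero_le_square[of \<epsilon>] by linarith+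
  qed
  define u where "u \<mu> = (\<integral>x. indicat_real A x * exp (\<mu> * (W n x - W m x)) \<partial>M)" for \<mu>
  have u: "prob A * exp (\<mu>\<^sup>2 * s * (1 - e) / 2) \<le> u \<mu> \<and> u \<mu> \<le> prob A * exp (\<mu>\<^sup>2 * s * (1 + e) / 2)"
    if \<mu>: "0 \<le> \<mu>" "\<mu> \<le> 2 * r" for \<mu>
  proof -
    have 4: "4 * \<bar>\<mu>\<bar> * b k \<le> \<epsilon>" for k
    proof -
      have "4 * \<mu> * b k \<le> 4 * (2 * r) * b k" using \<mu> b_pos[of k] by (intro mult_right_mono mult_left_mono) auto
      then show ?thesis using b_small[of k] \<mu> by (simp add: \<epsilon>_def)
    qed
    have sm: "real (Suc m) powr (-\<kappa>) * (exp (16 * \<mu>\<^sup>2 * (V n - V m)) + C) \<le> 2 * (\<epsilon> * \<phi>)"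
    proof -
      have "\<mu>\<^sup>2 \<le> (2 * r)\<^sup>2" using \<mu> by (intro power_mono) auto
      then have "16 * \<mu>\<^sup>2 * (V n - V m) \<le> 64 * r\<^sup>2 * (V n - V m)"
        using V_mono[OF A(3)] by (intro mult_right_mono) (auto simp: power_mult_distrib)
      then have "real (Suc m) powr (-\<kappa>) * (exp (16 * \<mu>\<^sup>2 * (V n - V m)) + C)
        \<le> real (Suc m) powr (-\<kappa>) * (exp (64 * r\<^sup>2 * (V n - V m)) + C)"
        by (intro mult_left_mono add_right_mono) auto
      from order_trans[OF this small] show ?thesis by (simp add: \<epsilon>_def mult.commute)
    qed
    note mom = exp_moment_sandwich[OF A 4 \<epsilon>(1-3) sm, folded u_def]
    have ms: "0 \<le> \<mu>\<^sup>2 * s / 2" using s0 by simp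
    have "\<mu>\<^sup>2 * s * (1 - e) / 2 \<le> (1 - \<epsilon>) ^ 3 * \<mu>\<^sup>2 * \<phi> * (V n - V m) / 2"
      using mult_left_mono[OF e3(1) ms] by (simp add: s_def algebra_simps)
    moreover have "(1 + \<epsilon>)\<^sup>2 * \<mu>\<^sup>2 * \<phi> * (V n - V m) / 2 \<le> \<mu>\<^sup>2 * s * (1 + e) / 2"
      using mult_left_mono[OF e3(2) ms] by (simp add: s_def algebra_simps)
    ultimately show ?thesis using mom
      by (meson exp_le_cancel_iff mult_left_mono measure_nonneg order_trans)
  qed
  define T where "T = {x \<in> space M. W n x - W m x \<ge> (1 - \<delta>) * r * s} \<inter> A"
  have [measurable]: "T \<in> sets M" unfolding T_def by measurable
  have iu: "integrable M (\<lambda>x. indicat_real A x * exp (\<mu> * (W n x - W m x)))" for \<mu>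
    by (rule tilt_adapted_integrable(3)[OF AFm A(3)])
  have L0: "L \<ge> 0" using s0 by (simp add: L_def)
  have "u r \<le> (\<integral>x. exp (- (\<delta> * (1 + \<delta>) * L)) * (indicat_real A x * exp ((1 + \<delta>) * r * (W n x - W m x)))
      + exp (\<delta> * (1 - \<delta>) * L) * (indicat_real A x * exp ((1 - \<delta>) * r * (W n x - W m x)))
      + exp ((1 + \<delta>) * L) * indicat_real T x \<partial>M)"
    unfolding u_def
  proof (rule integral_mono[OF iu])
    show "integrable M (\<lambda>x. exp (- (\<delta> * (1 + \<delta>) * L)) * (indicat_real A x * exp ((1 + \<delta>) * r * (W n x - W m x)))
      + exp (\<delta> * (1 - \<delta>) * L) * (indicat_real A x * exp ((1 - \<delta>) * r * (W n x - W m x)))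
      + exp ((1 + \<delta>) * L) * indicat_real T x)"
      by (intro Bochner_Integration.integrable_add integrable_mult_right iu) (simp add: emeasure_eq_measure)
    fix x assume x: "x \<in> space M"
    define D where "D = W n x - W m x"
    show "indicat_real A x * exp (r * (W n x - W m x)) \<le>
      exp (- (\<delta> * (1 + \<delta>) * L)) * (indicat_real A x * exp ((1 + \<delta>) * r * (W n x - W m x)))
      + exp (\<delta> * (1 - \<delta>) * L) * (indicat_real A x * exp ((1 - \<delta>) * r * (W n x - W m x)))
      + exp ((1 + \<delta>) * L) * indicat_real T x"
      unfolding D_def[symmetric]
    proof (cases "x \<in> A")
      case True
      have rd: "r * \<delta> > 0" using r \<delta> by simp
      \<comment> \<open>On either far region exp(r D) is dominated, as in Markov's inequality, by a
        constant times the exponential at (1 \<plusminus> \<delta>) r; in the middle it is at most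
        exp((1 + \<delta>) L).\<close>
      consider "D > (1 + \<delta>) * r * s" | "D < (1 - \<delta>) * r * s" | "(1 - \<delta>) * r * s \<le> D" "D \<le> (1 + \<delta>) * r * s" by linarith
      then have "exp (r * D) \<le> exp (- (\<delta> * (1 + \<delta>) * L)) * exp ((1 + \<delta>) * r * D)
          + exp (\<delta> * (1 - \<delta>) * L) * exp ((1 - \<delta>) * r * D) + exp ((1 + \<delta>) * L) * indicat_real T x"
      proof cases
        case 1
        have "(r * \<delta>) * ((1 + \<delta>) * r * s) \<le> (r * \<delta>) * D" using 1 rd by (intro mult_left_mono) auto
        then have "r * D \<le> - (\<delta> * (1 + \<delta>) * L) + (1 + \<delta>) * r * D" by (simp add: L_def power2_eq_square algebra_simps)
        then have "exp (r * D) \<le> exp (- (\<delta> * (1 + \<delta>) * L)) * exp ((1 + \<delta>) * r * D)" by (simp flip: exp_add)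
        then show ?thesis by (smt (verit) exp_ge_zero indicator_pos_le mult_nonneg_nonneg)
      next
        case 2
        have "(r * \<delta>) * D \<le> (r * \<delta>) * ((1 - \<delta>) * r * s)" using 2 rd by (intro mult_left_mono) auto
        then have "r * D \<le> \<delta> * (1 - \<delta>) * L + (1 - \<delta>) * r * D" by (simp add: L_def power2_eq_square algebra_simps)
        then have "exp (r * D) \<le> exp (\<delta> * (1 - \<delta>) * L) * exp ((1 - \<delta>) * r * D)" by (simp flip: exp_add)
        then show ?thesis by (smt (verit) exp_ge_zero indicator_pos_le mult_nonneg_nonneg)
      next
        case 3
        have "x \<in> T" using 3 x True by (simp add: T_def D_def)
        moreover have "r * D \<le> r * ((1 + \<delta>) * r * s)" using 3 r by (intro mult_left_mono) auto
        then have "r * D \<le> (1 + \<delta>) * L" by (simp add: L_def power2_eq_square algebra_simps)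
        ultimately show ?thesis by (smt (verit) exp_ge_zero exp_le_cancel_iff indicator_simps(1) mult_nonneg_nonneg mult_cancel_left2)
      qed
      then show "indicat_real A x * exp (r * D) \<le>
        exp (- (\<delta> * (1 + \<delta>) * L)) * (indicat_real A x * exp ((1 + \<delta>) * r * D))
        + exp (\<delta> * (1 - \<delta>) * L) * (indicat_real A x * exp ((1 - \<delta>) * r * D))
        + exp ((1 + \<delta>) * L) * indicat_real T x" using True by simp
    qed (simp add: T_def)
  qed
  also have "\<dots> = exp (- (\<delta> * (1 + \<delta>) * L)) * u ((1 + \<delta>) * r) + exp (\<delta> * (1 - \<delta>) * L) * u ((1 - \<delta>) * r)
      + exp ((1 + \<delta>) * L) * prob T"
  proof -
    have iT: "integrable M (indicat_real T)" by (simp add: emeasure_eq_measure)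
    have ET: "(\<integral>x. indicat_real T x \<partial>M) = prob T" by simp
    show ?thesis
      unfolding u_def ET[symmetric]
      by (simp only: integral_mult_right_zero
        Bochner_Integration.integral_add[OF Bochner_Integration.integrable_add[OF integrable_mult_right[OF iu] integrable_mult_right[OF iu]] integrable_mult_right[OF iT]]
        Bochner_Integration.integral_add[OF integrable_mult_right[OF iu] integrable_mult_right[OF iu]])
  qed
  also have "\<dots> \<le> exp (- (\<delta> * (1 + \<delta>) * L)) * (prob A * exp (((1 + \<delta>) * r)\<^sup>2 * s * (1 + e) / 2))
      + exp (\<delta> * (1 - \<delta>) * L) * (prob A * exp (((1 - \<delta>) * r)\<^sup>2 * s * (1 + e) / 2)) + exp ((1 + \<delta>) * L) * prob T"
    using u[of "(1 + \<delta>) * r"] u[of "(1 - \<delta>) * r"] r \<delta>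
    by (intro add_mono mult_left_mono order_refl) auto
  also have "\<dots> = prob A * exp (L * ((1 + \<delta>)\<^sup>2 * (1 + e) / 2 - \<delta> * (1 + \<delta>)))
      + prob A * exp (L * ((1 - \<delta>)\<^sup>2 * (1 + e) / 2 + \<delta> * (1 - \<delta>))) + exp ((1 + \<delta>) * L) * prob T"
  proof -
    have 1: "L * ((1 + \<delta>)\<^sup>2 * (1 + e) / 2 - \<delta> * (1 + \<delta>)) = - (\<delta> * (1 + \<delta>) * L) + ((1 + \<delta>) * r)\<^sup>2 * s * (1 + e) / 2"
      unfolding L_def power_mult_distrib by (simp add: right_diff_distrib)
    have 2: "L * ((1 - \<delta>)\<^sup>2 * (1 + e) / 2 + \<delta> * (1 - \<delta>)) = \<delta> * (1 - \<delta>) * L + ((1 - \<delta>) * r)\<^sup>2 * s * (1 + e) / 2"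
      unfolding L_def power_mult_distrib by (simp add: distrib_left)
    show ?thesis unfolding 1 2 exp_add by (simp only: mult.left_commute)
  qed
  \<comment> \<open>Each far region carries at most a quarter of the lower bound for
    \<open>u r\<close>, so at least half of that bound must come from \<open>T\<close>.\<close>
  also have "\<dots> \<le> prob A * (exp (L * (1 - e) / 2) / 4) + prob A * (exp (L * (1 - e) / 2) / 4) + exp ((1 + \<delta>) * L) * prob T"
    using tilted_exponents(1,2)[of \<delta> e L] \<delta> large \<epsilon> by (intro add_mono mult_left_mono) (auto simp: e_def L_def)
  finally have "u r \<le> prob A * exp (L * (1 - e) / 2) / 2 + exp ((1 + \<delta>) * L) * prob T" by simp
  moreover have "prob A * exp (L * (1 - e) / 2) \<le> u r" using u[of r] r by (simp add: L_def)
  ultimately have "prob A * exp (L * (1 - e) / 2) / 2 \<le> exp ((1 + \<delta>) * L) * prob T" by simp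
  then have "exp (- ((1 + \<delta>) * L)) * (prob A * exp (L * (1 - e) / 2) / 2) \<le> exp (- ((1 + \<delta>) * L)) * (exp ((1 + \<delta>) * L) * prob T)"
    by (rule mult_left_mono) simp
  also have "\<dots> = prob T" by (simp add: mult.assoc[symmetric] flip: exp_add)
  finally have "prob A / 2 * exp (- ((1 + \<delta>) * L) + L * (1 - e) / 2) \<le> prob T"
    unfolding exp_add by (simp add: mult_ac)
  moreover have "prob A / 2 * exp (- (L * (1 / 2 + 2 * \<delta>))) \<le> prob A / 2 * exp (- ((1 + \<delta>) * L) + L * (1 - e) / 2)"
    using tilted_exponents(3)[of \<delta> e L] \<delta> large \<epsilon> by (intro mult_left_mono) (auto simp: e_def L_def mult.commute)
  ultimately show ?thesis unfolding T_def L_def by linarith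
qed

section \<open>From blocks to the pathwise lower bound\<close>

lemma \<psi>_pos: "eventually (\<lambda>n. \<psi> n > 0) sequentially"
proof -
  have "eventually (\<lambda>n. ln (real n) > 0) sequentially" by real_asymp
  moreover have "eventually (\<lambda>n. ln (ln (ln (real n))) > 0) sequentially" by real_asymp
  ultimately show ?thesis by eventually_elim (use \<phi>_pos in \<open>simp add: \<psi>_def\<close>)
qed

text \<open>Along very sparse times the increment over one block carries nearly the whole clock,
  while everything before it has only the fraction 2/R. Instead of independence of the blocks, a
  bound uniform over all events at time \<open>l j\<close> is fed into
  \<open>sequential_borel_cantelli\<close>.\<close>

lemma lil_lower:
  assumes "\<eta> > 0"
  shows "AE x in M. \<exists>\<^sub>F n in sequentially. W n x \<ge> (1 - \<eta>) * \<psi> n"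
proof -
  define h where "h = min 1 \<eta>"
  \<comment> \<open>The relative losses 6 \<delta> + 3/R must stay below h/2, which asks for
    \<delta> <= h/24; the second entry secures \<open>\<phi> * \<delta>\<^sup>2 \<le> 24\<close> for
    \<open>block_lower_bound\<close>.\<close>
  define \<delta> where "\<delta> = min (h / 24) (1 / (1 + \<phi>))"
  have h: "0 < h" "h \<le> 1" "h \<le> \<eta>" using assms by (auto simp: h_def)
  have \<delta>: "0 < \<delta>" "\<delta> \<le> 1 / 24" "24 * \<delta> \<le> h" using h \<phi>_pos by (auto simp: \<delta>_def)
  have \<phi>\<delta>: "\<phi> * \<delta>\<^sup>2 \<le> 24"
  proof -
    have "\<delta> * (1 + \<phi>) \<le> 1" using \<phi>_pos by (simp add: \<delta>_def min_def field_simps)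
    then have "\<phi> * \<delta> \<le> 1" using \<delta> by (simp add: algebra_simps)
    then have "\<phi> * \<delta> * \<delta> \<le> 1 * 1" using \<delta> by (intro mult_mono) auto
    then show ?thesis by (simp add: power2_eq_square mult.assoc)
  qed
  \<comment> \<open>With this R, sqrt(2/R) <= h/8 makes \<open>\<psi> (m j)\<close> small against
    \<open>\<psi> (n j)\<close>, and 3/R <= h/4 bounds the clock missing from a block.\<close>
  define R where "R = nat \<lceil>128 / h\<^sup>2\<rceil>"
  have R_ge: "real R \<ge> 128 / h\<^sup>2" unfolding R_def by linarith
  have h2: "0 < h\<^sup>2" "h\<^sup>2 \<le> h" using h by (auto simp: power2_eq_square mult_left_le)
  have R: "real R \<ge> 128"
  proof -
    have "128 \<le> 128 / h\<^sup>2" using h2 h by (simp add: pos_le_divide_eq)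
    then show ?thesis using R_ge by simp
  qed
  have "2 / R \<le> (h / 8)\<^sup>2"
    using R_ge R h2 by (simp add: power_divide field_simps)
  then have R1: "sqrt (2 / R) \<le> h / 8" using h by (intro real_le_lsqrt) auto
  have R2: "3 / R \<le> h / 4"
  proof -
    have "128 \<le> R * h\<^sup>2" using R_ge h2 by (simp add: pos_divide_le_eq)
    also have "\<dots> \<le> R * h" using h2 by (intro mult_left_mono) auto
    finally show ?thesis using R by (simp add: field_simps)
  qed
  \<comment> \<open>The past of block j ends at \<open>l j\<close>, the increment starts only at its
    square \<open>m j\<close>, as the lag demands, and ends at \<open>n j\<close>, where the past of
    block j+1 ends. The ratio ln m / ln n is 2/R.\<close>
  define l where "l j = (2::nat) ^ (R ^ j)" for j
  define m where "m j = (l j)\<^sup>2" for j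
  define n where "n j = l (Suc j)" for j
  define L where "L j = ln (real (n j))" for j
  \<comment> \<open>The optimal tilt reduced by 1 - 4\<delta> in its square: the cost exponent r^2 s
    (1/2 + 2\<delta>) is then at most (1 - 4\<delta>)(1 + 4\<delta>) ln j <= ln j, so the
    conditional probabilities are at least 1/(2j) and their sum diverges.\<close>
  define r where "r j = sqrt (2 * (1 - 4 * \<delta>) * ln (real j) / (\<phi> * L j))" for j
  define s where "s j = \<phi> * (V (n j) - V (m j))" for j
  have L_eq: "L j = real R ^ Suc j * ln 2" for j
    by (simp add: L_def n_def l_def ln_realpow)
  have lnm: "ln (real (m j)) = 2 / R * L j" for j
    using R by (simp add: L_eq m_def l_def ln_realpow)
  have L0: "L j > 0" for j using R by (simp add: L_eq)
  have lm: "m j \<le> n j" for j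
  proof -
    have "R ^ j * 2 \<le> R ^ Suc j" using R by simp
    then have "(2::nat) ^ (R ^ j * 2) \<le> 2 ^ (R ^ Suc j)" by (intro power_increasing) auto
    then show ?thesis by (simp add: m_def n_def l_def power_mult)
  qed
  have l_top: "filterlim l at_top sequentially"
  proof (rule filterlim_at_top_mono[OF filterlim_ident])
    have "j < R ^ j" "R ^ j < l j" for j
      using R by (auto simp: l_def intro!: power_gt_expt)
    then show "eventually (\<lambda>j. j \<le> l j) sequentially"
      by (intro always_eventually allI) (meson less_imp_le order_trans)
  qed
  have n_top: "filterlim n at_top sequentially"
    unfolding n_def using l_top by (rule filterlim_compose[OF _ filterlim_Suc])
  have m_top: "filterlim m at_top sequentially"
  proof (rule filterlim_at_top_mono[OF l_top])
    show "eventually (\<lambda>j. l j \<le> m j) sequentially"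
      by (intro always_eventually allI) (simp add: m_def power2_eq_square l_def)
  qed
  have Vn: "(\<lambda>j. V (n j) / L j) \<longlonglongrightarrow> 1"
    unfolding L_def using filterlim_compose[OF V_sim_ln n_top] .
  have "(\<lambda>j. V (m j) / ln (real (m j))) \<longlonglongrightarrow> 1"
    using filterlim_compose[OF V_sim_ln m_top] .
  then have "(\<lambda>j. 2 / R * (V (m j) / ln (real (m j)))) \<longlonglongrightarrow> 2 / R * 1"
    by (intro tendsto_intros)
  moreover have "2 / R * (V (m j) / ln (real (m j))) = V (m j) / L j" for j
    unfolding lnm using R L0[of j] by simp
  ultimately have "(\<lambda>j. V (n j) / L j - V (m j) / L j) \<longlonglongrightarrow> 1 - 2 / R"
    by (intro tendsto_diff Vn) simp
  then have Vd: "(\<lambda>j. (V (n j) - V (m j)) / L j) \<longlonglongrightarrow> 1 - 2 / R"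
    by (simp add: diff_divide_distrib)
  have "eventually (\<lambda>j. (V (n j) - V (m j)) / L j < 1) sequentially"
    using order_tendstoD(2)[OF Vd, of 1] R by simp
  then have evV1: "eventually (\<lambda>j. V (n j) - V (m j) \<le> L j) sequentially"
    by eventually_elim (use L0 in \<open>simp add: field_simps less_imp_le\<close>)
  have "eventually (\<lambda>j. (V (n j) - V (m j)) / L j > 1 - 3 / R) sequentially"
    using order_tendstoD(1)[OF Vd, of "1 - 3 / R"] R by (simp add: divide_strict_right_mono)
  then have evV2: "eventually (\<lambda>j. (1 - 3 / R) * L j \<le> V (n j) - V (m j)) sequentially"
    by eventually_elim (use L0 in \<open>simp add: pos_less_divide_eq less_imp_le\<close>)
  obtain K where K: "K > 0" "\<And>k. b k \<le> K" using b_bound by metis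
  have r2: "(r j)\<^sup>2 * (\<phi> * L j) = 2 * (1 - 4 * \<delta>) * ln (real j)" if "j > 0" for j
    using that \<delta> \<phi>_pos L0[of j] by (simp add: r_def)
  have R1': "real R > 1" using R by simp
  have r0: "r \<longlonglongrightarrow> 0"
  proof -
    have c: "2 * (1 - 4 * \<delta>) > 0" using \<delta> by simp
    define c where "c = 2 * (1 - 4 * \<delta>)"
    have c0: "c > 0" using \<delta> by (simp add: c_def)
    show ?thesis unfolding r_def L_eq c_def[symmetric] using c0 \<phi>_pos R1' by real_asymp
  qed
  have evr: "eventually (\<lambda>j. r j < \<delta>\<^sup>2 / 24 / (8 * K)) sequentially"
    using order_tendstoD(2)[OF r0, of "\<delta>\<^sup>2 / 24 / (8 * K)"] \<delta> K by simp
  \<comment> \<open>The crude moment over block j is at most j^q, because 64 r^2 (V n - V m) <= 128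
    ln j / \<phi>. Against this stands m^(-\<kappa>), which is exponentially small in R^j.\<close>
  define q where "q = 128 / \<phi>"
  have q0: "q > 0" using \<phi>_pos by (simp add: q_def)
  have lim_s: "(\<lambda>j. exp (- (\<kappa> * (2 * real R ^ j * ln 2))) * (real j powr q + C)) \<longlonglongrightarrow> 0"
    using \<kappa>_pos R1' q0 by real_asymp
  have evs: "eventually (\<lambda>j. exp (- (\<kappa> * (2 * real R ^ j * ln 2))) * (real j powr q + C) < \<delta>\<^sup>2 / 12 * \<phi>) sequentially"
    by (rule order_tendstoD(2)[OF lim_s]) (use \<delta> \<phi>_pos in simp)
  have c3: "1 - 3 / R > 0" using R2 h by simp
  have "filterlim (\<lambda>j. 2 * (1 - 4 * \<delta>) * (1 - 3 / R) * \<delta>\<^sup>2 * ln (real j)) at_top sequentially"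
    using \<delta> c3 by (intro filterlim_tendsto_pos_mult_at_top[OF tendsto_const] filterlim_compose[OF ln_at_top filterlim_real_sequentially]) auto
  then have evL: "eventually (\<lambda>j. 8 \<le> 2 * (1 - 4 * \<delta>) * (1 - 3 / R) * \<delta>\<^sup>2 * ln (real j)) sequentially"
    by (simp add: filterlim_at_top)
  define E where "E j = {x \<in> space M. W (n j) x - W (m j) x \<ge> (1 - \<delta>) * r j * s j}" for j
  have "AE x in M. \<exists>\<^sub>F j in sequentially. x \<in> E j"
  proof (rule sequential_borel_cantelli[where G = "\<lambda>j. F (l j)" and c = "\<lambda>j. real j powr (-1) / 2"])
    show "subalgebra M (F (l j))" for j by (rule subalg)
    have lS: "l j \<le> l (Suc j)" for j
      using lm[of j] by (simp add: m_def n_def power2_nat_le_imp_le)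
    show "sets (F (l j)) \<subseteq> sets (F (l (Suc j)))" for j by (intro F_mono lS)
    show "E j \<in> sets (F (l (Suc j)))" for j
    proof -
      have "{x \<in> space (F (l (Suc j))). (1 - \<delta>) * r j * s j \<le> W (n j) x - W (m j) x} \<in> sets (F (l (Suc j)))"
        using lm[of j] by (intro borel_measurable_le borel_measurable_const borel_measurable_diff W_adapted) (auto simp: n_def)
      then show ?thesis by (simp add: E_def)
    qed
    show "\<not> summable (\<lambda>j. real j powr (-1) / 2)"
    proof
      assume "summable (\<lambda>j. real j powr (-1) / 2)"
      from summable_mult[OF this, of 2] have "summable (\<lambda>j. real j powr (-1))" by simp
      then show False by (simp only: summable_real_powr_iff)
    qed
    show "0 \<le> real j powr (-1) / 2" for j by simp
    show "eventually (\<lambda>j. \<forall>B\<in>sets (F (l j)). real j powr (-1) / 2 * prob B \<le> prob (E j \<inter> B)) sequentially"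
      using evV1 evV2 evr evs evL eventually_gt_at_top[of 1]
    proof eventually_elim
      case (elim j)
      have lj: "ln (real j) > 0" using elim by simp
      have rj: "r j > 0" using elim \<delta> \<phi>_pos L0[of j] by (simp add: r_def)
      have rs_up: "(r j)\<^sup>2 * s j \<le> 2 * (1 - 4 * \<delta>) * ln (real j)"
        unfolding s_def r2[of j, symmetric, OF less_trans[OF zero_less_one elim(6)]] using elim(1) \<phi>_pos
        by (intro mult_left_mono) auto
      have rs_lo: "2 * (1 - 4 * \<delta>) * ln (real j) * (1 - 3 / R) \<le> (r j)\<^sup>2 * s j"
      proof -
        have "(r j)\<^sup>2 * (\<phi> * L j) * (1 - 3 / R) \<le> (r j)\<^sup>2 * s j"
          unfolding s_def mult.assoc using elim(2) \<phi>_pos by (intro mult_left_mono) (auto simp: mult.commute)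
        then show ?thesis using r2[of j] elim by simp
      qed
      show ?case
      proof
        fix B assume B: "B \<in> sets (F (l j))"
        have "prob B / 2 * exp (- ((r j)\<^sup>2 * s j * (1 / 2 + 2 * \<delta>))) \<le> prob (E j \<inter> B)"
          unfolding E_def s_def
        proof (rule block_lower_bound[OF B])
          show "(l j)\<^sup>2 \<le> m j" by (simp add: m_def)
          show "m j \<le> n j" by (rule lm)
          show "8 * r j * b k \<le> \<delta>\<^sup>2 / 24" for k
          proof -
            have "r j * b k \<le> \<delta>\<^sup>2 / 24 / (8 * K) * K"
              using elim(3) rj K b_pos[of k] by (intro mult_mono) (auto intro: less_imp_le)
            then show ?thesis using K by simp
          qed
          show "real (Suc (m j)) powr (-\<kappa>) * (exp (64 * (r j)\<^sup>2 * (V (n j) - V (m j))) + C) \<le> \<delta>\<^sup>2 / 12 * \<phi>"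
          proof -
            have "real (Suc (m j)) powr (-\<kappa>) \<le> real (m j) powr (-\<kappa>)"
              using \<kappa>_pos by (intro powr_mono2') (auto simp: m_def l_def)
            also have "\<dots> = exp (- (\<kappa> * (2 * real R ^ j * ln 2)))"
              using R by (simp add: powr_def lnm L_eq) (simp add: m_def l_def)
            finally have 1: "real (Suc (m j)) powr (-\<kappa>) \<le> exp (- (\<kappa> * (2 * real R ^ j * ln 2)))" .
            have "(r j)\<^sup>2 * (V (n j) - V (m j)) = (r j)\<^sup>2 * s j / \<phi>" using \<phi>_pos by (simp add: s_def)
            also have "\<dots> \<le> 2 * 1 * ln (real j) / \<phi>"
            proof (rule divide_right_mono)
              have "2 * (1 - 4 * \<delta>) * ln (real j) \<le> 2 * 1 * ln (real j)" using lj \<delta> by (intro mult_right_mono) auto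
              then show "(r j)\<^sup>2 * s j \<le> 2 * 1 * ln (real j)" using rs_up by linarith
            qed (use \<phi>_pos in simp)
            finally have "64 * (r j)\<^sup>2 * (V (n j) - V (m j)) \<le> q * ln (real j)" by (simp add: q_def)
            then have 2: "exp (64 * (r j)\<^sup>2 * (V (n j) - V (m j))) \<le> real j powr q"
              using elim by (simp add: powr_def)
            have "real (Suc (m j)) powr (-\<kappa>) * (exp (64 * (r j)\<^sup>2 * (V (n j) - V (m j))) + C)
               \<le> exp (- (\<kappa> * (2 * real R ^ j * ln 2))) * (real j powr q + C)"
              using 1 2 C_nonneg by (intro mult_mono add_mono) auto
            then show ?thesis using elim(4) by linarith
          qed
          have "8 \<le> 2 * (1 - 4 * \<delta>) * ln (real j) * (1 - 3 / R) * \<delta>\<^sup>2" using elim(5) by (simp add: mult_ac)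
          also have "\<dots> \<le> (r j)\<^sup>2 * s j * \<delta>\<^sup>2" using rs_lo by (intro mult_right_mono) auto
          finally show "8 \<le> (r j)\<^sup>2 * (\<phi> * (V (n j) - V (m j))) * \<delta>\<^sup>2" by (simp add: s_def)
        qed (use \<delta> \<phi>\<delta> rj in auto)
        moreover have "real j powr (-1) / 2 * prob B \<le> prob B / 2 * exp (- ((r j)\<^sup>2 * s j * (1 / 2 + 2 * \<delta>)))"
        proof -
          have "(r j)\<^sup>2 * s j * (1 / 2 + 2 * \<delta>) \<le> 2 * (1 - 4 * \<delta>) * ln (real j) * (1 / 2 + 2 * \<delta>)"
            using rs_up \<delta> by (intro mult_right_mono) auto
          also have "\<dots> = (1 - 16 * \<delta>\<^sup>2) * ln (real j)" by (simp add: power2_eq_square field_simps)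
          also have "\<dots> \<le> 1 * ln (real j)" using lj by (intro mult_right_mono) auto
          finally have "exp (- ln (real j)) \<le> exp (- ((r j)\<^sup>2 * s j * (1 / 2 + 2 * \<delta>)))" by simp
          moreover have "real j powr (-1) = exp (- ln (real j))" using elim by (simp add: powr_def)
          ultimately show ?thesis by (simp add: mult.commute mult_left_mono)
        qed
        ultimately show "real j powr (-1) / 2 * prob B \<le> prob (E j \<inter> B)" by linarith
      qed
    qed
  qed
  \<comment> \<open>A large increment makes W large at \<open>n j\<close> only if W is not very
    negative at \<open>m j\<close>; the upper half for the reflected martingale excludes
    this.\<close>
  moreover have "AE x in M. eventually (\<lambda>n. - W n x \<le> 2 * \<psi> n) sequentially"
  proof -
    interpret U: critical_martingale M F "\<lambda>n x. - \<xi> n x" v b \<phi> \<kappa> C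
      by (rule uminus_critical_martingale)
    have "U.W n x = - W n x" for n x by (simp add: U.W_def W_def sum_negf)
    then show ?thesis using U.lil_upper[of 1] by simp
  qed
  ultimately show ?thesis
  proof eventually_elim
    case (elim x)
    have ev_low: "eventually (\<lambda>j. - W (m j) x \<le> 2 * \<psi> (m j)) sequentially"
      using elim(2) m_top by (rule eventually_compose_filterlim)
    have "(\<lambda>j. ln (real j) / ln (ln (real R ^ Suc j * ln 2))) \<longlonglongrightarrow> 1"
      using R1' by real_asymp
    moreover have "(1 - \<delta>)\<^sup>2 < 1" using \<delta> by (simp add: abs_square_less_1)
    ultimately have "eventually (\<lambda>j. (1 - \<delta>)\<^sup>2 < ln (real j) / ln (ln (L j))) sequentially"
      unfolding L_eq using order_tendstoD(1) by blast
    moreover have ev_ll: "eventually (\<lambda>j. ln (ln (L j)) > 0) sequentially"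
      unfolding L_eq using R1' by real_asymp
    ultimately have ev_ln: "eventually (\<lambda>j. (1 - \<delta>)\<^sup>2 * ln (ln (L j)) \<le> ln (real j)) sequentially"
      by eventually_elim (simp add: pos_less_divide_eq less_imp_le)
    have ev_lm: "eventually (\<lambda>j. ln (ln (2 / R * L j)) > 0) sequentially"
      unfolding L_eq using R1' by real_asymp
    have ev_lm': "eventually (\<lambda>j. ln (2 / R * L j) > 0) sequentially"
      unfolding L_eq using R1' by real_asymp
    have good: "eventually (\<lambda>j. x \<in> E j \<longrightarrow> (1 - \<eta>) * \<psi> (n j) \<le> W (n j) x) sequentially"
      using ev_low ev_ll ev_ln ev_lm ev_lm' evV2 eventually_gt_at_top[of 1]
    proof eventually_elim
      case (elim j)
      have \<psi>n: "\<psi> (n j) = sqrt (2 * \<phi> * L j * ln (ln (L j)))" by (simp add: \<psi>_def L_def)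
      have \<psi>n0: "\<psi> (n j) \<ge> 0" unfolding \<psi>n using elim(2) \<phi>_pos L0[of j] by simp
      have lj: "ln (real j) > 0" using elim by simp
      have m\<psi>: "\<psi> (m j) \<le> h / 8 * \<psi> (n j)"
      proof -
        have "2 / R * L j \<le> 1 * L j" using L0[of j] R by (intro mult_right_mono) auto
        then have "ln (2 / R * L j) \<le> ln (L j)" using L0[of j] R by (intro ln_mono) auto
        then have le: "ln (ln (2 / R * L j)) \<le> ln (ln (L j))" by (rule ln_mono[OF _ elim(5)])
        have "\<psi> (m j) = sqrt (2 * \<phi> * (2 / R * L j) * ln (ln (2 / R * L j)))" by (simp only: \<psi>_def lnm)
        also have "\<dots> \<le> sqrt (2 * \<phi> * (2 / R * L j) * ln (ln (L j)))"
          using le \<phi>_pos L0[of j] by (intro real_sqrt_le_mono mult_left_mono) auto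
        also have "\<dots> = sqrt (2 / R * (2 * \<phi> * L j * ln (ln (L j))))" by (simp add: mult_ac)
        also have "\<dots> = sqrt (2 / R) * \<psi> (n j)" unfolding \<psi>n by (rule real_sqrt_mult)
        also have "\<dots> \<le> h / 8 * \<psi> (n j)" using R1 \<psi>n0 by (rule mult_right_mono)
        finally show ?thesis .
      qed
      \<comment> \<open>The right side is the root of 2 (1 - 4\<delta>) \<phi> L ln j. The root of 1
        - 4\<delta> is at least 1 - 4\<delta>, and the factor 1 - \<delta> pays for replacing ln j
        by ln ln L.\<close>
      have rL: "(1 - 4 * \<delta>) * ((1 - \<delta>) * \<psi> (n j)) \<le> r j * (\<phi> * L j)"
      proof (rule power2_le_imp_le)
        have "((1 - 4 * \<delta>) * ((1 - \<delta>) * \<psi> (n j)))\<^sup>2 = (1 - 4 * \<delta>)\<^sup>2 * ((2 * \<phi> * L j) * ((1 - \<delta>)\<^sup>2 * ln (ln (L j))))"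
          unfolding power_mult_distrib \<psi>n using elim(2) \<phi>_pos L0[of j] by (simp add: mult_ac)
        also have "\<dots> \<le> (1 - 4 * \<delta>) * ((2 * \<phi> * L j) * ln (real j))"
          using elim(2,3) \<delta> \<phi>_pos L0[of j] by (intro mult_mono) (auto simp: power2_eq_square mult_left_le)
        also have "\<dots> = (r j)\<^sup>2 * (\<phi> * L j) * (\<phi> * L j)" using r2[of j] elim by (simp add: mult_ac)
        also have "\<dots> = (r j * (\<phi> * L j))\<^sup>2" by (simp add: power2_eq_square mult_ac)
        finally show "((1 - 4 * \<delta>) * ((1 - \<delta>) * \<psi> (n j)))\<^sup>2 \<le> (r j * (\<phi> * L j))\<^sup>2" .
        show "0 \<le> r j * (\<phi> * L j)" using \<phi>_pos L0[of j] lj \<delta> by (simp add: r_def)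
      qed
      \<comment> \<open>The losses add up: \<delta> from the threshold, 3/R from the missing clock,
        4\<delta> from the reduced tilt and \<delta> from the iterated logarithm.\<close>
      have coef: "1 - h / 2 \<le> (1 - \<delta>) * ((1 - 3 / R) * ((1 - 4 * \<delta>) * (1 - \<delta>)))"
      proof -
        have *: "1 - (a + c) \<le> (1 - a) * (1 - c)" if "a \<ge> 0" "c \<ge> 0" for a c :: real
          using mult_nonneg_nonneg[OF that] by (simp add: algebra_simps)
        have "1 - (4 * \<delta> + \<delta>) \<le> (1 - 4 * \<delta>) * (1 - \<delta>)" using \<delta> by (intro *) auto
        then have "(1 - 3 / R) * (1 - (4 * \<delta> + \<delta>)) \<le> (1 - 3 / R) * ((1 - 4 * \<delta>) * (1 - \<delta>))"
          using c3 by (intro mult_left_mono) auto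
        moreover have "1 - (3 / R + (4 * \<delta> + \<delta>)) \<le> (1 - 3 / R) * (1 - (4 * \<delta> + \<delta>))"
          using \<delta> R by (intro *) auto
        ultimately have "1 - (3 / R + (4 * \<delta> + \<delta>)) \<le> (1 - 3 / R) * ((1 - 4 * \<delta>) * (1 - \<delta>))" by linarith
        then have "(1 - \<delta>) * (1 - (3 / R + (4 * \<delta> + \<delta>))) \<le> (1 - \<delta>) * ((1 - 3 / R) * ((1 - 4 * \<delta>) * (1 - \<delta>)))"
          using \<delta> by (intro mult_left_mono) auto
        moreover have "1 - (\<delta> + (3 / R + (4 * \<delta> + \<delta>))) \<le> (1 - \<delta>) * (1 - (3 / R + (4 * \<delta> + \<delta>)))"
          using \<delta> R by (intro *) auto
        ultimately show ?thesis using R2 \<delta> by linarith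
      qed
      show ?case
      proof
        assume "x \<in> E j"
        then have inc: "W (n j) x - W (m j) x \<ge> (1 - \<delta>) * r j * s j" by (simp add: E_def)
        have rj: "r j \<ge> 0" using \<phi>_pos L0[of j] lj \<delta> by (simp add: r_def)
        have "(1 - h / 2) * \<psi> (n j) \<le> (1 - \<delta>) * ((1 - 3 / R) * ((1 - 4 * \<delta>) * (1 - \<delta>))) * \<psi> (n j)"
          using coef \<psi>n0 by (rule mult_right_mono)
        also have "\<dots> = (1 - \<delta>) * ((1 - 3 / R) * ((1 - 4 * \<delta>) * ((1 - \<delta>) * \<psi> (n j))))" by (simp add: mult_ac)
        also have "\<dots> \<le> (1 - \<delta>) * ((1 - 3 / R) * (r j * (\<phi> * L j)))"
          using rL c3 \<delta> by (intro mult_left_mono) auto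
        also have "\<dots> = (1 - \<delta>) * r j * (\<phi> * ((1 - 3 / R) * L j))" by (simp add: mult_ac)
        also have "\<dots> \<le> (1 - \<delta>) * r j * s j"
          unfolding s_def using elim(6) rj \<phi>_pos \<delta> by (intro mult_left_mono) auto
        also have "\<dots> \<le> W (n j) x - W (m j) x" by (rule inc)
        finally have "(1 - h / 2) * \<psi> (n j) - 2 * \<psi> (m j) \<le> W (n j) x" using elim(1) by linarith
        then have "(1 - h / 2) * \<psi> (n j) - 2 * (h / 8 * \<psi> (n j)) \<le> W (n j) x" using m\<psi> by linarith
        moreover have "(1 - \<eta>) * \<psi> (n j) \<le> (1 - h / 2) * \<psi> (n j) - 2 * (h / 8 * \<psi> (n j))"
        proof -
          have "(1 - \<eta>) * \<psi> (n j) \<le> (1 - 3 * h / 4) * \<psi> (n j)" using h \<psi>n0 by (intro mult_right_mono) auto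
          then show ?thesis by (simp add: algebra_simps)
        qed
        ultimately show "(1 - \<eta>) * \<psi> (n j) \<le> W (n j) x" by linarith
      qed
    qed
    have "\<exists>\<^sub>F j in sequentially. (1 - \<eta>) * \<psi> (n j) \<le> W (n j) x"
      using eventually_frequently_simps(1) frequently_rev_mp[OF elim(1) good] by blast
    then show ?case
      unfolding frequently_def using n_top eventually_compose_filterlim by blast
  qed
qed

text \<open>The two halves hold simultaneously for the countably many tolerances 1/(k+1), and an
  equivalent normalization changes the quotients by a factor tending to 1.\<close>

theorem iterated_logarithm:
  assumes a: "(\<lambda>n. a n / \<psi> n) \<longlonglongrightarrow> 1"
  shows "AE x in M. limsup (\<lambda>n. ereal (W n x / a n)) = 1"
proof -
  have "AE x in M. \<forall>k. eventually (\<lambda>n. W n x \<le> (1 + 1 / real (Suc k)) * \<psi> n) sequentially"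
    by (subst AE_all_countable) (intro allI lil_upper, simp)
  moreover have "AE x in M. \<forall>k. \<exists>\<^sub>F n in sequentially. W n x \<ge> (1 - 1 / real (Suc k)) * \<psi> n"
    by (subst AE_all_countable) (intro allI lil_lower, simp)
  ultimately show ?thesis
  proof eventually_elim
    case (elim x)
    have "(\<lambda>n. inverse (a n / \<psi> n)) \<longlonglongrightarrow> inverse 1" by (intro tendsto_inverse a) simp
    then have lim: "(\<lambda>n. \<psi> n / a n) \<longlonglongrightarrow> 1" by simp
    have "eventually (\<lambda>n. a n / \<psi> n > 0) sequentially" using order_tendstoD(1)[OF a] by simp
    with \<psi>_pos have a_pos: "eventually (\<lambda>n. a n > 0) sequentially"
      by eventually_elim (simp add: zero_less_divide_iff)
    show ?case
    proof (rule antisym)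
      show "limsup (\<lambda>n. ereal (W n x / a n)) \<le> 1"
      proof (rule ereal_le_epsilon2)
        fix e :: real assume e: "e > 0"
        obtain k where k: "1 / real (Suc k) < e" using reals_Archimedean[OF e] by (auto simp: inverse_eq_divide)
        have "(\<lambda>n. (1 + 1 / real (Suc k)) * (\<psi> n / a n)) \<longlonglongrightarrow> (1 + 1 / real (Suc k)) * 1"
          by (intro tendsto_intros lim)
        then have "eventually (\<lambda>n. (1 + 1 / real (Suc k)) * (\<psi> n / a n) < 1 + e) sequentially"
          using order_tendstoD(2)[of _ "(1 + 1 / real (Suc k)) * 1" _ "1 + e"] k by simp
        with a_pos spec[OF elim(1), of k]
        have "eventually (\<lambda>n. ereal (W n x / a n) \<le> 1 + ereal e) sequentially"
        proof eventually_elim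
          case (elim n)
          have "W n x / a n \<le> (1 + 1 / real (Suc k)) * \<psi> n / a n" using elim by (intro divide_right_mono) auto
          then have "W n x / a n \<le> 1 + e" using elim(3) by (simp only: times_divide_eq_right)
          then show ?case by (simp add: one_ereal_def)
        qed
        then show "limsup (\<lambda>n. ereal (W n x / a n)) \<le> 1 + ereal e" by (rule Limsup_bounded)
      qed
      show "1 \<le> limsup (\<lambda>n. ereal (W n x / a n))"
      proof (rule ccontr)
        assume "\<not> 1 \<le> limsup (\<lambda>n. ereal (W n x / a n))"
        then obtain z :: real where z: "limsup (\<lambda>n. ereal (W n x / a n)) < ereal z" "z < 1"
          using ereal_dense2[of _ 1] by (auto simp: one_ereal_def not_le)
        obtain k where k: "1 / real (Suc k) < 1 - z" using reals_Archimedean[of "1 - z"] z by (auto simp: inverse_eq_divide)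
        have "(\<lambda>n. (1 - 1 / real (Suc k)) * (\<psi> n / a n)) \<longlonglongrightarrow> (1 - 1 / real (Suc k)) * 1"
          by (intro tendsto_intros lim)
        then have "eventually (\<lambda>n. (1 - 1 / real (Suc k)) * (\<psi> n / a n) > z) sequentially"
          using order_tendstoD(1)[of _ "(1 - 1 / real (Suc k)) * 1" _ z] k by simp
        with a_pos Limsup_lessD[OF z(1)]
        have "eventually (\<lambda>n. \<not> (1 - 1 / real (Suc k)) * \<psi> n \<le> W n x) sequentially"
        proof eventually_elim
          case (elim n)
          show ?case
          proof
            assume "(1 - 1 / real (Suc k)) * \<psi> n \<le> W n x"
            then have "(1 - 1 / real (Suc k)) * \<psi> n / a n \<le> W n x / a n" using elim by (intro divide_right_mono) auto
            then have "z < W n x / a n" using elim(3) by (simp only: times_divide_eq_right)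
            then show False using elim(2) by simp
          qed
        qed
        then show False using spec[OF elim(2), of k] by (simp add: frequently_def)
      qed
    qed
  qed
qed

end

section \<open>The lazy elephant random walk\<close>

lemma space_nat_filtr [simp]: "space (nat_filtr M X n) = space M"
  by (simp add: nat_filtr_def space_measure_of_conv)

lemma sets_nat_filtr:
  "sets (nat_filtr M X n) = sigma_sets (space M) {X i -` A \<inter> space M | i A. i \<in> {1..n} \<and> A \<in> sets borel}"
  unfolding nat_filtr_def by (rule sets_measure_of) auto

lemma nat_filtr_mono: "m \<le> n \<Longrightarrow> sets (nat_filtr M X m) \<subseteq> sets (nat_filtr M X n)"
  unfolding sets_nat_filtr by (rule sigma_sets_mono') force

lemma measurable_nat_filtr:
  assumes "1 \<le> i" "i \<le> n"
  shows "X i \<in> borel_measurable (nat_filtr M X n)"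
proof (rule measurableI)
  fix A :: "real set" assume "A \<in> sets borel"
  then show "X i -` A \<inter> space (nat_filtr M X n) \<in> sets (nat_filtr M X n)"
    using assms unfolding sets_nat_filtr by (auto intro!: sigma_sets.Basic)
qed simp

lemma subalgebra_nat_filtr:
  assumes "\<And>i. 1 \<le> i \<Longrightarrow> X i \<in> borel_measurable M"
  shows "subalgebra M (nat_filtr M X n)"
  unfolding subalgebra_def sets_nat_filtr
  by (intro conjI sets.sigma_sets_subset) (auto intro: measurable_sets[OF assms])

text \<open>The index set 1..0 is empty, so the algebra at time 0 is trivial. This lets the
  unconditional law of the first step act as a conditional law at n = 0.\<close>

lemma nat_filtr_0_const:
  assumes h: "h \<in> borel_measurable (nat_filtr M X 0)"
  obtains c :: real where "\<And>x. x \<in> space M \<Longrightarrow> h x = c"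
proof (cases "space M = {}")
  case False
  then obtain x0 where x0: "x0 \<in> space M" by blast
  have "h -` {h x0} \<inter> space M \<in> sets (nat_filtr M X 0)"
    using measurable_sets[OF h, of "{h x0}"] by simp
  then have "h -` {h x0} \<inter> space M = space M"
    unfolding sets_nat_filtr using x0 by (auto simp: sigma_sets_empty_eq)
  then show ?thesis using that[of "h x0"] by blast
qed (use that in auto)

section \<open>Parameters and one-step conditional moments\<close>

locale lazy_elephant_walk = prob_space M
  for M :: "'a measure" +
  fixes X :: "nat \<Rightarrow> 'a \<Rightarrow> real" and p q r \<theta> :: real
  assumes pqr: "p \<ge> 0" "q \<ge> 0" "r \<ge> 0" "p + q + r = 1"
    and th: "0 \<le> \<theta>" "\<theta> < 1"
    and meas: "\<And>n. n \<ge> 1 \<Longrightarrow> X n \<in> borel_measurable M"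
    and vals: "\<And>n x. n \<ge> 1 \<Longrightarrow> x \<in> space M \<Longrightarrow> X n x \<in> {-1, 0, 1}"
    and init: "prob {x \<in> space M. X 1 x = 1} = p" "prob {x \<in> space M. X 1 x = -1} = q"
    and step_plus: "\<And>n. n \<ge> 1 \<Longrightarrow> AE x in M.
        real_cond_exp M (nat_filtr M X n) (indicator {x \<in> space M. X (Suc n) x = 1}) x
        = \<theta> * (real (card {i \<in> {1..n}. X i x = 1}) / real n * p
                 + real (card {i \<in> {1..n}. X i x = -1}) / real n * q) + (1 - \<theta>) * p"
    and step_minus: "\<And>n. n \<ge> 1 \<Longrightarrow> AE x in M.
        real_cond_exp M (nat_filtr M X n) (indicator {x \<in> space M. X (Suc n) x = -1}) x
        = \<theta> * (real (card {i \<in> {1..n}. X i x = -1}) / real n * p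
                 + real (card {i \<in> {1..n}. X i x = 1}) / real n * q) + (1 - \<theta>) * q"
    and critical: "(p - q) * \<theta> = 1 / 2"
begin

definition "\<omega> = (p - q) * (1 - \<theta>)"
definition "\<tau> = (1 - \<theta>) * (p + q)"
definition "\<gamma> = (p + q) * \<theta>"
definition "\<phi> = \<tau> / (1 - \<gamma>) - (\<omega> / (1 - (p - q) * \<theta>))\<^sup>2"

definition S :: "nat \<Rightarrow> 'a \<Rightarrow> real" where "S n x = (\<Sum>i = 1..n. X i x)"
definition N :: "nat \<Rightarrow> 'a \<Rightarrow> real" where "N n x = (\<Sum>i = 1..n. (X i x)\<^sup>2)"

text \<open>The factor \<open>1/2\<close> in \<open>\<mu>\<close> is the critical value of \<open>\<alpha> = (p - q) \<theta>\<close>. The first step is treated separately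
  because with \<open>0 / 0 = 0\<close> the general formulas would give wrong values at \<open>n = 0\<close>.\<close>

definition \<mu> :: "nat \<Rightarrow> 'a \<Rightarrow> real" where
  "\<mu> n x = (if n = 0 then p - q else S n x / real n / 2 + \<omega>)"

definition \<nu> :: "nat \<Rightarrow> 'a \<Rightarrow> real" where
  "\<nu> n x = (if n = 0 then p + q else \<gamma> * (N n x / real n) + \<tau>)"

abbreviation F :: "nat \<Rightarrow> 'a measure" where "F \<equiv> nat_filtr M X"

lemma S_Suc: "S (Suc n) x = S n x + X (Suc n) x" and N_Suc: "N (Suc n) x = N n x + (X (Suc n) x)\<^sup>2"
  by (simp_all add: S_def N_def)

text \<open>Criticality forces \<theta> > 0 and p > q; comparing p + q with p - q gives \<gamma> >=
  1/2, and \<theta> < 1 gives \<gamma> < 1. These two are the hypotheses of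
  \<open>second_moment_growth\<close>.\<close>

lemma parameter_bounds: "1 / 2 \<le> \<gamma>" "\<gamma> < 1" "0 \<le> \<tau>" "0 < \<omega>" "\<omega> \<le> 1 / 2" "\<gamma> + \<tau> \<le> 1" "\<omega> + 1 / 2 = p - q" "\<gamma> + \<tau> = p + q"
proof -
  show sum: "\<gamma> + \<tau> = p + q" "\<omega> + 1 / 2 = p - q"
    using critical by (simp_all add: \<gamma>_def \<tau>_def \<omega>_def algebra_simps)
  show "\<gamma> + \<tau> \<le> 1" using sum pqr by simp
  show "\<omega> \<le> 1 / 2" using sum pqr by simp
  have "\<theta> \<noteq> 0" using critical by auto
  then have th0: "\<theta> > 0" using th by simp
  have "(p - q) * \<theta> > 0" using critical by simp
  then have pq: "p - q > 0" using th0 by (simp add: zero_less_mult_iff)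
  then show "0 < \<omega>" using th by (simp add: \<omega>_def)
  show "0 \<le> \<tau>" using th pqr by (simp add: \<tau>_def)
  have "(p - q) * \<theta> \<le> (p + q) * \<theta>" using pqr th by (intro mult_right_mono) auto
  then show "1 / 2 \<le> \<gamma>" using critical by (simp add: \<gamma>_def)
  have "(p + q) * \<theta> \<le> 1 * \<theta>" using pqr th by (intro mult_right_mono) auto
  then show "\<gamma> < 1" using th by (simp add: \<gamma>_def)
qed

lemma subalg: "subalgebra M (F n)"
  by (rule subalgebra_nat_filtr[OF meas])

lemma F_measurable_M: "f \<in> borel_measurable (F n) \<Longrightarrow> f \<in> borel_measurable M"
  by (rule measurable_from_subalg[OF subalg])

lemma S_adapted: "S n \<in> borel_measurable (F n)" and N_adapted: "N n \<in> borel_measurable (F n)"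
  unfolding S_def N_def by (intro borel_measurable_sum borel_measurable_power measurable_nat_filtr; simp)+

lemma \<mu>_adapted: "\<mu> n \<in> borel_measurable (F n)" and \<nu>_adapted: "\<nu> n \<in> borel_measurable (F n)"
  using S_adapted[of n] N_adapted[of n] unfolding \<mu>_def \<nu>_def by (cases n; simp)+

lemma X_bound: "x \<in> space M \<Longrightarrow> n \<ge> 1 \<Longrightarrow> \<bar>X n x\<bar> \<le> 1" "x \<in> space M \<Longrightarrow> n \<ge> 1 \<Longrightarrow> (X n x)\<^sup>2 \<le> 1"
  using vals[of n x] by auto

lemma S_bound: "x \<in> space M \<Longrightarrow> \<bar>S n x\<bar> \<le> real n"
proof (induction n)
  case (Suc n)
  then show ?case using X_bound(1)[of x "Suc n"] by (simp add: S_Suc)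
qed (simp add: S_def)

lemma N_bound: "x \<in> space M \<Longrightarrow> 0 \<le> N n x \<and> N n x \<le> real n"
proof (induction n)
  case (Suc n)
  then show ?case using X_bound(2)[of x "Suc n"] by (simp add: N_Suc)
qed (simp add: N_def)

lemma \<mu>_bound: "x \<in> space M \<Longrightarrow> \<bar>\<mu> n x\<bar> \<le> 1"
proof (cases "n = 0")
  case False
  assume x: "x \<in> space M"
  define y where "y = S n x / real n"
  have y: "\<bar>y\<bar> \<le> 1" using S_bound[OF x, of n] False by (simp add: y_def divide_le_eq)
  have "\<mu> n x = y / 2 + \<omega>" using False by (simp add: \<mu>_def y_def)
  then show ?thesis using parameter_bounds abs_le_D1[OF y] abs_le_D2[OF y] by (intro abs_leI) linarith+
qed (use pqr parameter_bounds in \<open>simp add: \<mu>_def\<close>)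

lemma \<nu>_bound: "x \<in> space M \<Longrightarrow> 0 \<le> \<nu> n x \<and> \<nu> n x \<le> 1"
proof (cases "n = 0")
  case False
  assume x: "x \<in> space M"
  have *: "0 \<le> N n x / real n" "N n x / real n \<le> 1" using N_bound[OF x, of n] False by (auto simp: divide_le_eq)
  then have "\<gamma> * (N n x / real n) \<le> \<gamma> * 1" using parameter_bounds by (intro mult_left_mono) auto
  moreover have "0 \<le> \<gamma> * (N n x / real n)" using parameter_bounds *(1) by (intro mult_nonneg_nonneg) auto
  moreover have "\<nu> n x = \<gamma> * (N n x / real n) + \<tau>" using False by (simp add: \<nu>_def)
  ultimately show ?thesis using parameter_bounds by linarith
qed (use pqr parameter_bounds in \<open>simp add: \<nu>_def\<close>)

text \<open>For values in {-1, 0, 1} the indicators of the two nonzero values are (X^2 + X)/2 and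
  (X^2 - X)/2.\<close>

lemma card_plus_minus:
  assumes x: "x \<in> space M"
  shows "real (card {i \<in> {1..n}. X i x = 1}) = (N n x + S n x) / 2"
    and "real (card {i \<in> {1..n}. X i x = -1}) = (N n x - S n x) / 2"
proof -
  have card: "real (card {i \<in> {1..n}. P i}) = (\<Sum>i = 1..n. if P i then 1 else 0)" for P
    by (simp add: sum.If_cases Int_def)
  have X: "X i x \<in> {-1, 0, 1}" if "i \<in> {1..n}" for i using vals[of i x] that x by simp
  have "(\<Sum>i = 1..n. if X i x = 1 then 1 else 0) = (\<Sum>i = 1..n. ((X i x)\<^sup>2 + X i x) / 2)"
    using X by (intro sum.cong) force+
  also have "\<dots> = (N n x + S n x) / 2" by (simp add: N_def S_def sum.distrib sum_divide_distrib[symmetric])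
  finally show "real (card {i \<in> {1..n}. X i x = 1}) = (N n x + S n x) / 2" unfolding card .
  have "(\<Sum>i = 1..n. if X i x = -1 then 1 else 0) = (\<Sum>i = 1..n. ((X i x)\<^sup>2 - X i x) / 2)"
    using X by (intro sum.cong) force+
  also have "\<dots> = (N n x - S n x) / 2" by (simp add: N_def S_def sum_subtractf sum_divide_distrib[symmetric])
  finally show "real (card {i \<in> {1..n}. X i x = -1}) = (N n x - S n x) / 2" unfolding card .
qed

text \<open>Translation of the transition law into test-function form: X and its square are the
  difference and the sum of the indicators of +1 and -1, whose conditional expectations are
  prescribed.\<close>

lemma step_moments:
  assumes h: "h \<in> borel_measurable (F n)" and hb: "\<And>x. x \<in> space M \<Longrightarrow> \<bar>h x\<bar> \<le> c"
  shows "(\<integral>x. h x * X (Suc n) x \<partial>M) = (\<integral>x. h x * \<mu> n x \<partial>M)"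
    and "(\<integral>x. h x * (X (Suc n) x)\<^sup>2 \<partial>M) = (\<integral>x. h x * \<nu> n x \<partial>M)"
proof -
  have [measurable]: "h \<in> borel_measurable M" by (rule F_measurable_M[OF h])
  have [measurable]: "X (Suc n) \<in> borel_measurable M" by (rule meas) simp
  define I where "I a = indicat_real {x \<in> space M. X (Suc n) x = a}" for a
  have [measurable]: "I a \<in> borel_measurable M" for a unfolding I_def by measurable
  have iI: "integrable M (\<lambda>x. h x * I a x)" for a
  proof (rule integrable_abs_bounded[where c = c])
    show "\<bar>h x * I a x\<bar> \<le> c" if "x \<in> space M" for x using hb[OF that] by (auto simp: I_def indicator_def)
  qed measurable
  have X1: "X (Suc n) x = I 1 x - I (-1) x" and X2: "(X (Suc n) x)\<^sup>2 = I 1 x + I (-1) x" if "x \<in> space M" for x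
    using vals[of "Suc n" x] that by (auto simp: I_def indicator_def)
  have E1: "(\<integral>x. h x * X (Suc n) x \<partial>M) = (\<integral>x. h x * I 1 x \<partial>M) - (\<integral>x. h x * I (-1) x \<partial>M)"
    by (subst Bochner_Integration.integral_diff[symmetric, OF iI iI])
       (auto intro!: Bochner_Integration.integral_cong simp: X1 algebra_simps)
  have E2: "(\<integral>x. h x * (X (Suc n) x)\<^sup>2 \<partial>M) = (\<integral>x. h x * I 1 x \<partial>M) + (\<integral>x. h x * I (-1) x \<partial>M)"
    by (subst Bochner_Integration.integral_add[symmetric, OF iI iI])
       (auto intro!: Bochner_Integration.integral_cong simp: X2 algebra_simps)
  have "(\<integral>x. h x * X (Suc n) x \<partial>M) = (\<integral>x. h x * \<mu> n x \<partial>M) \<and>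
    (\<integral>x. h x * (X (Suc n) x)\<^sup>2 \<partial>M) = (\<integral>x. h x * \<nu> n x \<partial>M)"
  proof (cases "n = 0")
    \<comment> \<open>At n = 0 the test function is constant, and the first-step values of
      \<open>\<mu>\<close> and \<open>\<nu>\<close> are p - q and p + q.\<close>
    case True
    obtain d where d: "\<And>x. x \<in> space M \<Longrightarrow> h x = d" using nat_filtr_0_const[of h M X] h True by metis
    have D: "(\<integral>x. h x * f x \<partial>M) = d * (\<integral>x. f x \<partial>M)" for f
      using d by (subst integral_mult_right_zero[symmetric]) (intro Bochner_Integration.integral_cong, auto)
    have eI: "(\<integral>x. I 1 x \<partial>M) = p" "(\<integral>x. I (-1) x \<partial>M) = q"
      using init True by (simp_all add: I_def Int_def conj_commute)
    show ?thesis unfolding E1 E2 D eI using True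
      by (simp add: \<mu>_def \<nu>_def prob_space algebra_simps)
  next
    case False
    have n1: "n \<ge> 1" using False by simp
    interpret C: finite_measure_subalgebra M "F n"
      by (intro finite_measure_subalgebra.intro finite_measure_subalgebra_axioms.intro subalg) unfold_locales
    define g where "g a x = \<theta> * (real (card {i \<in> {1..n}. X i x = a}) / real n * p
                 + real (card {i \<in> {1..n}. X i x = -a}) / real n * q) + (1 - \<theta>) * (if a = 1 then p else q)" for a x
    \<comment> \<open>P and Q are the conditional probabilities of +1 and -1, rewritten as half the
      sum and half the difference of conditional second moment and conditional mean.\<close>
    define P where "P x = (\<gamma> * (N n x / n) + \<tau> + (S n x / n / 2 + \<omega>)) / 2" for x
    define Q where "Q x = (\<gamma> * (N n x / n) + \<tau> - (S n x / n / 2 + \<omega>)) / 2" for x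
    have half: "(p - q) * \<theta> * a = a / 2" for a using critical by simp
    have [measurable]: "S n \<in> borel_measurable M" "N n \<in> borel_measurable M"
      using S_adapted N_adapted F_measurable_M by auto
    have pl: "(\<integral>x. h x * I 1 x \<partial>M) = (\<integral>x. h x * P x \<partial>M)"
    proof -
      have "(\<integral>x. h x * I 1 x \<partial>M) = (\<integral>x. h x * real_cond_exp M (F n) (I 1) x \<partial>M)"
        by (rule C.real_cond_exp_intg(2)[symmetric, OF iI h]) measurable
      also have "\<dots> = (\<integral>x. h x * P x \<partial>M)"
      proof (rule integral_cong_AE)
        show "AE x in M. h x * real_cond_exp M (F n) (I 1) x = h x * P x"
          using step_plus[OF n1] AE_space
        proof eventually_elim
          case (elim x)
          have "\<theta> * ((N n x + S n x) / 2 / n * p + (N n x - S n x) / 2 / n * q) + (1 - \<theta>) * p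
            = ((p + q) * \<theta> * (N n x / n) + (1 - \<theta>) * (p + q) + ((p - q) * \<theta> * (S n x / n) + (p - q) * (1 - \<theta>))) / 2"
            using False by (simp add: field_simps)
          then show ?case using elim False unfolding card_plus_minus[OF elim(2)] I_def half
            by (simp add: P_def \<gamma>_def \<tau>_def \<omega>_def)
        qed
      qed (auto simp: P_def)
      finally show ?thesis .
    qed
    have mi: "(\<integral>x. h x * I (-1) x \<partial>M) = (\<integral>x. h x * Q x \<partial>M)"
    proof -
      have "(\<integral>x. h x * I (-1) x \<partial>M) = (\<integral>x. h x * real_cond_exp M (F n) (I (-1)) x \<partial>M)"
        by (rule C.real_cond_exp_intg(2)[symmetric, OF iI h]) measurable
      also have "\<dots> = (\<integral>x. h x * Q x \<partial>M)"
      proof (rule integral_cong_AE)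
        show "AE x in M. h x * real_cond_exp M (F n) (I (-1)) x = h x * Q x"
          using step_minus[OF n1] AE_space
        proof eventually_elim
          case (elim x)
          have "\<theta> * ((N n x - S n x) / 2 / n * p + (N n x + S n x) / 2 / n * q) + (1 - \<theta>) * q
            = ((p + q) * \<theta> * (N n x / n) + (1 - \<theta>) * (p + q) - ((p - q) * \<theta> * (S n x / n) + (p - q) * (1 - \<theta>))) / 2"
            using False by (simp add: field_simps)
          then show ?case using elim False unfolding card_plus_minus[OF elim(2)] I_def half
            by (simp add: Q_def \<gamma>_def \<tau>_def \<omega>_def)
        qed
      qed (auto simp: Q_def)
      finally show ?thesis .
    qed
    have PQ: "P x + Q x = \<nu> n x" "P x - Q x = \<mu> n x" for x
      using False by (simp_all add: P_def Q_def \<mu>_def \<nu>_def field_simps)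
    have PQ': "P x = (\<nu> n x + \<mu> n x) / 2" "Q x = (\<nu> n x - \<mu> n x) / 2" for x
      using PQ[of x] by (simp_all add: field_simps)
    have b: "\<bar>P x\<bar> \<le> 1" "\<bar>Q x\<bar> \<le> 1" if "x \<in> space M" for x
      using \<mu>_bound[OF that, of n] \<nu>_bound[OF that, of n] unfolding PQ' by (auto simp: abs_le_iff)
    have c0: "0 \<le> c" if "x \<in> space M" for x using hb[OF that] by simp
    have iP: "integrable M (\<lambda>x. h x * P x)"
    proof (rule integrable_abs_bounded[where c = "c * 1"])
      show "\<bar>h x * P x\<bar> \<le> c * 1" if "x \<in> space M" for x unfolding abs_mult
        using hb[OF that] b[OF that] c0[OF that] by (intro mult_mono) auto
    qed (unfold P_def, measurable)
    have iQ: "integrable M (\<lambda>x. h x * Q x)"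
    proof (rule integrable_abs_bounded[where c = "c * 1"])
      show "\<bar>h x * Q x\<bar> \<le> c * 1" if "x \<in> space M" for x unfolding abs_mult
        using hb[OF that] b[OF that] c0[OF that] by (intro mult_mono) auto
    qed (unfold Q_def, measurable)
    show ?thesis
      unfolding E1 E2 pl mi Bochner_Integration.integral_diff[symmetric, OF iP iQ]
        Bochner_Integration.integral_add[symmetric, OF iP iQ] PQ[symmetric]
      by (simp add: algebra_simps)
  qed
  then show "(\<integral>x. h x * X (Suc n) x \<partial>M) = (\<integral>x. h x * \<mu> n x \<partial>M)"
    "(\<integral>x. h x * (X (Suc n) x)\<^sup>2 \<partial>M) = (\<integral>x. h x * \<nu> n x \<partial>M)" by auto
qed

section \<open>Centred innovations and their conditional variance\<close>

definition \<xi> :: "nat \<Rightarrow> 'a \<Rightarrow> real" where "\<xi> n x = X (Suc n) x - \<mu> n x"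
definition v :: "nat \<Rightarrow> 'a \<Rightarrow> real" where "v n x = \<nu> n x - (\<mu> n x)\<^sup>2"
text \<open>This is Gamma(k+1) / Gamma(k+3/2), as the Pochhammer symbol equals Gamma(k+3/2) / sqrt
  pi.\<close>

definition weight :: "nat \<Rightarrow> real" where "weight k = fact k / (pochhammer (1 / 2) (Suc k) * sqrt pi)"

lemma F_mono_measurable:
  assumes "f \<in> borel_measurable (F m)" "m \<le> n"
  shows "f \<in> borel_measurable (F n)"
  by (rule measurable_from_subalg[OF _ assms(1)]) (use nat_filtr_mono[OF assms(2)] in \<open>simp add: subalgebra_def\<close>)

lemma X_measurable: "X (Suc n) \<in> borel_measurable (F (Suc n))"
  by (rule measurable_nat_filtr) auto

lemma step_centered:
  assumes h: "h \<in> borel_measurable (F n)" and hb: "\<And>x. x \<in> space M \<Longrightarrow> \<bar>h x\<bar> \<le> c"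
  shows "(\<integral>x. h x * \<xi> n x \<partial>M) = 0"
    and "(\<integral>x. h x * (\<xi> n x)\<^sup>2 \<partial>M) = (\<integral>x. h x * v n x \<partial>M)"
    and "(\<integral>x. h x * ((X (Suc n) x)\<^sup>2 - \<nu> n x) \<partial>M) = 0"
proof -
  have [measurable]: "h \<in> borel_measurable M" "\<mu> n \<in> borel_measurable M" "\<nu> n \<in> borel_measurable M" "X (Suc n) \<in> borel_measurable M"
    using h \<mu>_adapted \<nu>_adapted F_measurable_M meas by auto
  have int: "integrable M (\<lambda>x. h x * f x)"
    if [measurable]: "f \<in> borel_measurable M" and fb: "\<And>x. x \<in> space M \<Longrightarrow> \<bar>f x\<bar> \<le> 1" for f
  proof (rule integrable_abs_bounded[where c = c])
    show "\<bar>h x * f x\<bar> \<le> c" if x: "x \<in> space M" for x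
    proof -
      have "\<bar>h x * f x\<bar> \<le> c * 1" unfolding abs_mult
        using hb[OF x] fb[OF x] by (intro mult_mono) auto
      then show ?thesis by simp
    qed
  qed measurable
  have \<mu>2: "\<bar>(\<mu> n x)\<^sup>2\<bar> \<le> 1" if "x \<in> space M" for x
    using \<mu>_bound[OF that, of n] by (simp add: abs_square_le_1)
  have X2: "\<bar>(X (Suc n) x)\<^sup>2\<bar> \<le> 1" if "x \<in> space M" for x
    using X_bound(2)[OF that, of "Suc n"] by simp
  have \<nu>1: "\<bar>\<nu> n x\<bar> \<le> 1" if "x \<in> space M" for x using \<nu>_bound[OF that, of n] by simp
  have X\<mu>: "\<bar>\<mu> n x * X (Suc n) x\<bar> \<le> 1" if "x \<in> space M" for x
    using \<mu>_bound[OF that, of n] X_bound(1)[OF that, of "Suc n"] unfolding abs_mult by (intro mult_le_one) auto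
  have iX: "integrable M (\<lambda>x. h x * X (Suc n) x)" by (rule int) (use X_bound(1) in auto)
  have i\<mu>: "integrable M (\<lambda>x. h x * \<mu> n x)" by (rule int) (use \<mu>_bound in auto)
  have iX2: "integrable M (\<lambda>x. h x * (X (Suc n) x)\<^sup>2)" by (rule int) (use X2 in auto)
  have i\<nu>: "integrable M (\<lambda>x. h x * \<nu> n x)" by (rule int) (use \<nu>1 in auto)
  have i\<mu>2: "integrable M (\<lambda>x. h x * (\<mu> n x)\<^sup>2)" by (rule int) (use \<mu>2 in auto)
  have iX\<mu>: "integrable M (\<lambda>x. h x * (\<mu> n x * X (Suc n) x))" by (rule int) (use X\<mu> in auto)
  note mom = step_moments[OF h hb]
  show "(\<integral>x. h x * \<xi> n x \<partial>M) = 0"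
    using mom(1) iX i\<mu> by (simp add: \<xi>_def right_diff_distrib)
  show "(\<integral>x. h x * ((X (Suc n) x)\<^sup>2 - \<nu> n x) \<partial>M) = 0"
    using mom(2) iX2 i\<nu> by (simp add: right_diff_distrib)
  \<comment> \<open>The cross term of the square is a first moment with the test function h *
    \<open>\<mu> n\<close>, which is again bounded and known at time n.\<close>
  have "(\<integral>x. h x * \<mu> n x * X (Suc n) x \<partial>M) = (\<integral>x. h x * \<mu> n x * \<mu> n x \<partial>M)"
  proof (rule step_moments(1))
    show "(\<lambda>x. h x * \<mu> n x) \<in> borel_measurable (F n)" using h \<mu>_adapted[of n] by simp
    show "\<bar>h x * \<mu> n x\<bar> \<le> c" if x: "x \<in> space M" for x
    proof -
      have "\<bar>h x * \<mu> n x\<bar> \<le> c * 1" unfolding abs_mult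
        using hb[OF x] \<mu>_bound[OF x] by (intro mult_mono) auto
      then show ?thesis by simp
    qed
  qed
  then have cross: "(\<integral>x. h x * (\<mu> n x * X (Suc n) x) \<partial>M) = (\<integral>x. h x * (\<mu> n x)\<^sup>2 \<partial>M)"
    by (simp add: power2_eq_square mult.assoc)
  have "(\<integral>x. h x * (\<xi> n x)\<^sup>2 \<partial>M)
      = (\<integral>x. h x * (X (Suc n) x)\<^sup>2 - 2 * (h x * (\<mu> n x * X (Suc n) x)) + h x * (\<mu> n x)\<^sup>2 \<partial>M)"
    by (intro Bochner_Integration.integral_cong) (auto simp: \<xi>_def power2_eq_square algebra_simps)
  also have "\<dots> = (\<integral>x. h x * (X (Suc n) x)\<^sup>2 \<partial>M) - 2 * (\<integral>x. h x * (\<mu> n x * X (Suc n) x) \<partial>M) + (\<integral>x. h x * (\<mu> n x)\<^sup>2 \<partial>M)"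
    by (simp only: Bochner_Integration.integral_add[OF Bochner_Integration.integrable_diff[OF iX2 integrable_mult_right[OF iX\<mu>]] i\<mu>2]
        Bochner_Integration.integral_diff[OF iX2 integrable_mult_right[OF iX\<mu>]] integral_mult_right_zero)
  also have "\<dots> = (\<integral>x. h x * \<nu> n x \<partial>M) - (\<integral>x. h x * (\<mu> n x)\<^sup>2 \<partial>M)"
    using mom(2) unfolding cross by simp
  also have "\<dots> = (\<integral>x. h x * v n x \<partial>M)"
    using i\<nu> i\<mu>2 by (simp add: v_def right_diff_distrib)
  finally show "(\<integral>x. h x * (\<xi> n x)\<^sup>2 \<partial>M) = (\<integral>x. h x * v n x \<partial>M)" .
qed

text \<open>Orthogonality of the innovation to the past removes the cross term, even on a past
  event. The slack between \<open>\<beta>\<close> and \<open>\<beta>'\<close> lets recursions with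
  different coefficients share one growth bound.\<close>

lemma second_moment_step:
  assumes T: "T \<in> borel_measurable (F k)" "\<And>x. x \<in> space M \<Longrightarrow> \<bar>T x\<bar> \<le> B"
    and \<zeta>: "\<zeta> \<in> borel_measurable M" "\<And>x. x \<in> space M \<Longrightarrow> \<bar>\<zeta> x\<bar> \<le> 2"
    and mean: "\<And>h c. h \<in> borel_measurable (F k) \<Longrightarrow> (\<And>x. x \<in> space M \<Longrightarrow> \<bar>h x\<bar> \<le> c) \<Longrightarrow> (\<integral>x. h x * \<zeta> x \<partial>M) = 0"
    and A: "A \<in> sets (F k)" and \<beta>: "0 \<le> \<beta>" "\<beta> \<le> \<beta>'"
  shows "(\<integral>x. indicat_real A x * (\<beta> * T x + \<zeta> x)\<^sup>2 \<partial>M) \<le> \<beta>'\<^sup>2 * (\<integral>x. indicat_real A x * (T x)\<^sup>2 \<partial>M) + 4 * prob A"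
proof -
  have [measurable]: "T \<in> borel_measurable M" "\<zeta> \<in> borel_measurable M" by (rule F_measurable_M[OF T(1)]) (rule \<zeta>)
  have [measurable]: "A \<in> sets M" using A subalg[of k] by (auto simp: subalgebra_def)
  have hF: "(\<lambda>x. indicat_real A x * T x) \<in> borel_measurable (F k)" using T(1) A by simp
  have B0: "B \<ge> 0" if "x \<in> space M" for x using T(2)[OF that] by simp
  have hb: "\<bar>indicat_real A x * T x\<bar> \<le> B" if "x \<in> space M" for x
    using T(2)[OF that] B0[OF that] by (auto simp: indicator_def)
  have \<zeta>2: "(\<zeta> x)\<^sup>2 \<le> 4" if "x \<in> space M" for x
    using \<zeta>(2)[OF that] power_mono[of "\<bar>\<zeta> x\<bar>" 2 2] by simp
  have i1: "integrable M (\<lambda>x. indicat_real A x * (T x)\<^sup>2)"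
  proof (rule integrable_abs_bounded[where c = "B\<^sup>2"])
    show "\<bar>indicat_real A x * (T x)\<^sup>2\<bar> \<le> B\<^sup>2" if "x \<in> space M" for x
      using power_mono[OF T(2)[OF that], of 2] by (auto simp: indicator_def)
  qed measurable
  have i2: "integrable M (\<lambda>x. indicat_real A x * T x * \<zeta> x)"
  proof (rule integrable_abs_bounded[where c = "B * 2"])
    show "\<bar>indicat_real A x * T x * \<zeta> x\<bar> \<le> B * 2" if "x \<in> space M" for x
      unfolding abs_mult[of _ "\<zeta> x"] using hb[OF that] \<zeta>(2)[OF that] B0[OF that] by (intro mult_mono) auto
  qed measurable
  have i3: "integrable M (\<lambda>x. indicat_real A x * (\<zeta> x)\<^sup>2)"
  proof (rule integrable_abs_bounded[where c = 4])
    show "\<bar>indicat_real A x * (\<zeta> x)\<^sup>2\<bar> \<le> 4" if "x \<in> space M" for x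
      using \<zeta>2[OF that] by (auto simp: indicator_def)
  qed measurable
  have "(\<integral>x. indicat_real A x * (\<beta> * T x + \<zeta> x)\<^sup>2 \<partial>M) =
    (\<integral>x. \<beta>\<^sup>2 * (indicat_real A x * (T x)\<^sup>2) + 2 * \<beta> * (indicat_real A x * T x * \<zeta> x) + indicat_real A x * (\<zeta> x)\<^sup>2 \<partial>M)"
    by (intro Bochner_Integration.integral_cong) (auto simp: power2_eq_square algebra_simps)
  also have "\<dots> = \<beta>\<^sup>2 * (\<integral>x. indicat_real A x * (T x)\<^sup>2 \<partial>M) + 2 * \<beta> * (\<integral>x. indicat_real A x * T x * \<zeta> x \<partial>M)
      + (\<integral>x. indicat_real A x * (\<zeta> x)\<^sup>2 \<partial>M)"
    by (simp only: Bochner_Integration.integral_add[OF Bochner_Integration.integrable_add[OF integrable_mult_right[OF i1] integrable_mult_right[OF i2]] i3]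
        Bochner_Integration.integral_add[OF integrable_mult_right[OF i1] integrable_mult_right[OF i2]] integral_mult_right_zero)
  also have "(\<integral>x. indicat_real A x * T x * \<zeta> x \<partial>M) = 0" by (rule mean[OF hF hb])
  also have "\<beta>\<^sup>2 * (\<integral>x. indicat_real A x * (T x)\<^sup>2 \<partial>M) \<le> \<beta>'\<^sup>2 * (\<integral>x. indicat_real A x * (T x)\<^sup>2 \<partial>M)"
    using \<beta> by (intro mult_right_mono power_mono Bochner_Integration.integral_nonneg) auto
  also have "(\<integral>x. indicat_real A x * (\<zeta> x)\<^sup>2 \<partial>M) \<le> (\<integral>x. 4 * indicat_real A x \<partial>M)"
  proof (intro integral_mono i3)
    show "integrable M (\<lambda>x. 4 * indicat_real A x)" by (simp add: emeasure_eq_measure)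
  qed (use \<zeta>2 in \<open>auto simp: indicator_def\<close>)
  also have "(\<integral>x. 4 * indicat_real A x \<partial>M) = 4 * prob A" by simp
  finally show ?thesis by simp
qed

text \<open>Fixed point of d -> d/2 + \<open>\<omega>\<close>, around which S_k/k contracts;
  likewise \<open>activity\<close> is the fixed point of a -> \<open>\<gamma>\<close> a +
  \<open>\<tau>\<close> for N_k/k.\<close>

definition drift :: real where "drift = 2 * \<omega>"
definition activity :: real where "activity = \<tau> / (1 - \<gamma>)"

lemma \<phi>_eq: "\<phi> = activity - drift\<^sup>2"
  unfolding \<phi>_def activity_def drift_def critical by simp

lemma drift_activity: "0 \<le> drift" "drift \<le> 1" "0 \<le> activity" "activity \<le> 1" "\<gamma> * activity + \<tau> = activity"
  using parameter_bounds by (auto simp: drift_def activity_def divide_le_eq field_simps)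

text \<open>Subtracting the fixed point times k removes the constants from both recursions, leaving
  T_(k+1) = (1 + g/k) T_k + noise with g < 1: slower growth than k itself, hence contraction of the
  averages.\<close>

lemma second_moment_bounds:
  obtains D where "D > 0"
    "\<And>A m k. A \<in> sets (F m) \<Longrightarrow> m \<ge> 1 \<Longrightarrow> m\<^sup>2 \<le> k \<Longrightarrow>
      (\<integral>x. indicat_real A x * (S k x - drift * real k)\<^sup>2 \<partial>M) \<le> D * prob A * (real k)\<^sup>2 * real (Suc k) powr (- ((1 - \<gamma>) / 2))"
    "\<And>A m k. A \<in> sets (F m) \<Longrightarrow> m \<ge> 1 \<Longrightarrow> m\<^sup>2 \<le> k \<Longrightarrow>
      (\<integral>x. indicat_real A x * (N k x - activity * real k)\<^sup>2 \<partial>M) \<le> D * prob A * (real k)\<^sup>2 * real (Suc k) powr (- ((1 - \<gamma>) / 2))"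
proof -
  obtain D where D: "D > 0" "\<And>e m k P. P \<ge> 0 \<Longrightarrow> m \<ge> 1 \<Longrightarrow> m\<^sup>2 \<le> k \<Longrightarrow> (\<And>i. e i \<ge> 0) \<Longrightarrow> e m \<le> 4 * P * (real m)\<^sup>2 \<Longrightarrow>
    (\<And>i. i \<ge> m \<Longrightarrow> e (Suc i) \<le> (1 + \<gamma> / real i)\<^sup>2 * e i + 4 * P) \<Longrightarrow>
    e k \<le> D * P * (real k)\<^sup>2 * real (Suc k) powr (- ((1 - \<gamma>) / 2))"
    using second_moment_growth[OF parameter_bounds(1,2)] by blast
  \<comment> \<open>Used with g = 1/2 for \<open>S\<close> and g = \<open>\<gamma>\<close> for
    \<open>N\<close>; since 1/2 <= \<open>\<gamma>\<close>, both obey the rate belonging to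
    \<open>\<gamma>\<close>.\<close>
  have growth: "(\<integral>x. indicat_real A x * (T k x)\<^sup>2 \<partial>M) \<le> D * prob A * (real k)\<^sup>2 * real (Suc k) powr (- ((1 - \<gamma>) / 2))"
    if A: "A \<in> sets (F m)" and m: "m \<ge> 1" "m\<^sup>2 \<le> k"
      and T: "\<And>k. T k \<in> borel_measurable (F k)" "\<And>k x. x \<in> space M \<Longrightarrow> \<bar>T k x\<bar> \<le> 2 * real k"
      and \<zeta>: "\<And>k. \<zeta> k \<in> borel_measurable M" "\<And>k x. x \<in> space M \<Longrightarrow> \<bar>\<zeta> k x\<bar> \<le> 2"
      and mean: "\<And>k h c. h \<in> borel_measurable (F k) \<Longrightarrow> (\<And>x. x \<in> space M \<Longrightarrow> \<bar>h x\<bar> \<le> c) \<Longrightarrow> (\<integral>x. h x * \<zeta> k x \<partial>M) = 0"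
      and rec: "\<And>k x. k \<ge> 1 \<Longrightarrow> T (Suc k) x = (1 + g / real k) * T k x + \<zeta> k x"
      and g: "0 \<le> g" "g \<le> \<gamma>" for A m k T \<zeta> g
  proof (rule D(2)[OF _ m])
    have AM: "A \<in> sets M" using A subalg[of m] by (auto simp: subalgebra_def)
    show "0 \<le> (\<integral>x. indicat_real A x * (T i x)\<^sup>2 \<partial>M)" for i by (intro Bochner_Integration.integral_nonneg) auto
    show "(\<integral>x. indicat_real A x * (T m x)\<^sup>2 \<partial>M) \<le> 4 * prob A * (real m)\<^sup>2"
    proof -
      have [measurable]: "T m \<in> borel_measurable M" "A \<in> sets M" using F_measurable_M[OF T(1)] AM by auto
      have bd: "indicat_real A x * (T m x)\<^sup>2 \<le> (4 * (real m)\<^sup>2) * indicat_real A x" if "x \<in> space M" for x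
        using power_mono[OF T(2)[OF that, of m], of 2] by (auto simp: indicator_def power_mult_distrib)
      have "(\<integral>x. indicat_real A x * (T m x)\<^sup>2 \<partial>M) \<le> (\<integral>x. (4 * (real m)\<^sup>2) * indicat_real A x \<partial>M)"
      proof (rule integral_mono)
        show "integrable M (\<lambda>x. indicat_real A x * (T m x)\<^sup>2)"
        proof (rule integrable_abs_bounded[where c = "4 * (real m)\<^sup>2"])
          show "\<bar>indicat_real A x * (T m x)\<^sup>2\<bar> \<le> 4 * (real m)\<^sup>2" if "x \<in> space M" for x
            using bd[OF that] by (auto simp: indicator_def)
        qed measurable
      qed (use bd in \<open>auto simp: emeasure_eq_measure\<close>)
      then show ?thesis using AM by (simp add: mult_ac)
    qed
    fix i assume i: "i \<ge> m"
    have AF: "A \<in> sets (F i)" using A nat_filtr_mono[OF i] by blast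
    have "(\<integral>x. indicat_real A x * (T (Suc i) x)\<^sup>2 \<partial>M) = (\<integral>x. indicat_real A x * ((1 + g / real i) * T i x + \<zeta> i x)\<^sup>2 \<partial>M)"
      using rec[of i] i m by simp
    also have "\<dots> \<le> (1 + \<gamma> / real i)\<^sup>2 * (\<integral>x. indicat_real A x * (T i x)\<^sup>2 \<partial>M) + 4 * prob A"
      by (rule second_moment_step[OF T \<zeta> mean AF]) (use g in \<open>auto intro: divide_right_mono\<close>)
    finally show "(\<integral>x. indicat_real A x * (T (Suc i) x)\<^sup>2 \<partial>M) \<le> (1 + \<gamma> / real i)\<^sup>2 * (\<integral>x. indicat_real A x * (T i x)\<^sup>2 \<partial>M) + 4 * prob A" .
  qed simp
  have meas_M: "\<mu> k \<in> borel_measurable M" "\<nu> k \<in> borel_measurable M" "X (Suc k) \<in> borel_measurable M" for k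
    using \<mu>_adapted \<nu>_adapted F_measurable_M meas by auto
  show thesis
  proof (rule that[OF D(1)])
    fix A m k assume A: "A \<in> sets (F m)" and m: "m \<ge> 1" "m\<^sup>2 \<le> k"
    show "(\<integral>x. indicat_real A x * (S k x - drift * real k)\<^sup>2 \<partial>M) \<le> D * prob A * (real k)\<^sup>2 * real (Suc k) powr (- ((1 - \<gamma>) / 2))"
    proof (rule growth[of A m k "\<lambda>k x. S k x - drift * real k" \<xi> "1 / 2", OF A m])
      show "(\<lambda>x. S k x - drift * real k) \<in> borel_measurable (F k)" for k using S_adapted[of k] by simp
      show "\<bar>S k x - drift * real k\<bar> \<le> 2 * real k" if "x \<in> space M" for k x
      proof -
        have "\<bar>drift * real k\<bar> \<le> 1 * real k" unfolding abs_mult using drift_activity by (intro mult_mono) auto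
        then show ?thesis using S_bound[OF that, of k] by linarith
      qed
      show "\<xi> k \<in> borel_measurable M" for k unfolding \<xi>_def using meas_M by simp
      show "\<bar>\<xi> k x\<bar> \<le> 2" if "x \<in> space M" for k x
        using \<mu>_bound[OF that, of k] X_bound(1)[OF that, of "Suc k"] by (simp add: \<xi>_def abs_le_iff)
      show "S (Suc k) x - drift * real (Suc k) = (1 + 1 / 2 / real k) * (S k x - drift * real k) + \<xi> k x" if "k \<ge> 1" for k x
        using that by (simp add: S_Suc \<xi>_def \<mu>_def drift_def field_simps)
    qed (use step_centered(1) parameter_bounds in auto)
    show "(\<integral>x. indicat_real A x * (N k x - activity * real k)\<^sup>2 \<partial>M) \<le> D * prob A * (real k)\<^sup>2 * real (Suc k) powr (- ((1 - \<gamma>) / 2))"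
    proof (rule growth[of A m k "\<lambda>k x. N k x - activity * real k" "\<lambda>k x. (X (Suc k) x)\<^sup>2 - \<nu> k x" \<gamma>, OF A m])
      show "(\<lambda>x. N k x - activity * real k) \<in> borel_measurable (F k)" for k using N_adapted[of k] by simp
      show "\<bar>N k x - activity * real k\<bar> \<le> 2 * real k" if "x \<in> space M" for k x
      proof -
        have "\<bar>activity * real k\<bar> \<le> 1 * real k" unfolding abs_mult using drift_activity by (intro mult_mono) auto
        then show ?thesis using N_bound[OF that, of k] by linarith
      qed
      show "(\<lambda>x. (X (Suc k) x)\<^sup>2 - \<nu> k x) \<in> borel_measurable M" for k using meas_M by simp
      show "\<bar>(X (Suc k) x)\<^sup>2 - \<nu> k x\<bar> \<le> 2" if "x \<in> space M" for k x
        using \<nu>_bound[OF that, of k] X_bound(2)[OF that, of "Suc k"] zero_le_power2[of "X (Suc k) x"]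
        by (intro abs_leI) linarith+
      show "N (Suc k) x - activity * real (Suc k) = (1 + \<gamma> / real k) * (N k x - activity * real k) + ((X (Suc k) x)\<^sup>2 - \<nu> k x)"
        if "k \<ge> 1" for k x
      proof -
        have t: "\<tau> = activity - \<gamma> * activity" using drift_activity(5) by simp
        have "(1 + \<gamma> / real k) * (N k x - activity * real k) = N k x - activity * real k + \<gamma> * (N k x / real k) - \<gamma> * activity"
          using that by (simp add: field_simps)
        then show ?thesis using that by (simp add: N_Suc \<nu>_def t algebra_simps)
      qed
    qed (use step_centered(3) parameter_bounds in auto)
  qed
qed

text \<open>The conditional variance is linear in the second average and quadratic in the first; the
  difference of squares factors as (\<mu> - drift)(\<mu> + drift), where half of the second factor
  is at most 1 in modulus. Multiplying by k throughout avoids the quotients.\<close>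

lemma v_near_\<phi>:
  assumes x: "x \<in> space M" and k: "k \<ge> 1"
  shows "(v k x - \<phi>)\<^sup>2 * (real k)\<^sup>2 \<le> 2 * (N k x - activity * real k)\<^sup>2 + 2 * (S k x - drift * real k)\<^sup>2"
proof -
  define a c where "a = N k x - activity * real k" and "c = S k x - drift * real k"
  have k0: "real k > 0" using k by simp
  have \<nu>: "(\<nu> k x - activity) * real k = \<gamma> * a"
  proof -
    have t: "\<tau> = activity - \<gamma> * activity" using drift_activity(5) by simp
    have "\<nu> k x * real k = \<gamma> * N k x + \<tau> * real k" using k by (simp add: \<nu>_def field_simps)
    then have "(\<nu> k x - activity) * real k = \<gamma> * N k x + \<tau> * real k - activity * real k"
      by (simp add: left_diff_distrib)
    then show ?thesis unfolding a_def by (simp add: t algebra_simps)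
  qed
  have \<mu>: "(\<mu> k x - drift) * real k = c / 2"
    using k by (simp add: \<mu>_def c_def drift_def field_simps)
  have "(v k x - \<phi>) * real k = (\<nu> k x - activity) * real k - (\<mu> k x - drift) * real k * (\<mu> k x + drift)"
    unfolding v_def \<phi>_eq by (simp add: power2_eq_square algebra_simps)
  also have "\<dots> = \<gamma> * a - c * ((\<mu> k x + drift) / 2)" unfolding \<nu> \<mu> by simp
  finally have eq: "(v k x - \<phi>) * real k = \<gamma> * a - c * ((\<mu> k x + drift) / 2)" .
  have "\<bar>\<gamma> * a\<bar> \<le> 1 * \<bar>a\<bar>" unfolding abs_mult using parameter_bounds by (intro mult_right_mono) auto
  then have a2: "(\<gamma> * a)\<^sup>2 \<le> a\<^sup>2" by (simp add: abs_le_square_iff)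
  have "\<bar>(\<mu> k x + drift) / 2\<bar> \<le> 1" using \<mu>_bound[OF x, of k] drift_activity by (simp add: abs_le_iff)
  then have "\<bar>c * ((\<mu> k x + drift) / 2)\<bar> \<le> \<bar>c\<bar> * 1" unfolding abs_mult by (intro mult_left_mono) auto
  then have c2: "(c * ((\<mu> k x + drift) / 2))\<^sup>2 \<le> c\<^sup>2" unfolding abs_le_square_iff[symmetric] by simp
  have "(y - z)\<^sup>2 \<le> 2 * y\<^sup>2 + 2 * z\<^sup>2" for y z :: real
    using zero_le_power2[of "y + z"] by (simp add: power2_eq_square algebra_simps)
  from this[of "\<gamma> * a" "c * ((\<mu> k x + drift) / 2)"]
  have "((v k x - \<phi>) * real k)\<^sup>2 \<le> 2 * (\<gamma> * a)\<^sup>2 + 2 * (c * ((\<mu> k x + drift) / 2))\<^sup>2" unfolding eq .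
  with a2 c2 show ?thesis unfolding a_def c_def power_mult_distrib by linarith
qed

lemma v_bound: "x \<in> space M \<Longrightarrow> \<bar>v n x\<bar> \<le> 1"
proof -
  assume x: "x \<in> space M"
  have "(\<mu> n x)\<^sup>2 \<le> 1" using \<mu>_bound[OF x, of n] by (simp add: abs_square_le_1)
  then show ?thesis using \<nu>_bound[OF x, of n] zero_le_power2[of "\<mu> n x"] unfolding v_def by (intro abs_leI) linarith+
qed

lemma v_measurable: "v n \<in> borel_measurable (F n)"
  using \<mu>_adapted[of n] \<nu>_adapted[of n] unfolding v_def by simp

text \<open>The mean-square rate (1 - \<gamma>)/2 of the averages carries over to \<open>v\<close>;
  it is written as 2\<kappa> with \<kappa> = (1 - \<gamma>)/4 to match the martingale
  locale.\<close>

lemma v_close: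
  obtains C where "C \<ge> 0" "\<And>A m k. A \<in> sets (F m) \<Longrightarrow> m\<^sup>2 \<le> k \<Longrightarrow>
      (\<integral>x. indicat_real A x * (v k x - \<phi>)\<^sup>2 \<partial>M) \<le> C * real (Suc k) powr (-2 * ((1 - \<gamma>) / 4)) * prob A"
proof -
  obtain D where D: "D > 0"
    "\<And>A m k. A \<in> sets (F m) \<Longrightarrow> m \<ge> 1 \<Longrightarrow> m\<^sup>2 \<le> k \<Longrightarrow>
      (\<integral>x. indicat_real A x * (S k x - drift * real k)\<^sup>2 \<partial>M) \<le> D * prob A * (real k)\<^sup>2 * real (Suc k) powr (- ((1 - \<gamma>) / 2))"
    "\<And>A m k. A \<in> sets (F m) \<Longrightarrow> m \<ge> 1 \<Longrightarrow> m\<^sup>2 \<le> k \<Longrightarrow>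
      (\<integral>x. indicat_real A x * (N k x - activity * real k)\<^sup>2 \<partial>M) \<le> D * prob A * (real k)\<^sup>2 * real (Suc k) powr (- ((1 - \<gamma>) / 2))"
    using second_moment_bounds by blast
  show thesis
  proof (rule that[of "4 + 4 * D"])
    show "4 + 4 * D \<ge> 0" using D by simp
    fix A m k assume A: "A \<in> sets (F m)" and mk: "m\<^sup>2 \<le> (k::nat)"
    have AM: "A \<in> sets M" using A subalg[of m] by (auto simp: subalgebra_def)
    have [measurable]: "v k \<in> borel_measurable M" "S k \<in> borel_measurable M" "N k \<in> borel_measurable M" "A \<in> sets M"
      using F_measurable_M[OF v_measurable] F_measurable_M[OF S_adapted] F_measurable_M[OF N_adapted] AM by auto
    have dr: "\<bar>drift\<bar> \<le> 1" "\<bar>activity\<bar> \<le> 1" using drift_activity by auto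
    have "drift\<^sup>2 \<le> 1" using dr by (simp add: abs_square_le_1)
    then have "\<bar>\<phi>\<bar> \<le> 1" using drift_activity zero_le_power2[of drift] unfolding \<phi>_eq by (intro abs_leI) linarith+
    then have v4: "(v k x - \<phi>)\<^sup>2 \<le> 4" if "x \<in> space M" for x
      using v_bound[OF that, of k] power_mono[of "\<bar>v k x - \<phi>\<bar>" 2 2] by simp
    have iv: "integrable M (\<lambda>x. indicat_real A x * (v k x - \<phi>)\<^sup>2)"
    proof (rule integrable_abs_bounded[where c = 4])
      show "\<bar>indicat_real A x * (v k x - \<phi>)\<^sup>2\<bar> \<le> 4" if "x \<in> space M" for x
        using v4[OF that] by (auto simp: indicator_def)
    qed measurable
    show "(\<integral>x. indicat_real A x * (v k x - \<phi>)\<^sup>2 \<partial>M) \<le> (4 + 4 * D) * real (Suc k) powr (-2 * ((1 - \<gamma>) / 4)) * prob A"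
    proof (cases "k = 0")
      \<comment> \<open>At k = 0 \<open>v\<close> comes from the separate first-step values, so only
        the trivial bound applies; the power of \<open>Suc 0\<close> equals 1.\<close>
      case True
      have "(\<integral>x. indicat_real A x * (v k x - \<phi>)\<^sup>2 \<partial>M) \<le> (\<integral>x. 4 * indicat_real A x \<partial>M)"
      proof (rule integral_mono[OF iv])
        show "integrable M (\<lambda>x. 4 * indicat_real A x)" by (simp add: emeasure_eq_measure)
      qed (use v4 in \<open>auto simp: indicator_def\<close>)
      also have "\<dots> = 4 * prob A" by simp
      also have "\<dots> \<le> (4 + 4 * D) * prob A" using D by (intro mult_right_mono) auto
      finally show ?thesis using True by simp
    next
      case False
      then have k: "k \<ge> 1" by simp
      \<comment> \<open>The recursions start at time 1, so events at time 0 are regarded as events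
        at time 1; the lag condition survives because k >= 1.\<close>
      define m' where "m' = max m 1"
      have m': "m' \<ge> 1" "m'\<^sup>2 \<le> k" "m \<le> m'" using mk k by (auto simp: m'_def max_def)
      have A': "A \<in> sets (F m')" using A nat_filtr_mono[OF m'(3)] by blast
      have k2: "(real k)\<^sup>2 > 0" using k by simp
      have iT: "integrable M (\<lambda>x. indicat_real A x * (T x)\<^sup>2)"
        if [measurable]: "T \<in> borel_measurable M" and bd: "\<And>x. x \<in> space M \<Longrightarrow> \<bar>T x\<bar> \<le> 2 * real k" for T
      proof (rule integrable_abs_bounded[where c = "(2 * real k)\<^sup>2"])
        show "\<bar>indicat_real A x * (T x)\<^sup>2\<bar> \<le> (2 * real k)\<^sup>2" if "x \<in> space M" for x
          using power_mono[OF bd[OF that], of 2] by (auto simp: indicator_def)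
      qed measurable
      have dk: "\<bar>drift * real k\<bar> \<le> 1 * real k" "\<bar>activity * real k\<bar> \<le> 1 * real k"
        unfolding abs_mult using mult_right_mono[OF dr(1), of "real k"] mult_right_mono[OF dr(2), of "real k"] by simp_all
      have iS: "integrable M (\<lambda>x. indicat_real A x * (S k x - drift * real k)\<^sup>2)"
      proof (rule iT)
        show "\<bar>S k x - drift * real k\<bar> \<le> 2 * real k" if "x \<in> space M" for x
          using S_bound[OF that, of k] dk by linarith
      qed measurable
      have iN: "integrable M (\<lambda>x. indicat_real A x * (N k x - activity * real k)\<^sup>2)"
      proof (rule iT)
        show "\<bar>N k x - activity * real k\<bar> \<le> 2 * real k" if "x \<in> space M" for x
          using N_bound[OF that, of k] dk by linarith
      qed measurable
      define R where "R = prob A * (real k)\<^sup>2 * real (Suc k) powr (- ((1 - \<gamma>) / 2))"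
      have R0: "R \<ge> 0" by (simp add: R_def)
      have "(real k)\<^sup>2 * (\<integral>x. indicat_real A x * (v k x - \<phi>)\<^sup>2 \<partial>M) = (\<integral>x. (real k)\<^sup>2 * (indicat_real A x * (v k x - \<phi>)\<^sup>2) \<partial>M)"
        by simp
      also have "\<dots> \<le> (\<integral>x. 2 * (indicat_real A x * (N k x - activity * real k)\<^sup>2) + 2 * (indicat_real A x * (S k x - drift * real k)\<^sup>2) \<partial>M)"
      proof (rule integral_mono)
        show "(real k)\<^sup>2 * (indicat_real A x * (v k x - \<phi>)\<^sup>2) \<le> 2 * (indicat_real A x * (N k x - activity * real k)\<^sup>2) + 2 * (indicat_real A x * (S k x - drift * real k)\<^sup>2)"
          if "x \<in> space M" for x
          using v_near_\<phi>[OF that k] by (cases "x \<in> A") (simp_all add: mult.commute)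
      qed (use iv iN iS in auto)
      also have "\<dots> = 2 * (\<integral>x. indicat_real A x * (N k x - activity * real k)\<^sup>2 \<partial>M) + 2 * (\<integral>x. indicat_real A x * (S k x - drift * real k)\<^sup>2 \<partial>M)"
        using iN iS by simp
      also have "\<dots> \<le> 2 * (D * R) + 2 * (D * R)"
        using D(2)[OF A' m'(1,2)] D(3)[OF A' m'(1,2)] by (simp add: R_def mult.assoc)
      also have "\<dots> \<le> (4 + 4 * D) * R" using R0 by (simp add: algebra_simps)
      finally have "(real k)\<^sup>2 * (\<integral>x. indicat_real A x * (v k x - \<phi>)\<^sup>2 \<partial>M) \<le> (real k)\<^sup>2 * ((4 + 4 * D) * real (Suc k) powr (- ((1 - \<gamma>) / 2)) * prob A)"
        by (simp only: R_def mult_ac)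
      then have "(\<integral>x. indicat_real A x * (v k x - \<phi>)\<^sup>2 \<partial>M) \<le> (4 + 4 * D) * real (Suc k) powr (- ((1 - \<gamma>) / 2)) * prob A"
        using k2 by (simp only: mult_le_cancel_left_pos)
      moreover have "-2 * ((1 - \<gamma>) / 4) = - ((1 - \<gamma>) / 2)" by (simp add: field_simps)
      ultimately show ?thesis by (simp only:)
    qed
  qed
qed

section \<open>Gamma weights and the martingale transform\<close>

lemma weight_pos: "weight k > 0"
  by (simp add: weight_def pochhammer_pos)

text \<open>The defining property of the weights: they cancel the factor 1 + 1/(2(k+1)) by which the
  centred walk is expected to grow in one step.\<close>

lemma weight_Suc: "weight (Suc k) * (1 + 1 / (2 * real (Suc k))) = weight k"
proof -
  have gen: "K * f / (z * P * s) * (z / K) = f / (P * s)" if "K \<noteq> 0" "z \<noteq> 0" for K z P f s :: real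
    using that by simp
  have "1 + 1 / (2 * real (Suc k)) = (1 / 2 + real (Suc k)) / real (Suc k)"
    by (simp add: field_simps)
  then show ?thesis
    unfolding weight_def pochhammer_rec'[of "1 / 2 :: real" "Suc k"] fact_Suc
    by (simp only:) (rule gen, auto simp: add_nonneg_eq_0_iff)
qed

lemma critical_martingale:
  assumes "\<phi> > 0"
  obtains C where "critical_martingale M F \<xi> v weight \<phi> ((1 - \<gamma>) / 4) C"
proof -
  obtain C where C: "C \<ge> 0" "\<And>A m k. A \<in> sets (F m) \<Longrightarrow> m\<^sup>2 \<le> k \<Longrightarrow>
      (\<integral>x. indicat_real A x * (v k x - \<phi>)\<^sup>2 \<partial>M) \<le> C * real (Suc k) powr (-2 * ((1 - \<gamma>) / 4)) * prob A"
    using v_close by blast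
  have 1: "\<xi> n \<in> borel_measurable (F (Suc n))" for n
    using X_measurable[of n] F_mono_measurable[OF \<mu>_adapted[of n], of "Suc n"] unfolding \<xi>_def by simp
  have 2: "\<bar>\<xi> n x\<bar> \<le> 2" if "x \<in> space M" for n x
    using \<mu>_bound[OF that, of n] X_bound(1)[OF that, of "Suc n"] by (simp add: \<xi>_def abs_le_iff)
  have 3: "\<bar>v n x\<bar> \<le> 4" if "x \<in> space M" for n x using v_bound[OF that, of n] by simp
  have 4: "(\<lambda>k. weight k * sqrt (real (Suc k))) \<longlonglongrightarrow> 1"
    using Gamma_half_weight_limit by (simp only: weight_def)
  have 5: "(1 - \<gamma>) / 4 > 0" using parameter_bounds by simp
  have "critical_martingale M F \<xi> v weight \<phi> ((1 - \<gamma>) / 4) C"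
    by (intro critical_martingale.intro critical_martingale_axioms.intro prob_space_axioms)
       (fact subalg nat_filtr_mono 1 2 v_measurable 3 step_centered(1,2) C weight_pos 4 assms 5)+
  then show thesis by (rule that)
qed

lemma S_0: "S 0 = (\<lambda>_. 0)"
  by (simp add: S_def fun_eq_iff)

lemma expectation_S_Suc: "expectation (S (Suc n)) = expectation (S n) + expectation (\<mu> n)"
proof -
  have [measurable]: "S n \<in> borel_measurable M" "X (Suc n) \<in> borel_measurable M"
    using S_adapted F_measurable_M meas by auto
  have "integrable M (S n)" by (rule integrable_abs_bounded[where c = "real n"]) (use S_bound in auto)
  moreover have "integrable M (X (Suc n))" by (rule integrable_abs_bounded[where c = 1]) (use X_bound(1) in auto)
  ultimately have "expectation (S (Suc n)) = expectation (S n) + expectation (X (Suc n))"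
    by (simp add: S_Suc[abs_def])
  also have "expectation (X (Suc n)) = expectation (\<mu> n)"
    using step_moments(1)[of "\<lambda>_. 1" n 1] by simp
  finally show ?thesis .
qed

text \<open>By \<open>weight_Suc\<close> the weighted centred walk changes exactly by a weighted
  innovation at each step, so the sum telescopes. The index is shifted because the innovation k
  drives step k+1.\<close>

lemma martingale_transform:
  assumes "n \<ge> 1"
  shows "(\<Sum>k<n. weight k * \<xi> k x) = weight (n - 1) * (S n x - expectation (S n))"
proof -
  have "(\<Sum>k<Suc n. weight k * \<xi> k x) = weight n * (S (Suc n) x - expectation (S (Suc n)))" for n
  proof (induction n)
    case 0
    have "S (Suc 0) x - expectation (S (Suc 0)) = \<xi> 0 x"
      unfolding expectation_S_Suc by (simp add: S_0 S_Suc \<xi>_def \<mu>_def[abs_def] prob_space)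
    then show ?case by simp
  next
    case (Suc n)
    have [measurable]: "S (Suc n) \<in> borel_measurable M" using S_adapted F_measurable_M by auto
    have "integrable M (S (Suc n))" by (rule integrable_abs_bounded[where c = "real (Suc n)"]) (use S_bound[of _ "Suc n"] in auto)
    then have "expectation (\<mu> (Suc n)) = expectation (S (Suc n)) / real (Suc n) / 2 + \<omega>"
      by (simp add: \<mu>_def[abs_def] prob_space del: of_nat_Suc)
    then have "S (Suc (Suc n)) x - expectation (S (Suc (Suc n)))
      = (1 + 1 / (2 * real (Suc n))) * (S (Suc n) x - expectation (S (Suc n))) + \<xi> (Suc n) x"
      unfolding expectation_S_Suc[of "Suc n"] S_Suc[of "Suc n"] \<xi>_def \<mu>_def by (simp add: field_simps del: of_nat_Suc)
    moreover have "w * a = w * \<beta> * y + w * z" if "a = \<beta> * y + z" for a \<beta> w y z :: real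
      using that by (simp add: algebra_simps)
    ultimately have "weight (Suc n) * (S (Suc (Suc n)) x - expectation (S (Suc (Suc n))))
      = weight (Suc n) * (1 + 1 / (2 * real (Suc n))) * (S (Suc n) x - expectation (S (Suc n))) + weight (Suc n) * \<xi> (Suc n) x"
      by blast
    then show ?case using Suc.IH unfolding weight_Suc by simp
  qed
  from this[of "n - 1"] assms show ?thesis by simp
qed

theorem limit_theorems:
  assumes pos: "\<phi> > 0"
  shows "weak_conv_m (\<lambda>n. distr M borel (\<lambda>x. (S n x - expectation (S n)) / sqrt (\<phi> * real n * ln (real n)))) std_normal_distribution"
    and "AE x in M. limsup (\<lambda>n. ereal ((S n x - expectation (S n)) /
      sqrt (2 * \<phi> * real n * ln (real n) * ln (ln (\<phi> * Gamma (3 / 2) * ln (real n)))))) = 1"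
    and "AE x in M. limsup (\<lambda>n. ereal (- (S n x - expectation (S n)) /
      sqrt (2 * \<phi> * real n * ln (real n) * ln (ln (\<phi> * Gamma (3 / 2) * ln (real n)))))) = 1"
proof -
  obtain C where "critical_martingale M F \<xi> v weight \<phi> ((1 - \<gamma>) / 4) C"
    using critical_martingale[OF pos] .
  then interpret W: critical_martingale M F \<xi> v weight \<phi> "(1 - \<gamma>) / 4" C .
  interpret U: critical_martingale M F "\<lambda>n x. - \<xi> n x" v weight \<phi> "(1 - \<gamma>) / 4" C
    by (rule W.uminus_critical_martingale)
  \<comment> \<open>At n = 0 the truncated index n - 1 is harmless, since the walk and the
    martingale both vanish there.\<close>
  have scale: "(S n x - expectation (S n)) / c = W.W n x / (weight (n - 1) * c)" for n x c
  proof (cases "n = 0")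
    case True
    then show ?thesis by (simp add: W.W_def S_0)
  next
    case False
    then show ?thesis using martingale_transform[of n x] weight_pos[of "n - 1"] by (simp add: W.W_def)
  qed
  have UW: "U.W n x = - W.W n x" for n x by (simp add: U.W_def W.W_def sum_negf)
  have w: "(\<lambda>n. weight (n - 1) * sqrt (real n)) \<longlonglongrightarrow> 1"
    by (rule LIMSEQ_imp_Suc) (use W.b_lim in simp)
  have "(\<lambda>n. weight (n - 1) * sqrt (real n) * sqrt \<phi>) \<longlonglongrightarrow> 1 * sqrt \<phi>"
    by (intro tendsto_intros w)
  moreover have "eventually (\<lambda>n. weight (n - 1) * sqrt (real n) * sqrt \<phi> = weight (n - 1) * sqrt (\<phi> * real n * ln (real n)) / sqrt (ln (real n))) sequentially"
    using eventually_gt_at_top[of 1] by eventually_elim (simp add: real_sqrt_mult)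
  ultimately have "(\<lambda>n. weight (n - 1) * sqrt (\<phi> * real n * ln (real n)) / sqrt (ln (real n))) \<longlonglongrightarrow> sqrt \<phi>"
    using Lim_transform_eventually by fastforce
  from W.central_limit[OF this]
  show "weak_conv_m (\<lambda>n. distr M borel (\<lambda>x. (S n x - expectation (S n)) / sqrt (\<phi> * real n * ln (real n)))) std_normal_distribution"
    by (simp only: scale)
  define c where "c = \<phi> * Gamma (3 / 2)"
  have c: "c > 0" using pos by (simp add: c_def Gamma_real_pos)
  define a where "a n = weight (n - 1) * sqrt (2 * \<phi> * real n * ln (real n) * ln (ln (c * ln (real n))))" for n
  \<comment> \<open>A positive constant inside the double logarithm changes it only by a factor
    tending to 1, so the stated normalization is equivalent to \<open>W.\<psi>\<close>.\<close>
  have "(\<lambda>n. ln (ln (c * ln (real n))) / ln (ln (ln (real n)))) \<longlonglongrightarrow> 1"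
    using c by real_asymp
  then have "(\<lambda>n. weight (n - 1) * sqrt (real n) * sqrt (ln (ln (c * ln (real n))) / ln (ln (ln (real n))))) \<longlonglongrightarrow> 1 * sqrt 1"
    by (intro tendsto_mult w tendsto_real_sqrt)
  moreover have "eventually (\<lambda>n. ln (ln (ln (real n))) > 0) sequentially" by real_asymp
  then have "eventually (\<lambda>n. weight (n - 1) * sqrt (real n) * sqrt (ln (ln (c * ln (real n))) / ln (ln (ln (real n)))) = a n / W.\<psi> n) sequentially"
    using eventually_gt_at_top[of 1]
  proof eventually_elim
    case (elim n)
    then have "sqrt \<phi> > 0" "sqrt (ln (real n)) > 0" using pos by auto
    then show ?case by (simp add: a_def W.\<psi>_def real_sqrt_mult real_sqrt_divide)
  qed
  ultimately have lim: "(\<lambda>n. a n / W.\<psi> n) \<longlonglongrightarrow> 1"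
    using Lim_transform_eventually by fastforce
  show "AE x in M. limsup (\<lambda>n. ereal ((S n x - expectation (S n)) /
      sqrt (2 * \<phi> * real n * ln (real n) * ln (ln (\<phi> * Gamma (3 / 2) * ln (real n)))))) = 1"
    using W.iterated_logarithm[OF lim] by (simp only: scale a_def c_def)
  show "AE x in M. limsup (\<lambda>n. ereal (- (S n x - expectation (S n)) /
      sqrt (2 * \<phi> * real n * ln (real n) * ln (ln (\<phi> * Gamma (3 / 2) * ln (real n)))))) = 1"
    using U.iterated_logarithm[OF lim] by (simp only: UW minus_divide_left[symmetric] scale a_def c_def)
qed

end

theorem theorem2:
  fixes M :: "'a measure" and X :: "nat \<Rightarrow> 'a \<Rightarrow> real"
    and p q r \<theta> :: real
  assumes "prob_space M"
    and pqr: "p \<ge> 0" "q \<ge> 0" "r \<ge> 0" "p + q + r = 1"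
    and th: "0 \<le> \<theta>" "\<theta> < 1"
    and meas: "\<And>n. n \<ge> 1 \<Longrightarrow> X n \<in> borel_measurable M"
    and vals: "\<And>n \<omega>. n \<ge> 1 \<Longrightarrow> \<omega> \<in> space M \<Longrightarrow> X n \<omega> \<in> {-1, 0, 1}"
    and init: "measure M {\<omega> \<in> space M. X 1 \<omega> = 1} = p"
              "measure M {\<omega> \<in> space M. X 1 \<omega> = -1} = q"
              "measure M {\<omega> \<in> space M. X 1 \<omega> = 0} = r"
    and step_plus: "\<And>n. n \<ge> 1 \<Longrightarrow> AE \<omega> in M.
        real_cond_exp M (nat_filtr M X n) (indicator {\<omega> \<in> space M. X (Suc n) \<omega> = 1}) \<omega>
        = \<theta> * (real (card {i \<in> {1..n}. X i \<omega> = 1}) / real n * p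
                 + real (card {i \<in> {1..n}. X i \<omega> = -1}) / real n * q) + (1 - \<theta>) * p"
    and step_minus: "\<And>n. n \<ge> 1 \<Longrightarrow> AE \<omega> in M.
        real_cond_exp M (nat_filtr M X n) (indicator {\<omega> \<in> space M. X (Suc n) \<omega> = -1}) \<omega>
        = \<theta> * (real (card {i \<in> {1..n}. X i \<omega> = -1}) / real n * p
                 + real (card {i \<in> {1..n}. X i \<omega> = 1}) / real n * q) + (1 - \<theta>) * q"
    and step_zero: "\<And>n. n \<ge> 1 \<Longrightarrow> AE \<omega> in M.
        real_cond_exp M (nat_filtr M X n) (indicator {\<omega> \<in> space M. X (Suc n) \<omega> = 0}) \<omega>
        = \<theta> * (p + q) * (real (card {i \<in> {1..n}. X i \<omega> = 0}) / real n) + r"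
    and alpha: "(p - q) * \<theta> = 1 / 2"
    and phi_pos: "(1 - \<theta>) * (p + q) / (1 - (p + q) * \<theta>)
                  - ((p - q) * (1 - \<theta>) / (1 - (p - q) * \<theta>))\<^sup>2 > 0"
  shows
    "let \<phi> = (1 - \<theta>) * (p + q) / (1 - (p + q) * \<theta>)
               - ((p - q) * (1 - \<theta>) / (1 - (p - q) * \<theta>))\<^sup>2;
         S = (\<lambda>n \<omega>. \<Sum>i = 1..n. X i \<omega>);
         ES = (\<lambda>n. prob_space.expectation M (S n))
     in weak_conv_m
          (\<lambda>n. distr M borel (\<lambda>\<omega>. (S n \<omega> - ES n) / sqrt (\<phi> * real n * ln (real n))))
          std_normal_distribution
      \<and> (AE \<omega> in M. limsup (\<lambda>n. ereal ((S n \<omega> - ES n) /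
              sqrt (2 * \<phi> * real n * ln (real n) * ln (ln (\<phi> * Gamma (3 / 2) * ln (real n)))))) = 1)
      \<and> (AE \<omega> in M. limsup (\<lambda>n. ereal (- (S n \<omega> - ES n) /
              sqrt (2 * \<phi> * real n * ln (real n) * ln (ln (\<phi> * Gamma (3 / 2) * ln (real n)))))) = 1)"
proof -
  interpret lazy_elephant_walk M X p q r \<theta>
    by (intro lazy_elephant_walk.intro lazy_elephant_walk_axioms.intro)
       (fact assms(1) pqr th meas vals init step_plus step_minus alpha)+
  have \<phi>: "(1 - \<theta>) * (p + q) / (1 - (p + q) * \<theta>) - ((p - q) * (1 - \<theta>) / (1 - (p - q) * \<theta>))\<^sup>2 = \<phi>"
    by (simp only: \<phi>_def \<tau>_def \<gamma>_def \<omega>_def)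
  have S: "(\<lambda>\<omega>. \<Sum>i = 1..n. X i \<omega>) = S n" for n by (rule ext) (simp only: S_def)
  have S': "(\<Sum>i = 1..n. X i x) = S n x" for n x by (simp only: S_def)
  show ?thesis
    unfolding Let_def \<phi> S S' using limit_theorems phi_pos[unfolded \<phi>] by blast
qed

end
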